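(* Let $(G,\rho)$ be a non-crossing framework in the plane, with $G$ $2$-connected, with a good self-stress, and let $h:\mathbb{R}^2\to\mathbb{R}$ be the height function of its standard lifting. Then the lifting has no (horizontal) saddle points. All level curves (at heights strictly between $0$ and the maximum of $h$) are simple closed curves, and as the height increases the level curve moves monotonically from the boundary cycle of $(G,\rho)$ to the distinguished non-pointed vertex.
   Context: Framework: a finite simple graph $G=(V,E)$ with a map $\rho:V\to\mathbb{R}^2$, $\rho(i)=p_i$, edges drawn as straight segments; non-crossing if vertices are distinct points and two edge segments meet at most in a common endpoint (a vertex never lies in the interior of an edge). Vertices with two angles equal to $\pi$ are not allowed. A vertex is pointed if one of the angles between cyclically consecutive incident edges is $>\pi$, non-pointed otherwise. Self-stress: $\omega:E\to\mathbb{R}$ with $\sum_{j:ij\in E}\omega_{ij}(p_i-p_j)=0$ for every $i\in V$. Reciprocal: $G^*$ is the dual plane graph of the drawing $(G,\rho)$ (one vertex per face, including the outer one; one edge per edge); the reciprocal $(G^*,\rho^* )$ is the framework, unique up to translation, such that for every directed edge $i\to j$ with left face $L$ and right face $R$, $\rho^*(L)-\rho^*(R)=\omega_{ij}(p_j-p_i)$. It is non-crossing if it is a non-crossing framework and its embedding is dual to that of $(G,\rho)$: face cycles become vertex cycles (cyclic orders of edges around vertices) and vertex cycles become face cycles, either all with the same orientation or all with reversed orientation (orientation of the outer face being considered from outside). A good self-stress is one that is non-zero on all edges and has a non-crossing reciprocal. In that case all edges of the boundary cycle of $(G,\rho)$ have the same sign, and there is exactly one vertex around which all edges have the same sign; it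 is non-pointed, it is the vertex whose reciprocal face is the outer face of $(G^*,\rho^* )$, and it is called the distinguished non-pointed vertex. The height function $h$ of the standard lifting is the continuous function that is affine on each face (including the outer face), identically $0$ on the outer face, and satisfies, for every directed edge $i\to j$ with left face $L$ and right face $R$, $\nabla h|_L-\nabla h|_R=c\,\omega_{ij}\,J(p_j-p_i)$, where $J$ is the counterclockwise rotation by $90^\circ$ and $c\in\{1,-1\}$ is chosen so that $c\,\omega_{ij}>0$ on boundary edges (boundary edges are valleys). A (horizontal) saddle point is a point $p$ such that the horizontal plane at height $h(p)$ cuts a small neighborhood of the lifted point in the surface into at least four pieces, alternately above and below the plane. "Moves monotonically" means that the curve at a higher level lies inside the curve at a lower level. *)

theory Defs
  imports "HOL-Analysis.Analysis"
begin

text \<open>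
  The plane is the type \<^typ>\<open>complex\<close>, so multiplication by \<^term>\<open>\<i>\<close> is the counterclockwise
  rotation by 90 degrees. A graph is a vertex set \<open>V\<close> together with a set \<open>E\<close> of two-element
  subsets of \<open>V\<close>.
\<close>

definition simple_graph :: "'v set \<Rightarrow> 'v set set \<Rightarrow> bool" where
  "simple_graph V E \<longleftrightarrow> finite V \<and> (\<forall>e\<in>E. e \<subseteq> V \<and> card e = 2)"

definition graph_connected :: "'v set \<Rightarrow> 'v set set \<Rightarrow> bool" where
  "graph_connected V E \<longleftrightarrow>
     (\<forall>u\<in>V. \<forall>w\<in>V. (u, w) \<in> {(x, y). x \<in> V \<and> y \<in> V \<and> {x, y} \<in> E}\<^sup>*)"

definition two_connected :: "'v set \<Rightarrow> 'v set set \<Rightarrow> bool" where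
  "two_connected V E \<longleftrightarrow>
     3 \<le> card V \<and> graph_connected V E \<and> (\<forall>x\<in>V. graph_connected (V - {x}) E)"

text \<open>
  An edge \<open>{i, j}\<close> is traversed in two directions, by the darts \<open>(i, j)\<close> and \<open>(j, i)\<close>.
  A straight-line drawing of a graph or of its dual is given by the darts \<open>D\<close> of the original
  graph, a function \<open>t\<close> assigning to each dart its tail, and a placement \<open>q\<close> of the vertices.
  For the original graph \<open>t\<close> is \<^const>\<open>fst\<close>; for the dual graph \<open>t\<close> is the face to the left of
  the dart, so that the dual of \<open>(i, j)\<close> leads from its left face to its right face. In this way
  dual edges stay indexed by the edges of the graph, and parallel dual edges are distinct.
\<close>

definition darts :: "'v set set \<Rightarrow> ('v \<times> 'v) set" where
  "darts E = {(i, j). {i, j} \<in> E}"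

definition dart_segment ::
  "('v \<times> 'v \<Rightarrow> 'w) \<Rightarrow> ('w \<Rightarrow> complex) \<Rightarrow> 'v \<times> 'v \<Rightarrow> complex set" where
  "dart_segment t q d = closed_segment (q (t d)) (q (t (prod.swap d)))"

definition dart_ends :: "('v \<times> 'v \<Rightarrow> 'w) \<Rightarrow> 'v \<times> 'v \<Rightarrow> 'w set" where
  "dart_ends t d = {t d, t (prod.swap d)}"

text \<open>
  Counterclockwise angle from \<open>u\<close> to \<open>w\<close>, normalized to \<open>(0, 2\<pi>]\<close>: equal directions
  enclose the full angle.
\<close>

definition ccw_angle :: "complex \<Rightarrow> complex \<Rightarrow> real" where
  "ccw_angle u w = 2 * pi - Arg2pi (u / w)"

definition dart_angle ::
  "('v \<times> 'v \<Rightarrow> 'w) \<Rightarrow> ('w \<Rightarrow> complex) \<Rightarrow> 'v \<times> 'v \<Rightarrow> 'v \<times> 'v \<Rightarrow> real" where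
  "dart_angle t q d d' =
     ccw_angle (q (t (prod.swap d)) - q (t d)) (q (t (prod.swap d')) - q (t d'))"

text \<open>\<open>d'\<close> follows \<open>d\<close> in the counterclockwise order around their common tail.\<close>

definition vertex_succ ::
  "('v \<times> 'v) set \<Rightarrow> ('v \<times> 'v \<Rightarrow> 'w) \<Rightarrow> ('w \<Rightarrow> complex) \<Rightarrow> 'v \<times> 'v \<Rightarrow> 'v \<times> 'v \<Rightarrow> bool" where
  "vertex_succ D t q d d' \<longleftrightarrow>
     d \<in> D \<and> d' \<in> D \<and> t d' = t d \<and>
     (\<forall>d''\<in>D. t d'' = t d \<longrightarrow> dart_angle t q d d' \<le> dart_angle t q d d'')"

text \<open>
  \<open>d'\<close> follows \<open>d\<close> on the boundary of the face to the left of \<open>d\<close>. With the face always on the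
  left, bounded faces are traversed counterclockwise and the outer face clockwise, that is,
  counterclockwise as seen from outside.
\<close>

definition face_succ ::
  "('v \<times> 'v) set \<Rightarrow> ('v \<times> 'v \<Rightarrow> 'w) \<Rightarrow> ('w \<Rightarrow> complex) \<Rightarrow> 'v \<times> 'v \<Rightarrow> 'v \<times> 'v \<Rightarrow> bool" where
  "face_succ D t q d d' \<longleftrightarrow> d \<in> D \<and> vertex_succ D t q d' (prod.swap d)"

definition noncrossing ::
  "'w set \<Rightarrow> ('v \<times> 'v) set \<Rightarrow> ('v \<times> 'v \<Rightarrow> 'w) \<Rightarrow> ('w \<Rightarrow> complex) \<Rightarrow> bool" where
  "noncrossing W D t q \<longleftrightarrow>
     inj_on q W \<and>
     (\<forall>d\<in>D. t d \<in> W \<and> t d \<noteq> t (prod.swap d)) \<and>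
     (\<forall>d\<in>D. \<forall>w\<in>W. q w \<in> dart_segment t q d \<longrightarrow> w \<in> dart_ends t d) \<and>
     (\<forall>d\<in>D. \<forall>d'\<in>D. d' \<noteq> d \<and> d' \<noteq> prod.swap d \<longrightarrow>
        dart_segment t q d \<inter> dart_segment t q d' \<subseteq> q ` (dart_ends t d \<inter> dart_ends t d')) \<and>
     \<not> (\<exists>d1 d1' d2 d2'. vertex_succ D t q d1 d1' \<and> vertex_succ D t q d2 d2' \<and>
          t d1 = t d2 \<and> d1 \<noteq> d2 \<and> dart_angle t q d1 d1' = pi \<and> dart_angle t q d2 d2' = pi)"

definition noncrossing_framework :: "'v set \<Rightarrow> 'v set set \<Rightarrow> ('v \<Rightarrow> complex) \<Rightarrow> bool" where
  "noncrossing_framework V E p \<longleftrightarrow> simple_graph V E \<and> noncrossing V (darts E) fst p"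

definition pointed :: "'v set set \<Rightarrow> ('v \<Rightarrow> complex) \<Rightarrow> 'v \<Rightarrow> bool" where
  "pointed E p v \<longleftrightarrow>
     (\<exists>d d'. fst d = v \<and> vertex_succ (darts E) fst p d d' \<and> dart_angle fst p d d' > pi)"

definition drawing :: "'v set \<Rightarrow> 'v set set \<Rightarrow> ('v \<Rightarrow> complex) \<Rightarrow> complex set" where
  "drawing V E p = p ` V \<union> (\<Union>e\<in>E. convex hull (p ` e))"

definition faces :: "'v set \<Rightarrow> 'v set set \<Rightarrow> ('v \<Rightarrow> complex) \<Rightarrow> complex set set" where
  "faces V E p = components (- drawing V E p)"

definition outer_face :: "'v set \<Rightarrow> 'v set set \<Rightarrow> ('v \<Rightarrow> complex) \<Rightarrow> complex set" where
  "outer_face V E p = outside (drawing V E p)"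

text \<open>The face containing the points immediately to the left of the midpoint of the dart.\<close>

definition left_face ::
  "'v set \<Rightarrow> 'v set set \<Rightarrow> ('v \<Rightarrow> complex) \<Rightarrow> 'v \<times> 'v \<Rightarrow> complex set" where
  "left_face V E p d = (THE F. F \<in> faces V E p \<and>
     (\<forall>\<^sub>F \<epsilon> in at_right 0.
        midpoint (p (fst d)) (p (snd d)) + \<epsilon> *\<^sub>R (\<i> * (p (snd d) - p (fst d))) \<in> F))"

abbreviation right_face ::
  "'v set \<Rightarrow> 'v set set \<Rightarrow> ('v \<Rightarrow> complex) \<Rightarrow> 'v \<times> 'v \<Rightarrow> complex set" where
  "right_face V E p d \<equiv> left_face V E p (prod.swap d)"

definition boundary_edges ::
  "'v set \<Rightarrow> 'v set set \<Rightarrow> ('v \<Rightarrow> complex) \<Rightarrow> 'v set set" where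
  "boundary_edges V E p = {{i, j} | i j. {i, j} \<in> E \<and> left_face V E p (i, j) = outer_face V E p}"

definition boundary_cycle :: "'v set \<Rightarrow> 'v set set \<Rightarrow> ('v \<Rightarrow> complex) \<Rightarrow> complex set" where
  "boundary_cycle V E p = (\<Union>e\<in>boundary_edges V E p. convex hull (p ` e))"

definition self_stress ::
  "'v set \<Rightarrow> 'v set set \<Rightarrow> ('v \<Rightarrow> complex) \<Rightarrow> ('v set \<Rightarrow> real) \<Rightarrow> bool" where
  "self_stress V E p \<omega> \<longleftrightarrow> (\<forall>i\<in>V. (\<Sum>j | {i, j} \<in> E. \<omega> {i, j} *\<^sub>R (p i - p j)) = 0)"

definition reciprocal ::
  "'v set \<Rightarrow> 'v set set \<Rightarrow> ('v \<Rightarrow> complex) \<Rightarrow> ('v set \<Rightarrow> real) \<Rightarrow> (complex set \<Rightarrow> complex) \<Rightarrow> bool"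
  where
  "reciprocal V E p \<omega> r \<longleftrightarrow>
     (\<forall>(i, j)\<in>darts E.
        r (left_face V E p (i, j)) - r (right_face V E p (i, j)) = \<omega> {i, j} *\<^sub>R (p j - p i))"

text \<open>
  A dual dart crosses the dart \<open>d = (i, j)\<close> from left to right. In an orientation-preserving
  dual embedding it therefore has the dual face of \<open>j\<close> on its left, so that the dual face
  cycle of a vertex consists of the duals of the darts pointing to that vertex. In an
  orientation-reversing one it has the dual face of \<open>i\<close> on its left, and the dual face cycle
  consists of the duals of the darts leaving the vertex.
\<close>

definition dual_embedding ::
  "'v set \<Rightarrow> 'v set set \<Rightarrow> ('v \<Rightarrow> complex) \<Rightarrow> (complex set \<Rightarrow> complex) \<Rightarrow> bool" where
  "dual_embedding V E p r \<longleftrightarrow>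
     (let D = darts E; L = left_face V E p in
       (\<forall>d\<in>D. \<forall>d'\<in>D.
          (face_succ D fst p d d' \<longleftrightarrow> vertex_succ D L r d d') \<and>
          (vertex_succ D fst p d d' \<longleftrightarrow> face_succ D L r (prod.swap d) (prod.swap d'))) \<or>
       (\<forall>d\<in>D. \<forall>d'\<in>D.
          (face_succ D fst p d d' \<longleftrightarrow> vertex_succ D L r d' d) \<and>
          (vertex_succ D fst p d d' \<longleftrightarrow> face_succ D L r d' d)))"

definition noncrossing_reciprocal ::
  "'v set \<Rightarrow> 'v set set \<Rightarrow> ('v \<Rightarrow> complex) \<Rightarrow> (complex set \<Rightarrow> complex) \<Rightarrow> bool" where
  "noncrossing_reciprocal V E p r \<longleftrightarrow>
     noncrossing (faces V E p) (darts E) (left_face V E p) r \<and> dual_embedding V E p r"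

definition good_self_stress ::
  "'v set \<Rightarrow> 'v set set \<Rightarrow> ('v \<Rightarrow> complex) \<Rightarrow> ('v set \<Rightarrow> real) \<Rightarrow> bool" where
  "good_self_stress V E p \<omega> \<longleftrightarrow>
     self_stress V E p \<omega> \<and> (\<forall>e\<in>E. \<omega> e \<noteq> 0) \<and>
     (\<exists>r. reciprocal V E p \<omega> r \<and> noncrossing_reciprocal V E p r)"

definition distinguished_vertex ::
  "'v set \<Rightarrow> 'v set set \<Rightarrow> ('v \<Rightarrow> complex) \<Rightarrow> ('v set \<Rightarrow> real) \<Rightarrow> 'v \<Rightarrow> bool" where
  "distinguished_vertex V E p \<omega> v \<longleftrightarrow>
     v \<in> V \<and> \<not> pointed E p v \<and>
     ((\<forall>e\<in>E. v \<in> e \<longrightarrow> \<omega> e > 0) \<or> (\<forall>e\<in>E. v \<in> e \<longrightarrow> \<omega> e < 0))"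

text \<open>Here \<open>g F\<close> is the constant gradient of \<open>h\<close> on the face \<open>F\<close>.\<close>

definition standard_lifting ::
  "'v set \<Rightarrow> 'v set set \<Rightarrow> ('v \<Rightarrow> complex) \<Rightarrow> ('v set \<Rightarrow> real) \<Rightarrow> (complex \<Rightarrow> real) \<Rightarrow> bool" where
  "standard_lifting V E p \<omega> h \<longleftrightarrow>
     continuous_on UNIV h \<and>
     (\<forall>x\<in>outer_face V E p. h x = 0) \<and>
     (\<exists>g :: complex set \<Rightarrow> complex. \<exists>c\<in>{1, -1 :: real}.
        (\<forall>e\<in>boundary_edges V E p. c * \<omega> e > 0) \<and>
        (\<forall>F\<in>faces V E p. \<exists>b. \<forall>x\<in>F. h x = inner (g F) x + b) \<and>
        (\<forall>(i, j)\<in>darts E.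
           g (left_face V E p (i, j)) - g (right_face V E p (i, j)) =
             (c * \<omega> {i, j}) *\<^sub>R (\<i> * (p j - p i))))"

text \<open>
  The surface is the graph of \<open>h\<close>, so the pieces into which the horizontal plane cuts it near
  the lifted point project to the components of \<open>{x \<in> ball q r. h x \<noteq> h q}\<close>. The four angles
  express that the chosen pieces occur in this cyclic order around \<open>q\<close>.
\<close>

definition saddle_point :: "(complex \<Rightarrow> real) \<Rightarrow> complex \<Rightarrow> bool" where
  "saddle_point h q \<longleftrightarrow>
     (\<exists>\<epsilon>>0. \<forall>r. 0 < r \<and> r < \<epsilon> \<longrightarrow>
        (\<exists>A1 A2 A3 A4 s t1 t2 t3 t4.
           {A1, A2, A3, A4} \<subseteq> components {x \<in> ball q r. h x \<noteq> h q} \<and>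
           A1 \<noteq> A3 \<and> A2 \<noteq> A4 \<and>
           (\<forall>x\<in>A1 \<union> A3. h x > h q) \<and> (\<forall>x\<in>A2 \<union> A4. h x < h q) \<and>
           0 < s \<and> t1 < t2 \<and> t2 < t3 \<and> t3 < t4 \<and> t4 < t1 + 2 * pi \<and>
           q + rcis s t1 \<in> A1 \<and> q + rcis s t2 \<in> A2 \<and>
           q + rcis s t3 \<in> A3 \<and> q + rcis s t4 \<in> A4))"

definition level_curve :: "(complex \<Rightarrow> real) \<Rightarrow> real \<Rightarrow> complex set" where
  "level_curve h z = {x. h x = z}"

definition simple_closed_curve :: "complex set \<Rightarrow> bool" where
  "simple_closed_curve C \<longleftrightarrow>
     (\<exists>\<gamma>. simple_path \<gamma> \<and> pathfinish \<gamma> = pathstart \<gamma> \<and> path_image \<gamma> = C)"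

text \<open>Convergence of \<open>C z\<close> to \<open>A\<close> along the filter \<open>Z\<close> with respect to the Hausdorff distance.\<close>

definition hausdorff_tendsto ::
  "(real \<Rightarrow> complex set) \<Rightarrow> complex set \<Rightarrow> real filter \<Rightarrow> bool" where
  "hausdorff_tendsto C A Z \<longleftrightarrow>
     (\<forall>\<epsilon>>0. \<forall>\<^sub>F z in Z.
        (\<forall>x\<in>C z. \<exists>a\<in>A. dist x a < \<epsilon>) \<and> (\<forall>a\<in>A. \<exists>x\<in>C z. dist x a < \<epsilon>))"

text \<open>
  As the height increases from \<open>z0\<close> to \<open>z1\<close>, the curves \<open>C z\<close> move strictly inwards, starting
  at the closed curve \<open>B\<close> and shrinking to the point \<open>a\<close>.
\<close>

definition moves_monotonically ::
  "(real \<Rightarrow> complex set) \<Rightarrow> real \<Rightarrow> real \<Rightarrow> complex set \<Rightarrow> complex \<Rightarrow> bool" where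
  "moves_monotonically C z0 z1 B a \<longleftrightarrow>
     (\<forall>z z'. z0 < z \<and> z < z' \<and> z' < z1 \<longrightarrow> C z' \<subseteq> inside (C z)) \<and>
     (\<forall>z. z0 < z \<and> z < z1 \<longrightarrow> C z \<subseteq> inside B \<and> a \<in> inside (C z)) \<and>
     hausdorff_tendsto C B (at_right z0) \<and> hausdorff_tendsto C {a} (at_left z1)"

end

theory Submission
  imports Defs
begin

text \<open>
  The lifted surface has a single hill. Two independent arguments show this: a combinatorial
  one, which finds the local extrema of \<open>h\<close>, and a topological one, which derives
  the shape of the level curves from the local extrema alone.

  The gradients of \<open>h\<close> on the faces form the reciprocal diagram, turned by a right
  angle and placed so that the outer face sits at the origin. Hence they are the vertices of a
  non-crossing drawing of the dual graph. If \<open>h\<close> has a local extremum at a point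
  \<open>q\<close> away from the outer face, then \<open>q\<close> is not inside a face, since
  the gradient there would be \<open>0\<close>, which belongs to the outer face only; nor is it
  inside an edge, since \<open>0\<close> would lie on the dual edge. So \<open>q\<close> is a
  vertex \<open>u\<close>. The slopes \<open>y\<close> for which \<open>h - \<langle>y,
  \<cdot>\<rangle>\<close> still has the extremum at \<open>u\<close> form a convex polygon, the
  cell of \<open>u\<close>, and every boundary point of it lies on the dual of an edge at
  \<open>u\<close>. The dual drawing is non-crossing, so its edges can leave the cell only
  through corners. At a corner the dual embedding, which reverses the orientation, has a reflex
  angle without dual edges exactly on the outer side of the cell. As the dual graph is
  connected, all gradients lie in the cell (\<open>peak_cell_contains_all\<close>). If two
  vertices both have this property, the dual of every edge at one of them lies on the boundary
  of the cell of the other, so it is an edge at both, which is impossible for two vertices of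
  degree at least two (\<open>peak_unique\<close>). The distinguished vertex has the property as
  well (\<open>monochromatic_nonpointed_peak\<close>), hence it is the only local extremum. An
  orientation-preserving reciprocal does not occur: two vertices of the convex hull would give
  two angles greater than \<open>\<pi>\<close> at the dual vertex of the outer face
  (\<open>not_orientation_preserving\<close>).

  For the topological part, let \<open>0 < z < h a\<close>, where \<open>a\<close> is the only
  local extremum. Every component of \<open>{h > z}\<close> contains a maximum of
  \<open>h\<close>, and every component of \<open>{h < z}\<close> away from the outer face would
  contain a minimum. So both sets are connected. If at a point \<open>q\<close> the surface were
  alternately above and below along four rays, the two upper rays could be joined inside
  \<open>{h > z}\<close> to a Jordan curve through \<open>q\<close> that separates the two lower
  rays, although these are joined inside \<open>{h < z}\<close> (\<open>no_alternation\<close>).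
  This excludes saddles, and it shows that a level set looks near each of its points like two
  radii of a disc. By Janiszewski's theorem the two radii are joined within the level set away
  from the centre, so the level set contains a Jordan curve; it equals this curve because each
  of its points is a limit of both higher and lower points, and those lie on different sides of
  the curve (\<open>level_simple_closed_curve\<close>). The inside of the level curve is
  \<open>{h > z}\<close>, which gives monotonicity, and the limits follow from compactness.
\<close>

section \<open>Polar coordinates\<close>

lemma rcis_inj:
  assumes "rcis r s = rcis r' t" "0 < r" "0 < r'" "\<bar>s - t\<bar> < 2 * pi"
  shows "r = r' \<and> s = t"
proof -
  have r: "r = r'"
    using assms by (metis abs_of_pos complex_mod_rcis)
  then have "cis s = cis t"
    using assms by (simp add: rcis_def)
  then have "cis (s - t) = 1"
    by (metis cis_divide cis_neq_zero divide_self_if)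
  then have "cos (s - t) = 1"
    by (metis cis.sel(1) one_complex.sel(1))
  then obtain n :: int where "s - t = of_int n * 2 * pi"
    using cos_one_2pi_int by blast
  moreover from this have "n = 0"
    using assms(4) by (simp add: abs_mult)
  ultimately show ?thesis using r by simp
qed

lemma polar_from:
  assumes "w \<noteq> 0"
  obtains t where "a \<le> t" "t < a + 2 * pi" "w = rcis (cmod w) t"
proof -
  let ?t = "Arg2pi (w / cis a)"
  have "w / cis a = rcis (cmod w) ?t"
    using Arg2pi_eq[of "w / cis a"] by (simp add: rcis_def cis_conv_exp norm_divide)
  then have "w = rcis (cmod w) ?t * cis a"
    by (metis cis_neq_zero nonzero_eq_divide_eq)
  then have "w = rcis (cmod w) (a + ?t)"
    by (simp add: rcis_def cis_mult add.commute mult.assoc)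
  then show thesis
    using that[of "a + ?t"] Arg2pi_ge_0 Arg2pi_lt_2pi by simp
qed

lemma rcis_periodic: "rcis s (t + 2 * pi) = rcis s t"
  by (simp add: rcis_def cis_mult[symmetric])

lemma shift_angle:
  obtains t' where "a0 \<le> t'" "t' < a0 + 2 * pi" "\<And>s. rcis s t' = rcis s t"
proof -
  obtain t' where t': "a0 \<le> t'" "t' < a0 + 2 * pi" "cis t = rcis (cmod (cis t)) t'"
    using polar_from[of "cis t" a0] by auto
  then have "rcis s t' = rcis s t" for s
    by (simp add: rcis_def)
  then show thesis
    using that t' by blast
qed

lemma radius_eq:
  assumes "0 \<le> s"
  shows "closed_segment q (q + rcis s t) = (\<lambda>r. q + rcis r t) ` {0..s}"
proof -
  have "closed_segment q (q + rcis s t) = (\<lambda>u. q + rcis (u * s) t) ` {0..1}"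
    by (simp add: closed_segment_image_interval rcis_def scaleR_conv_of_real algebra_simps)
  also have "\<dots> = (\<lambda>r. q + rcis r t) ` ((\<lambda>u. u * s) ` {0..1})"
    by (simp add: image_image)
  also have "(\<lambda>u. u * s) ` {0..1} = {0..s}"
    using assms by (simp add: image_mult_atLeastAtMost_if')
  finally show ?thesis .
qed

lemma outer_radius:
  assumes "0 \<le> r" "r \<le> s" "x \<in> closed_segment (q + rcis r t) (q + rcis s t)"
  obtains \<rho> where "r \<le> \<rho>" "\<rho> \<le> s" "x = q + rcis \<rho> t"
proof -
  obtain u where u: "0 \<le> u" "u \<le> 1" "x = (1 - u) *\<^sub>R (q + rcis r t) + u *\<^sub>R (q + rcis s t)"
    using assms(3) by (auto simp: in_segment)
  have "x = q + rcis (r + u * (s - r)) t"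
    using u(3) by (simp add: rcis_def scaleR_conv_of_real algebra_simps)
  moreover have "0 \<le> u * (s - r)" "u * (s - r) \<le> s - r"
    using u assms mult_left_le_one_le[of "s - r" u] by auto
  ultimately show thesis
    using that[of "r + u * (s - r)"] by simp
qed

text \<open>
  A path between two rays from \<open>q\<close> need not close up to a Jordan curve, because it
  may meet itself or the rays. Cutting it down to an arc between points of the rays that are
  closer to \<open>q\<close> than the whole path repairs this, and leaves the curve straight
  near \<open>q\<close>.
\<close>

lemma simple_loop_at_corner:
  assumes t: "t1 < t3" "t3 < t1 + 2 * pi" and "0 < s"
    and \<gamma>: "path \<gamma>" "pathstart \<gamma> = q + rcis s t1" "pathfinish \<gamma> = q + rcis s t3"
      "q \<notin> path_image \<gamma>"
  obtains c \<delta> where "simple_path c" "pathfinish c = pathstart c" "0 < \<delta>" "\<delta> < s"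
    "path_image c \<subseteq>
       path_image \<gamma> \<union> closed_segment q (q + rcis s t1) \<union> closed_segment q (q + rcis s t3)"
    "path_image c \<inter> ball q \<delta> = {q + rcis r t | r t. 0 \<le> r \<and> r < \<delta> \<and> t \<in> {t1, t3}}"
proof -
  have "closed (path_image \<gamma>)"
    using \<gamma>(1) by (simp add: closed_path_image)
  then obtain \<delta>0 where \<delta>0: "0 < \<delta>0" "\<And>x. x \<in> path_image \<gamma> \<Longrightarrow> \<delta>0 \<le> dist q x"
    using separate_point_closed[of "path_image \<gamma>" q] \<gamma>(4) by auto
  define \<delta> where "\<delta> = min \<delta>0 s / 2"
  have \<delta>: "0 < \<delta>" "\<delta> < s" "\<delta> < \<delta>0"
    using \<delta>0 \<open>0 < s\<close> by (auto simp: \<delta>_def)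
  let ?y1 = "q + rcis \<delta> t1" and ?y3 = "q + rcis \<delta> t3"
  have ne: "?y1 \<noteq> ?y3"
    using rcis_inj[of \<delta> t1 \<delta> t3] \<delta> t by auto
  (* The path is prolonged along both rays to distance delta from q, so that it touches the
     disc of radius delta only in its ends. *)
  let ?g = "linepath ?y1 (q + rcis s t1) +++ \<gamma> +++ linepath (q + rcis s t3) ?y3"
  have g: "path ?g" "pathstart ?g = ?y1" "pathfinish ?g = ?y3"
    using \<gamma> by auto
  obtain \<alpha> where \<alpha>: "arc \<alpha>" "path_image \<alpha> \<subseteq> path_image ?g" "pathstart \<alpha> = ?y1"
      "pathfinish \<alpha> = ?y3"
    using path_contains_arc[OF g ne] by blast
  have img: "path_image ?g \<subseteq> closed_segment ?y1 (q + rcis s t1) \<union> path_image \<gamma> \<union>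
       closed_segment ?y3 (q + rcis s t3)"
    using \<gamma> by (auto simp: path_image_join closed_segment_commute)
  have ray: "x \<in> closed_segment (q + rcis \<delta> t) (q + rcis s t) \<Longrightarrow>
      \<delta> \<le> dist q x \<and> (dist q x \<le> \<delta> \<longrightarrow> x = q + rcis \<delta> t) \<and> x \<in> closed_segment q (q + rcis s t)"
    for x t
    using \<delta> by (elim outer_radius[rotated 2]) (auto simp: radius_eq dist_norm norm_minus_commute)
  have far: "x \<in> path_image \<alpha> \<Longrightarrow> dist q x \<le> \<delta> \<Longrightarrow> x \<in> {?y1, ?y3}"
    and far': "x \<in> path_image \<alpha> \<Longrightarrow> \<delta> \<le> dist q x" for x
    using ray[of x t1] ray[of x t3] \<delta>0(2)[of x] \<delta> \<alpha>(2) img by fastforce+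
  let ?b = "linepath ?y3 q +++ linepath q ?y1"
  have rad: "closed_segment q (q + rcis \<delta> t) = (\<lambda>r. q + rcis r t) ` {0..\<delta>}" for t
    using radius_eq[of \<delta>] \<delta> by simp
  have "arc ?b"
  proof (rule arc_join)
    have "x = q" if x: "x \<in> closed_segment q ?y3" "x \<in> closed_segment q ?y1" for x
    proof -
      obtain r r' where r: "r \<in> {0..\<delta>}" "r' \<in> {0..\<delta>}" "x = q + rcis r t1" "x = q + rcis r' t3"
        using x unfolding rad by auto
      then have eq: "rcis r t1 = rcis r' t3"
        by simp
      then have "r = r'"
        using r by (metis abs_of_nonneg atLeastAtMost_iff complex_mod_rcis)
      then show "x = q"
        using rcis_inj[OF eq] t r by (cases "r = 0") auto
    qed
    then show "path_image (linepath ?y3 q) \<inter> path_image (linepath q ?y1) \<subseteq>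
        {pathstart (linepath q ?y1)}"
      by (auto simp: closed_segment_commute)
  qed (use \<delta> in auto)
  have imgb: "path_image ?b = (\<lambda>r. q + rcis r t3) ` {0..\<delta>} \<union> (\<lambda>r. q + rcis r t1) ` {0..\<delta>}"
    by (simp add: path_image_join closed_segment_commute[of ?y3] rad)
  have "simple_path (\<alpha> +++ ?b)"
  proof (rule simple_path_join_loop[OF \<alpha>(1) \<open>arc ?b\<close>])
    show "path_image \<alpha> \<inter> path_image ?b \<subseteq> {pathstart \<alpha>, pathstart ?b}"
      using far \<delta> by (force simp: imgb \<alpha> dist_norm)
  qed (use \<alpha> in auto)
  moreover have imgc: "path_image (\<alpha> +++ ?b) = path_image \<alpha> \<union> path_image ?b"
    using \<alpha> by (simp add: path_image_join)
  moreover have "path_image (\<alpha> +++ ?b) \<subseteq>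
       path_image \<gamma> \<union> closed_segment q (q + rcis s t1) \<union> closed_segment q (q + rcis s t3)"
    unfolding imgc imgb using \<alpha>(2) img ray[of _ t1] ray[of _ t3] \<delta> by (auto simp: radius_eq)
  moreover have "path_image (\<alpha> +++ ?b) \<inter> ball q \<delta> =
      {q + rcis r t | r t. 0 \<le> r \<and> r < \<delta> \<and> t \<in> {t1, t3}}"
    unfolding imgc imgb using far' by (fastforce simp: dist_norm)
  ultimately show thesis
    using \<delta> \<alpha> by (intro that[of "\<alpha> +++ ?b" \<delta>]) auto
qed

section \<open>Functions with a single hill\<close>

definition weak_local_extremum :: "(complex \<Rightarrow> real) \<Rightarrow> complex \<Rightarrow> bool" where
  "weak_local_extremum h q \<longleftrightarrow>
     (\<exists>r>0. (\<forall>x\<in>ball q r. h x \<le> h q) \<or> (\<forall>x\<in>ball q r. h x \<ge> h q))"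

lemma closure_component_in:
  assumes "C \<in> components S" "x \<in> closure C" "x \<in> S"
  shows "x \<in> C"
proof -
  obtain T where "closed T" "C = S \<inter> T"
    using closedin_component[OF assms(1)] by (auto simp: closedin_closed)
  then show ?thesis
    using assms(2,3) closure_minimal[of C T] by blast
qed

text \<open>
  Connectedness of the sets above and below a level is shown by finding one point that lies in
  every component.
\<close>

lemma connected_if_common_point:
  assumes "\<And>C. C \<in> components S \<Longrightarrow> k \<in> C"
  shows "connected S"
proof -
  have "connected_component S x k" if "x \<in> S" for x
    using assms[OF componentsI[OF that]] by simp
  then show ?thesis
    unfolding connected_iff_connected_component
    by (meson connected_component_sym connected_component_trans)
qed

lemma inside_outside_of_split:
  fixes S :: "complex set"
  assumes compl: "- S = A \<union> B" and "open A" "open B" "A \<inter> B = {}"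
    and "bounded A" "connected B" "\<not> bounded B"
  shows "inside S = A" "outside S = B"
proof -
  have lo: "B \<subseteq> outside S"
  proof
    fix x assume x: "x \<in> B"
    have "B \<subseteq> connected_component_set (- S) x"
      using assms x by (intro connected_component_maximal) auto
    then show "x \<in> outside S"
      using \<open>\<not> bounded B\<close> bounded_subset x compl by (auto simp: outside_def)
  qed
  have hi: "A \<subseteq> inside S"
  proof
    fix x assume x: "x \<in> A"
    let ?C = "connected_component_set (- S) x"
    have "x \<in> ?C"
      using x compl by (simp add: connected_component_refl)
    then have "?C \<inter> A \<noteq> {}"
      using x by blast
    moreover have "?C \<subseteq> A \<union> B"
      using connected_component_subset compl by blast
    ultimately have "?C \<inter> B = {}"
      using connectedD[of ?C A B] assms by auto
    then have "bounded ?C"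
      by (intro bounded_subset[OF \<open>bounded A\<close>]) (use \<open>?C \<subseteq> A \<union> B\<close> in blast)
    then show "x \<in> inside S"
      using x compl by (auto simp: inside_def)
  qed
  show "inside S = A" "outside S = B"
    using lo hi inside_Int_outside[of S] inside_Un_outside[of S] compl by blast+
qed

text \<open>
  What the topological part needs from a lifting. Being a cone near each point replaces the
  piecewise linear structure: it turns statements about small discs into statements about rays.
\<close>

locale mountain =
  fixes h :: "complex \<Rightarrow> real" and Out :: "complex set" and a :: complex
  assumes cont: "continuous_on UNIV h"
    and nonneg: "0 \<le> h x"
    and zero_set: "{x. h x = 0} = closure Out"
    and Out: "open Out" "connected Out" "\<not> bounded Out"
    and support: "bounded {x. h x \<noteq> 0}"
    and summit: "0 < h a"
    and conic: "\<exists>r>0. \<forall>x\<in>ball q r. \<forall>t\<in>{0..1}. h (q + t *\<^sub>R (x - q)) - h q = t * (h x - h q)"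
    and no_extremum: "0 < h q \<Longrightarrow> weak_local_extremum h q \<Longrightarrow> q = a"
begin

lemma zero_iff: "x \<in> closure Out \<longleftrightarrow> h x = 0"
  using zero_set by blast

lemma open_above: "open {x. z < h x}" and open_below: "open {x. h x < z}"
  and closed_level: "closed {x. h x = z}"
proof -
  show "open {x. z < h x}" "open {x. h x < z}"
    by (auto intro!: open_Collect_less continuous_intros cont)
  show "closed {x. h x = z}"
    by (auto intro!: closed_Collect_eq continuous_intros cont)
qed

lemma bounded_above: assumes "0 \<le> z" shows "bounded {x. z < h x}"
  using support by (rule bounded_subset) (use assms in auto)

lemma bounded_at_least: assumes "0 < z" shows "bounded {x. z \<le> h x}"
  using support by (rule bounded_subset) (use assms in auto)

text \<open>
  The maximum of \<open>h\<close> over the closure of the component is attained inside, since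
  \<open>h\<close> does not exceed \<open>z\<close> on its frontier. It is a local maximum of
  \<open>h\<close>, so it is at \<open>a\<close>.
\<close>

lemma component_above_contains_summit:
  assumes "0 \<le> z" and C: "C \<in> components {x. z < h x}"
  shows "a \<in> C"
proof -
  have "bounded C"
    using bounded_above[OF \<open>0 \<le> z\<close>] in_components_subset[OF C] bounded_subset by blast
  then have "compact (closure C)"
    by simp
  moreover obtain y where y: "y \<in> C"
    using in_components_nonempty[OF C] by blast
  ultimately obtain x where x: "x \<in> closure C" "\<And>y. y \<in> closure C \<Longrightarrow> h y \<le> h x"
    using continuous_attains_sup[of "closure C" h] continuous_on_subset[OF cont] by auto
  have "h y \<le> h x"
    using x y closure_subset by blast
  moreover have "z < h y"
    using in_components_subset[OF C] y by blast
  ultimately have "z < h x"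
    by simp
  then have "x \<in> C"
    using closure_component_in[OF C x(1)] by simp
  moreover have "open C"
    using open_components[OF open_above C] .
  ultimately obtain r where r: "r > 0" "ball x r \<subseteq> C"
    using open_contains_ball by blast
  have "weak_local_extremum h x"
    unfolding weak_local_extremum_def using r x(2) closure_subset by blast
  then have "x = a"
    using no_extremum \<open>z < h x\<close> \<open>0 \<le> z\<close> by simp
  then show ?thesis
    using \<open>x \<in> C\<close> by simp
qed

lemma connected_above: assumes "0 \<le> z" shows "connected {x. z < h x}"
  using component_above_contains_summit[OF assms] by (rule connected_if_common_point)

lemma le_summit: "h x \<le> h a"
proof (cases "h x \<le> 0")
  case False
  let ?z = "h x"
  have "\<exists>C\<in>components {x. y < h x}. x \<in> C" if "y < h x" for y
    using that by (metis (mono_tags, lifting) UnionE Union_components mem_Collect_eq)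
  then have "y < h a" if "0 \<le> y" "y < h x" for y
    using that component_above_contains_summit in_components_subset by blast
  then show ?thesis
    using False dense_le[of "h x" "h a"] by (meson linorder_not_le order_less_imp_le dual_order.strict_trans2)
qed (use summit in simp)

lemma less_summit: assumes "x \<noteq> a" shows "h x < h a"
proof (rule ccontr)
  assume "\<not> h x < h a"
  then have "h x = h a"
    using le_summit[of x] by simp
  then have "weak_local_extremum h x"
    unfolding weak_local_extremum_def using le_summit by (auto intro!: exI[of _ 1])
  then show False
    using no_extremum assms \<open>h x = h a\<close> summit by simp
qed

lemma Sup_summit: "(SUP x. h x) = h a"
  using le_summit by (intro cSup_eq_maximum) auto

text \<open>
  A component that misses the outer region is bounded, and the minimum of \<open>h\<close> over
  its closure would be a local minimum at positive height below the summit.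
\<close>

lemma connected_below:
  assumes "0 < z" "z \<le> h a"
  shows "connected {x. h x < z}"
proof -
  let ?B = "{x. h x < z}"
  have K: "closure Out \<subseteq> ?B"
    using zero_iff assms by auto
  obtain k where k: "k \<in> Out"
    using Out by fastforce
  have k': "k \<in> closure Out"
    using k closure_subset by blast
  have meet: "closure Out \<subseteq> C" if C: "C \<in> components ?B" for C
  proof (rule ccontr)
    assume "\<not> closure Out \<subseteq> C"
    moreover have "connected (closure Out)"
      using Out connected_imp_connected_closure by blast
    ultimately have disj: "C \<inter> closure Out = {}"
      using components_maximal[OF C _ K] by blast
    have "bounded C"
      using support by (rule bounded_subset) (use disj zero_iff in auto)
    then have "compact (closure C)"
      by simp
    moreover obtain y where y: "y \<in> C"
      using in_components_nonempty[OF C] by blast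
    ultimately obtain x where x: "x \<in> closure C" "\<And>y. y \<in> closure C \<Longrightarrow> h x \<le> h y"
      using continuous_attains_inf[of "closure C" h] continuous_on_subset[OF cont] by auto
    have "h x \<le> h y"
      using x y closure_subset by blast
    moreover have "h y < z"
      using in_components_subset[OF C] y by blast
    ultimately have "h x < z"
      by simp
    then have "x \<in> C"
      using closure_component_in[OF C x(1)] by simp
    then have "h x \<noteq> 0"
      using disj zero_iff by auto
    have "open C"
      using open_components[OF open_below C] .
    then obtain r where r: "r > 0" "ball x r \<subseteq> C"
      using open_contains_ball \<open>x \<in> C\<close> by blast
    have "weak_local_extremum h x"
      unfolding weak_local_extremum_def using r x(2) closure_subset by blast
    then have "x = a"
      using no_extremum[of x] \<open>h x \<noteq> 0\<close> nonneg[of x] by simp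
    then show False
      using \<open>h x < z\<close> assms by simp
  qed
  show ?thesis
    using meet k' by (intro connected_if_common_point) blast
qed

lemma unbounded_below: assumes "0 < z" shows "\<not> bounded {x. h x < z}"
proof -
  have "Out \<subseteq> {x. h x < z}"
    using zero_iff closure_subset[of Out] assms by fastforce
  then show ?thesis
    using Out(3) bounded_subset by blast
qed

lemma inside_outside_level:
  assumes "0 < z" "z \<le> h a"
  shows "inside (level_curve h z) = {x. z < h x}" "outside (level_curve h z) = {x. h x < z}"
proof -
  have "- level_curve h z = {x. z < h x} \<union> {x. h x < z}"
    by (auto simp: level_curve_def)
  then show "inside (level_curve h z) = {x. z < h x}" "outside (level_curve h z) = {x. h x < z}"
    using inside_outside_of_split[OF _ open_above open_below _ bounded_above
        connected_below[OF assms] unbounded_below[OF assms(1)]] assms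
    by (auto simp: disjoint_iff)
qed

text \<open>
  In a disc over which the surface is a cone, the sign of the height difference is constant
  along every ray from the centre.
\<close>

lemma along_ray:
  assumes conic_r: "\<forall>x\<in>ball q r. \<forall>t\<in>{0..1}. h (q + t *\<^sub>R (x - q)) - h q = t * (h x - h q)"
    and "0 < s" "s < r" "0 < \<rho>" "\<rho> < r"
  shows "h (q + rcis \<rho> t) - h q = (\<rho> / s) * (h (q + rcis s t) - h q)"
proof -
  have le: "h (q + rcis x t) - h q = (x / y) * (h (q + rcis y t) - h q)"
    if "0 < x" "x \<le> y" "y < r" for x y
  proof -
    have "q + (x / y) *\<^sub>R ((q + rcis y t) - q) = q + rcis x t"
      using that by (simp add: rcis_def scaleR_conv_of_real)
    moreover have "q + rcis y t \<in> ball q r"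
      using that by (simp add: dist_norm)
    moreover have "x / y \<in> {0..1}"
      using that by simp
    ultimately show ?thesis
      using conic_r by metis
  qed
  show ?thesis
  proof (cases "\<rho> \<le> s")
    case True
    then show ?thesis using le assms by simp
  next
    case False
    then show ?thesis using le[of s \<rho>] assms by (simp add: field_simps)
  qed
qed

text \<open>
  Jordan's theorem excludes the alternation: the two upper rays close up to a Jordan curve that
  meets \<open>{h < h q}\<close> nowhere, while the two sectors between them contain the lower
  rays and lie on different sides of the curve, because \<open>q\<close> is on the frontier of
  both sides.
\<close>

lemma no_alternation:
  assumes conic_r: "\<forall>x\<in>ball q r. \<forall>t\<in>{0..1}. h (q + t *\<^sub>R (x - q)) - h q = t * (h x - h q)"
    and s: "0 < s" "s < r"
    and t: "t1 < t2" "t2 < t3" "t3 < t4" "t4 < t1 + 2 * pi"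
    and up: "h q < h (q + rcis s t1)" "h q < h (q + rcis s t3)"
    and down: "h (q + rcis s t2) < h q" "h (q + rcis s t4) < h q"
  shows False
proof -
  let ?z = "h q" and ?U = "{x. h q < h x}" and ?D = "{x. h x < h q}"
  have z: "0 < ?z"
    using down(1) nonneg[of "q + rcis s t2"] by simp
  have z': "?z < h a"
    using up(1) le_summit[of "q + rcis s t1"] by simp
  have ray: "h (q + rcis \<rho> t) - h q = (\<rho> / s) * (h (q + rcis s t) - h q)"
    if "0 < \<rho>" "\<rho> < r" for \<rho> t
    using along_ray[OF conic_r s that] .
  have ray_up: "h q < h (q + rcis \<rho> t)" if "0 < \<rho>" "\<rho> < r" "h q < h (q + rcis s t)" for \<rho> t
  proof -
    have "0 < (\<rho> / s) * (h (q + rcis s t) - h q)"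
      using that s by simp
    then show ?thesis
      using ray[OF that(1,2), of t] by simp
  qed
  have ray_down: "h (q + rcis \<rho> t) < h q" if "0 < \<rho>" "\<rho> < r" "h (q + rcis s t) < h q" for \<rho> t
  proof -
    have "(\<rho> / s) * (h (q + rcis s t) - h q) < 0"
      using that s by (simp add: mult_less_0_iff divide_less_0_iff)
    then show ?thesis
      using ray[OF that(1,2), of t] by simp
  qed
  have "path_connected ?U"
    using connected_above[of ?z] open_above[of ?z] z by (simp add: connected_open_path_connected)
  then obtain \<gamma> where \<gamma>: "path \<gamma>" "path_image \<gamma> \<subseteq> ?U"
      "pathstart \<gamma> = q + rcis s t1" "pathfinish \<gamma> = q + rcis s t3"
    using up unfolding path_connected_def by blast
  have "q \<notin> path_image \<gamma>"
    using \<gamma>(2) by auto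
  then obtain c \<delta> where c: "simple_path c" "pathfinish c = pathstart c" and \<delta>: "0 < \<delta>" "\<delta> < s"
    and img: "path_image c \<subseteq>
       path_image \<gamma> \<union> closed_segment q (q + rcis s t1) \<union> closed_segment q (q + rcis s t3)"
    and near: "path_image c \<inter> ball q \<delta> = {q + rcis r t | r t. 0 \<le> r \<and> r < \<delta> \<and> t \<in> {t1, t3}}"
    using simple_loop_at_corner[of t1 t3 s \<gamma> q] \<gamma> s t by (smt (verit, best))
  have c_up: "path_image c \<subseteq> insert q ?U"
  proof -
    have "closed_segment q (q + rcis s t) \<subseteq> insert q ?U" if "h q < h (q + rcis s t)" for t
    proof
      fix x assume "x \<in> closed_segment q (q + rcis s t)"
      then obtain \<rho> where "0 \<le> \<rho>" "\<rho> \<le> s" "x = q + rcis \<rho> t"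
        using s by (auto simp: radius_eq)
      then show "x \<in> insert q ?U"
        using ray_up[of \<rho> t] that s by (cases "\<rho> = 0") auto
    qed
    from this[OF up(1)] this[OF up(2)] show ?thesis
      using img \<gamma>(2) by blast
  qed
  define W where "W lo hi = (\<lambda>(r, t). q + rcis r t) ` ({0<..<\<delta>} \<times> {lo<..<hi})" for lo hi :: real
  have connW: "connected (W lo hi)" for lo hi
    unfolding W_def rcis_def case_prod_unfold
    by (intro connected_continuous_image connected_Times continuous_intros) auto
  have avoid: "q + rcis \<rho> t \<notin> path_image c"
    if "0 < \<rho>" "\<rho> < \<delta>" "t1 < t" "t < t1 + 2 * pi" "t \<noteq> t3" for \<rho> t
  proof
    assume "q + rcis \<rho> t \<in> path_image c"
    moreover have "q + rcis \<rho> t \<in> ball q \<delta>"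
      using that by (simp add: dist_norm)
    ultimately obtain \<rho>' t' where r': "q + rcis \<rho> t = q + rcis \<rho>' t'" "0 \<le> \<rho>'" "t' \<in> {t1, t3}"
      using near by blast
    have "0 < \<rho>'"
      using r' that by (cases "\<rho>' = 0") auto
    moreover have "\<bar>t - t1\<bar> < 2 * pi" "\<bar>t - t3\<bar> < 2 * pi"
      using that t by linarith+
    ultimately show False
      using rcis_inj[of \<rho> t \<rho>' t'] r' that by auto
  qed
  (* The lower set joins the two sectors, so together they avoid one side of the curve. *)
  let ?S = "?D \<union> W t1 t3 \<union> W t3 (t1 + 2 * pi)"
  have "connected ?S"
  proof -
    have "(\<delta> / 2, t2) \<in> {0<..<\<delta>} \<times> {t1<..<t3}" "(\<delta> / 2, t4) \<in> {0<..<\<delta>} \<times> {t3<..<t1 + 2 * pi}"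
      using \<delta> t by auto
    then have "q + rcis (\<delta> / 2) t2 \<in> W t1 t3" "q + rcis (\<delta> / 2) t4 \<in> W t3 (t1 + 2 * pi)"
      unfolding W_def by (metis (no_types, lifting) case_prod_conv imageI)+
    moreover have "q + rcis (\<delta> / 2) t2 \<in> ?D" "q + rcis (\<delta> / 2) t4 \<in> ?D"
      using ray_down[of "\<delta> / 2" t2] ray_down[of "\<delta> / 2" t4] \<delta> s down by auto
    ultimately have "?D \<inter> W t1 t3 \<noteq> {}" "(?D \<union> W t1 t3) \<inter> W t3 (t1 + 2 * pi) \<noteq> {}"
      by blast+
    then show ?thesis
      using connected_below[of ?z] z z' connW by (intro connected_Un) auto
  qed
  moreover have "?S \<inter> path_image c = {}"
  proof -
    have "W t1 t3 \<inter> path_image c = {}" "W t3 (t1 + 2 * pi) \<inter> path_image c = {}"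
      using avoid t by (auto simp: W_def)
    moreover have "?D \<inter> path_image c = {}"
      using c_up by auto
    ultimately show ?thesis
      by blast
  qed
  ultimately have S: "connected ?S" "?S \<inter> path_image c = {}"
    by blast+
  let ?I = "inside (path_image c)" and ?O = "outside (path_image c)"
  have J: "open ?I" "open ?O" "?I \<inter> ?O = {}" "?I \<union> ?O = - path_image c"
    "frontier ?I = path_image c" "frontier ?O = path_image c"
    using Jordan_inside_outside[OF c] by simp_all
  have "?I \<inter> ?S = {} \<or> ?O \<inter> ?S = {}"
  proof (rule connectedD[OF S(1) J(1,2)])
    show "?I \<inter> ?O \<inter> ?S = {}"
      using J(3) by blast
    show "?S \<subseteq> ?I \<union> ?O"
      unfolding J(4) using S(2) by blast
  qed
  then have one_side: "?S \<inter> ?I = {} \<or> ?S \<inter> ?O = {}"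
    by (simp only: Int_commute)
  have cover: "ball q \<delta> \<subseteq> path_image c \<union> ?S"
  proof
    fix x assume x: "x \<in> ball q \<delta>"
    show "x \<in> path_image c \<union> ?S"
    proof (cases "x = q")
      case True
      have "q + rcis 0 t1 \<in> path_image c \<inter> ball q \<delta>"
        unfolding near using \<delta> by fastforce
      then show ?thesis
        using True by simp
    next
      case False
      then obtain t where t': "t1 \<le> t" "t < t1 + 2 * pi" "x - q = rcis (cmod (x - q)) t"
        using polar_from[of "x - q" t1] by auto
      define \<rho> where "\<rho> = cmod (x - q)"
      have \<rho>: "0 < \<rho>" "\<rho> < \<delta>" "x = q + rcis \<rho> t"
        using x t' False by (auto simp: \<rho>_def dist_norm norm_minus_commute algebra_simps)
      consider "t = t1" | "t = t3" | "t1 < t" "t < t3" | "t3 < t"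
        using t' by linarith
      then show ?thesis
      proof cases
        case 3
        then show ?thesis using \<rho> by (auto simp: W_def)
      next
        case 4
        then show ?thesis using \<rho> t' by (auto simp: W_def)
      qed (use near \<rho> in \<open>fastforce+\<close>)
    qed
  qed
  have "q \<in> path_image c"
  proof -
    have "q + rcis 0 t1 \<in> path_image c \<inter> ball q \<delta>"
      unfolding near using \<delta> by fastforce
    then show ?thesis by simp
  qed
  then have "q \<in> frontier ?I" "q \<in> frontier ?O"
    unfolding J(5,6) by simp_all
  then have "q \<in> closure ?I" "q \<in> closure ?O"
    by (simp_all add: frontier_def)
  then obtain x y where "x \<in> ?I" "x \<in> ball q \<delta>" "y \<in> ?O" "y \<in> ball q \<delta>"
    using \<delta>(1) by (metis closure_approachable mem_ball dist_commute)
  then have "x \<in> ?I \<inter> ?S" "y \<in> ?O \<inter> ?S"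
    using cover inside_no_overlap[of "path_image c"] outside_no_overlap[of "path_image c"] by blast+
  then show False
    using one_side by (metis Int_commute empty_iff)
qed

lemma no_saddle: "\<not> saddle_point h q"
proof
  assume saddle: "saddle_point h q"
  define P where "P r \<longleftrightarrow> (\<exists>A1 A2 A3 A4 s t1 t2 t3 t4.
           {A1, A2, A3, A4} \<subseteq> components {x \<in> ball q r. h x \<noteq> h q} \<and>
           A1 \<noteq> A3 \<and> A2 \<noteq> A4 \<and>
           (\<forall>x\<in>A1 \<union> A3. h x > h q) \<and> (\<forall>x\<in>A2 \<union> A4. h x < h q) \<and>
           0 < s \<and> t1 < t2 \<and> t2 < t3 \<and> t3 < t4 \<and> t4 < t1 + 2 * pi \<and>
           q + rcis s t1 \<in> A1 \<and> q + rcis s t2 \<in> A2 \<and>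
           q + rcis s t3 \<in> A3 \<and> q + rcis s t4 \<in> A4)" for r
  have "\<exists>e>0. \<forall>r. 0 < r \<and> r < e \<longrightarrow> P r"
    using saddle unfolding saddle_point_def P_def .
  then obtain e where e: "e > 0" "\<And>r. 0 < r \<Longrightarrow> r < e \<Longrightarrow> P r"
    by blast
  obtain r where "r > 0"
    and r: "\<forall>x\<in>ball q r. \<forall>t\<in>{0..1}. h (q + t *\<^sub>R (x - q)) - h q = t * (h x - h q)"
    using conic by blast
  define r' where "r' = min r e / 2"
  have r': "0 < r'" "r' < e" "r' < r"
    using \<open>r > 0\<close> \<open>e > 0\<close> by (auto simp: r'_def)
  have "P r'"
    using e r' by blast
  then show False
    unfolding P_def
  proof (elim exE conjE)
    fix A1 A2 A3 A4 s t1 t2 t3 t4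
    assume A: "{A1, A2, A3, A4} \<subseteq> components {x \<in> ball q r'. h x \<noteq> h q}"
       "\<forall>x\<in>A1 \<union> A3. h x > h q" "\<forall>x\<in>A2 \<union> A4. h x < h q"
      and t: "0 < s" "t1 < t2" "t2 < t3" "t3 < t4" "t4 < t1 + 2 * pi"
      and mem: "q + rcis s t1 \<in> A1" "q + rcis s t2 \<in> A2" "q + rcis s t3 \<in> A3" "q + rcis s t4 \<in> A4"
    have "A1 \<subseteq> ball q r'"
      using A(1) in_components_subset[of A1] by blast
    then have "q + rcis s t1 \<in> ball q r'"
      using mem by blast
    then have "s < r"
      using r' t(1) by (simp add: dist_norm)
    moreover have "h q < h (q + rcis s t1)" "h q < h (q + rcis s t3)"
       "h (q + rcis s t2) < h q" "h (q + rcis s t4) < h q"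
      using A mem by simp_all
    ultimately show False
      using no_alternation[OF r t(1) _ t(2-5)] by simp
  qed
qed

end

lemma connected_ivt:
  fixes h :: "complex \<Rightarrow> real"
  assumes "connected S" "continuous_on S h" "x \<in> S" "y \<in> S" "h x \<le> z" "z \<le> h y"
  obtains w where "w \<in> S" "h w = z"
proof -
  have "connected (h ` S)"
    using assms by (simp add: connected_continuous_image)
  then have "z \<in> h ` S"
    using assms by (metis connectedD_interval imageI)
  then show thesis
    using that by blast
qed

context mountain
begin

lemma level_nonempty:
  assumes "0 < z" "z < h a"
  obtains q where "h q = z"
proof -
  obtain k where "k \<in> Out"
    using Out by fastforce
  then have "k \<in> closure Out"
    using closure_subset by blast
  then have "h k = 0"
    by (simp add: zero_iff)
  then show thesis
    using connected_ivt[of UNIV h k a z] cont assms that by auto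
qed

text \<open>
  A point of the ray at angle \<open>\<theta>\<close> has the height of \<open>q\<close> and is
  no local extremum, so there are higher and lower points close to it. They lie on rays with
  nearby angles.
\<close>

lemma sign_limits:
  assumes q: "0 < h q" "h q < h a" and s: "0 < s" and zero: "h (q + rcis s \<theta>) = h q" and "\<epsilon> > 0"
    and conic_r: "\<forall>x\<in>ball q r. \<forall>t\<in>{0..1}. h (q + t *\<^sub>R (x - q)) - h q = t * (h x - h q)" "s < r"
  obtains t t' where "\<bar>t - \<theta>\<bar> < \<epsilon>" "h q < h (q + rcis s t)" "\<bar>t' - \<theta>\<bar> < \<epsilon>" "h (q + rcis s t') < h q"
proof -
  let ?x = "q + rcis s \<theta>"
  have no: "\<not> weak_local_extremum h ?x"
    using no_extremum[of ?x] q zero by (metis less_irrefl)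
  let ?f = "\<lambda>y. (y - q) / rcis s \<theta>"
  have fx: "?f ?x = 1"
    using s by simp
  have "isCont ?f ?x"
    using s by (intro continuous_intros) simp
  moreover have "isCont Arg (?f ?x)"
    unfolding fx by (intro continuous_at_Arg) simp
  ultimately have "isCont (\<lambda>y. Arg (?f y)) ?x"
    by (rule isCont_o2)
  moreover have "Arg (?f ?x) = 0"
    unfolding fx by simp
  ultimately have "((\<lambda>y. Arg (?f y)) \<longlongrightarrow> 0) (at ?x)"
    unfolding isCont_def by simp
  then have "\<forall>\<^sub>F y in at ?x. \<bar>Arg ((y - q) / rcis s \<theta>)\<bar> < \<epsilon>"
    using tendstoD[OF _ \<open>\<epsilon> > 0\<close>] by fastforce
  then have "\<forall>\<^sub>F y in nhds ?x. \<bar>Arg ((y - q) / rcis s \<theta>)\<bar> < \<epsilon>"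
    using s \<open>\<epsilon> > 0\<close> by (simp add: eventually_nhds_conv_at)
  moreover have "\<forall>\<^sub>F y in nhds ?x. y \<in> ball q r - {q}"
    using s \<open>s < r\<close> by (intro eventually_nhds_in_open) (auto simp: dist_norm open_delete)
  ultimately have "\<forall>\<^sub>F y in nhds ?x. \<exists>t \<rho>. \<bar>t - \<theta>\<bar> < \<epsilon> \<and> 0 < \<rho> \<and> \<rho> < r \<and> y = q + rcis \<rho> t"
  proof eventually_elim
    case (elim y)
    let ?w = "(y - q) / rcis s \<theta>"
    have "?w = rcis (cmod ?w) (Arg ?w)"
      by (simp add: rcis_cmod_Arg)
    then have "y - q = rcis s \<theta> * rcis (cmod ?w) (Arg ?w)"
      using s by (metis nonzero_mult_div_cancel_left rcis_eq_zero_iff times_divide_eq_right less_irrefl)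
    also have "\<dots> = rcis (s * cmod ?w) (\<theta> + Arg ?w)"
      by (rule rcis_mult)
    also have "s * cmod ?w = cmod (y - q)"
      using s by (simp add: norm_divide)
    finally have "y = q + rcis (cmod (y - q)) (\<theta> + Arg ?w)"
      by (simp add: algebra_simps)
    moreover have "0 < cmod (y - q)" "cmod (y - q) < r"
      using elim by (auto simp: dist_norm norm_minus_commute)
    moreover have "\<bar>(\<theta> + Arg ?w) - \<theta>\<bar> < \<epsilon>"
      using elim by simp
    ultimately show ?case
      by blast
  qed
  then obtain \<eta> where \<eta>: "\<eta> > 0"
    "\<And>y. y \<in> ball ?x \<eta> \<Longrightarrow> \<exists>t \<rho>. \<bar>t - \<theta>\<bar> < \<epsilon> \<and> 0 < \<rho> \<and> \<rho> < r \<and> y = q + rcis \<rho> t"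
    unfolding eventually_nhds_metric by (auto simp: dist_commute)
  have ray: "h (q + rcis \<rho> t) - h q = (\<rho> / s) * (h (q + rcis s t) - h q)"
    if "0 < \<rho>" "\<rho> < r" for \<rho> t
    using along_ray[OF conic_r(1) s \<open>s < r\<close> that] .
  obtain y where y: "y \<in> ball ?x \<eta>" "h q < h y"
    using no \<eta>(1) zero unfolding weak_local_extremum_def by (metis linorder_not_le)
  obtain y' where y': "y' \<in> ball ?x \<eta>" "h y' < h q"
    using no \<eta>(1) zero unfolding weak_local_extremum_def by (metis linorder_not_le)
  obtain t \<rho> where t: "\<bar>t - \<theta>\<bar> < \<epsilon>" "0 < \<rho>" "\<rho> < r" "y = q + rcis \<rho> t"
    using \<eta>(2)[OF y(1)] by blast
  obtain t' \<rho>' where t': "\<bar>t' - \<theta>\<bar> < \<epsilon>" "0 < \<rho>'" "\<rho>' < r" "y' = q + rcis \<rho>' t'"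
    using \<eta>(2)[OF y'(1)] by blast
  have "0 < (\<rho> / s) * (h (q + rcis s t) - h q)"
    using ray[of \<rho> t] t y by simp
  then have "h q < h (q + rcis s t)"
    using t s by (simp add: zero_less_mult_iff zero_less_divide_iff)
  moreover have "(\<rho>' / s) * (h (q + rcis s t') - h q) < 0"
    using ray[of \<rho>' t'] t' y' by simp
  then have "h (q + rcis s t') < h q"
    using t' s by (simp add: mult_less_0_iff divide_less_0_iff)
  ultimately show thesis
    using that t t' by blast
qed

text \<open>
  Next to each of three level rays there are rising and falling rays. Whatever their order
  within each of the three groups, four of them alternate.
\<close>

lemma no_three_zeros:
  assumes q: "0 < h q" "h q < h a" and s: "0 < s" "s < r"
    and conic_r: "\<forall>x\<in>ball q r. \<forall>t\<in>{0..1}. h (q + t *\<^sub>R (x - q)) - h q = t * (h x - h q)"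
    and x: "x1 < x2" "x2 < x3" "x3 < x1 + 2 * pi"
    and zero: "h (q + rcis s x1) = h q" "h (q + rcis s x2) = h q" "h (q + rcis s x3) = h q"
  shows False
proof -
  define \<epsilon> where "\<epsilon> = min (x2 - x1) (min (x3 - x2) (x1 + 2 * pi - x3)) / 2"
  have \<epsilon>: "\<epsilon> > 0" "2 * \<epsilon> \<le> x2 - x1" "2 * \<epsilon> \<le> x3 - x2" "2 * \<epsilon> \<le> x1 + 2 * pi - x3"
    using x by (auto simp: \<epsilon>_def)
  obtain p1 n1 where 1: "\<bar>p1 - x1\<bar> < \<epsilon>" "h q < h (q + rcis s p1)" "\<bar>n1 - x1\<bar> < \<epsilon>" "h (q + rcis s n1) < h q"
    using sign_limits[OF q s(1) zero(1) \<epsilon>(1) conic_r s(2)] by blast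
  obtain p2 n2 where 2: "\<bar>p2 - x2\<bar> < \<epsilon>" "h q < h (q + rcis s p2)" "\<bar>n2 - x2\<bar> < \<epsilon>" "h (q + rcis s n2) < h q"
    using sign_limits[OF q s(1) zero(2) \<epsilon>(1) conic_r s(2)] by blast
  obtain p3 n3 where 3: "\<bar>p3 - x3\<bar> < \<epsilon>" "h q < h (q + rcis s p3)" "\<bar>n3 - x3\<bar> < \<epsilon>" "h (q + rcis s n3) < h q"
    using sign_limits[OF q s(1) zero(3) \<epsilon>(1) conic_r s(2)] by blast
  have n1': "h (q + rcis s (n1 + 2 * pi)) < h q"
    using 1 by (simp add: rcis_periodic)
  have "n3 \<noteq> p3" "n1 \<noteq> p1"
    using 1 3 by auto
  then consider "p3 < n3" | "n1 < p1" | "n3 < p3" "p1 < n1"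
    by linarith
  then show False
  proof cases
    case 1
    then show ?thesis
      using no_alternation[OF conic_r s, of p1 n2 p3 n3] \<open>\<bar>p1 - x1\<bar> < \<epsilon>\<close> \<open>h q < h (q + rcis s p1)\<close> 2 3 \<epsilon> by linarith
  next
    case 2
    then show ?thesis
      using no_alternation[OF conic_r s, of p1 n2 p3 "n1 + 2 * pi"] 1 \<open>\<bar>n2 - x2\<bar> < \<epsilon>\<close> \<open>h (q + rcis s n2) < h q\<close> 3 n1' \<epsilon>
      by linarith
  next
    case 3
    then show ?thesis
      using no_alternation[OF conic_r s, of p2 n3 p3 "n1 + 2 * pi"] 1 2 \<open>\<bar>n3 - x3\<bar> < \<epsilon>\<close> \<open>h (q + rcis s n3) < h q\<close>
       \<open>\<bar>p3 - x3\<bar> < \<epsilon>\<close> \<open>h q < h (q + rcis s p3)\<close> n1' \<epsilon>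
      by linarith
  qed
qed

lemma two_radii:
  assumes q: "0 < h q" "h q < h a"
  obtains r t1 t2 where "0 < r" "t1 < t2" "t2 < t1 + 2 * pi"
    "\<And>\<rho> t. 0 < \<rho> \<Longrightarrow> \<rho> < r \<Longrightarrow> t1 \<le> t \<Longrightarrow> t < t1 + 2 * pi \<Longrightarrow>
       h (q + rcis \<rho> t) = h q \<longleftrightarrow> t = t1 \<or> t = t2"
    "\<And>\<rho>. 0 < \<rho> \<Longrightarrow> \<rho> < r \<Longrightarrow> \<exists>t. h q < h (q + rcis \<rho> t)"
    "\<And>\<rho>. 0 < \<rho> \<Longrightarrow> \<rho> < r \<Longrightarrow> \<exists>t. h (q + rcis \<rho> t) < h q"
proof -
  obtain r where "r > 0"
    and r: "\<forall>x\<in>ball q r. \<forall>t\<in>{0..1}. h (q + t *\<^sub>R (x - q)) - h q = t * (h x - h q)"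
    using conic by blast
  define s where "s = r / 2"
  have s: "0 < s" "s < r"
    using \<open>r > 0\<close> by (auto simp: s_def)
  have ray: "h (q + rcis \<rho> t) - h q = (\<rho> / \<rho>') * (h (q + rcis \<rho>' t) - h q)"
    if "0 < \<rho>" "\<rho> < r" "0 < \<rho>'" "\<rho>' < r" for \<rho> \<rho>' t
    using along_ray[OF r that(3,4,1,2)] .
  have sgn: "sgn (h (q + rcis \<rho> t) - h q) = sgn (h (q + rcis \<rho>' t) - h q)"
    if "0 < \<rho>" "\<rho> < r" "0 < \<rho>'" "\<rho>' < r" for \<rho> \<rho>' t
    using ray[OF that, of t] that by (simp add: sgn_mult)
  have up_iff: "h q < h (q + rcis \<rho> t) \<longleftrightarrow> h q < h (q + rcis s t)"
    and down_iff: "h (q + rcis \<rho> t) < h q \<longleftrightarrow> h (q + rcis s t) < h q"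
    and zero_iff: "h (q + rcis \<rho> t) = h q \<longleftrightarrow> h (q + rcis s t) = h q"
    if "0 < \<rho>" "\<rho> < r" for \<rho> t
    using sgn[OF that s, of t] by (auto simp: sgn_if split: if_splits)
  have no: "\<not> weak_local_extremum h q"
    using no_extremum[of q] q by (metis less_irrefl)
  have polar: "\<exists>\<rho> t. 0 < \<rho> \<and> \<rho> < r \<and> y = q + rcis \<rho> t" if y: "y \<in> ball q r" "y \<noteq> q" for y
  proof -
    have "y - q \<noteq> 0"
      using y by simp
    then obtain t where "y - q = rcis (cmod (y - q)) t"
      using polar_from[of "y - q" 0] by blast
    then have "y = q + rcis (cmod (y - q)) t"
      by (simp add: algebra_simps)
    then show ?thesis
      using y by (intro exI[of _ "cmod (y - q)"] exI[of _ t]) (auto simp: dist_norm norm_minus_commute)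
  qed
  obtain y where "y \<in> ball q r" "h q < h y"
    using no \<open>r > 0\<close> unfolding weak_local_extremum_def by (metis linorder_not_le)
  then obtain tp where tp: "h q < h (q + rcis s tp)"
    using polar[of y] up_iff by auto
  obtain y where "y \<in> ball q r" "h y < h q"
    using no \<open>r > 0\<close> unfolding weak_local_extremum_def by (metis linorder_not_le)
  then obtain tn where tn: "h (q + rcis s tn) < h q"
    using polar[of y] down_iff by auto
  have contF: "continuous_on UNIV (\<lambda>t. h (q + rcis s t))"
    unfolding rcis_def by (intro continuous_on_compose2[OF cont] continuous_intros) auto
  have ivt: "\<exists>t. min x y < t \<and> t < max x y \<and> h (q + rcis s t) = h q"
    if xy: "h q < h (q + rcis s x)" "h (q + rcis s y) < h q" for x y
  proof -
    have "\<exists>t. min x y \<le> t \<and> t \<le> max x y \<and> h (q + rcis s t) = h q"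
    proof (cases "x \<le> y")
      case True
      then show ?thesis
        using IVT2'[of "\<lambda>t. h (q + rcis s t)" y "h q" x] xy contF continuous_on_subset by fastforce
    next
      case False
      then show ?thesis
        using IVT'[of "\<lambda>t. h (q + rcis s t)" y "h q" x] xy contF continuous_on_subset by fastforce
    qed
    then obtain t where t: "min x y \<le> t" "t \<le> max x y" "h (q + rcis s t) = h q"
      by blast
    moreover have "t \<noteq> x" "t \<noteq> y"
      using t xy by auto
    ultimately show ?thesis
      by (intro exI[of _ t]) (auto simp: min_def max_def split: if_splits)
  qed
  obtain t1 where t1: "h (q + rcis s t1) = h q"
    using ivt[OF tp tn] by blast
  obtain tp' where tp': "t1 \<le> tp'" "tp' < t1 + 2 * pi" "h q < h (q + rcis s tp')"
    using shift_angle[of t1 tp] tp by metis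
  obtain tn' where tn': "t1 \<le> tn'" "tn' < t1 + 2 * pi" "h (q + rcis s tn') < h q"
    using shift_angle[of t1 tn] tn by metis
  obtain t2 where t2: "min tp' tn' < t2" "t2 < max tp' tn'" "h (q + rcis s t2) = h q"
    using ivt[OF tp'(3) tn'(3)] by blast
  have t12: "t1 < t2" "t2 < t1 + 2 * pi"
    using t2 tp' tn' by linarith+
  have only: "t = t1 \<or> t = t2"
    if zt: "h (q + rcis s t) = h q" "t1 \<le> t" "t < t1 + 2 * pi" for t
  proof (rule ccontr)
    assume "\<not> (t = t1 \<or> t = t2)"
    then consider "t1 < t" "t < t2" | "t2 < t"
      using zt by linarith
    then show False
    proof cases
      case 1
      then show ?thesis using no_three_zeros[OF q s r 1 t12(2) t1 zt(1) t2(3)] by simp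
    next
      case 2
      then show ?thesis using no_three_zeros[OF q s r t12(1) 2 zt(3) t1 t2(3) zt(1)] by simp
    qed
  qed
  show thesis
  proof (rule that[OF \<open>r > 0\<close> t12])
    fix \<rho> t assume "0 < \<rho>" "\<rho> < r" "t1 \<le> t" "t < t1 + 2 * pi"
    then show "h (q + rcis \<rho> t) = h q \<longleftrightarrow> t = t1 \<or> t = t2"
      using zero_iff[of \<rho> t] only[of t] t1 t2(3) by blast
  qed (use up_iff down_iff tp tn in blast)+
qed

lemma locally_path_connected_level: "locally path_connected (level_curve h z)"
proof (rule locally_path_connected_1)
  fix v x assume v: "openin (top_of_set (level_curve h z)) v" and x: "x \<in> v"
  then obtain T where T: "open T" "v = level_curve h z \<inter> T"
    by (auto simp: openin_open)
  obtain r0 where r0: "r0 > 0" "ball x r0 \<subseteq> T"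
    using T x open_contains_ball by blast
  obtain r where "r > 0"
    and r: "\<forall>y\<in>ball x r. \<forall>t\<in>{0..1}. h (x + t *\<^sub>R (y - x)) - h x = t * (h y - h x)"
    using conic by blast
  define u where "u = level_curve h z \<inter> ball x (min r r0)"
  have hx: "h x = z"
    using x T by (simp add: level_curve_def)
  have "x \<in> u"
    using r0 \<open>r > 0\<close> hx by (simp add: u_def level_curve_def)
  have "closed_segment x y \<subseteq> u" if "y \<in> u" for y
  proof -
    have "h ((1 - t) *\<^sub>R x + t *\<^sub>R y) = z" if "t \<in> {0..1}" for t
    proof -
      have "(1 - t) *\<^sub>R x + t *\<^sub>R y = x + t *\<^sub>R (y - x)"
        by (simp add: algebra_simps)
      moreover have "h (x + t *\<^sub>R (y - x)) - h x = t * (h y - h x)"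
        using r that \<open>y \<in> u\<close> by (simp add: u_def)
      ultimately show ?thesis
        using hx \<open>y \<in> u\<close> by (simp add: u_def level_curve_def)
    qed
    moreover have "closed_segment x y \<subseteq> ball x (min r r0)"
      using that \<open>x \<in> u\<close> by (intro closed_segment_subset) (auto simp: u_def)
    ultimately show ?thesis
      by (auto simp: u_def level_curve_def closed_segment_def)
  qed
  then have "path_connected u"
    using \<open>x \<in> u\<close> by (intro starlike_imp_path_connected) (auto simp: starlike_def)
  moreover have "openin (top_of_set (level_curve h z)) u"
    unfolding u_def by (simp add: openin_open_Int)
  moreover have "u \<subseteq> v"
    using T r0 by (auto simp: u_def)
  ultimately show "\<exists>u. openin (top_of_set (level_curve h z)) u \<and> path_connected u \<and> x \<in> u \<and> u \<subseteq> v"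
    using \<open>x \<in> u\<close> by blast
qed

lemma compact_level: assumes "0 < z" shows "compact (level_curve h z)"
proof -
  have "bounded (level_curve h z)"
    using support by (rule bounded_subset) (use assms in \<open>auto simp: level_curve_def\<close>)
  then show ?thesis
    using closed_level by (simp add: compact_eq_bounded_closed level_curve_def)
qed

end

context mountain
begin

lemma level_points_on_radii:
  assumes "h q = z"
    and only: "\<And>\<rho> t. 0 < \<rho> \<Longrightarrow> \<rho> < r \<Longrightarrow> t1 \<le> t \<Longrightarrow> t < t1 + 2 * pi \<Longrightarrow>
       h (q + rcis \<rho> t) = h q \<longleftrightarrow> t = t1 \<or> t = t2"
    and t: "t1 < t2" "t2 < t1 + 2 * pi" and "0 < \<rho>" "\<rho> < r"
  shows "level_curve h z \<inter> cball q \<rho> =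
    closed_segment q (q + rcis \<rho> t1) \<union> closed_segment q (q + rcis \<rho> t2)"
proof (intro equalityI subsetI)
  fix x assume x: "x \<in> level_curve h z \<inter> cball q \<rho>"
  show "x \<in> closed_segment q (q + rcis \<rho> t1) \<union> closed_segment q (q + rcis \<rho> t2)"
  proof (cases "x = q")
    case False
    then have "x - q \<noteq> 0"
      by simp
    then obtain t where tt: "t1 \<le> t" "t < t1 + 2 * pi" "x - q = rcis (cmod (x - q)) t"
      using polar_from by blast
    define d where "d = cmod (x - q)"
    have d: "0 < d" "d \<le> \<rho>" "x = q + rcis d t"
      using x False tt(3) by (auto simp: d_def dist_norm norm_minus_commute algebra_simps)
    then have "t = t1 \<or> t = t2"
      using only[of d t] tt x \<open>\<rho> < r\<close> \<open>h q = z\<close> by (simp add: level_curve_def)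
    then show ?thesis
      using d \<open>0 < \<rho>\<close> by (auto simp: radius_eq)
  qed simp
next
  fix x assume "x \<in> closed_segment q (q + rcis \<rho> t1) \<union> closed_segment q (q + rcis \<rho> t2)"
  then obtain d t where d: "0 \<le> d" "d \<le> \<rho>" "x = q + rcis d t" "t = t1 \<or> t = t2"
    using \<open>0 < \<rho>\<close> by (auto simp: radius_eq)
  have "h x = z"
    using only[of d t] d t \<open>\<rho> < r\<close> \<open>h q = z\<close> by (cases "d = 0") auto
  then show "x \<in> level_curve h z \<inter> cball q \<rho>"
    using d by (auto simp: level_curve_def dist_norm)
qed

text \<open>
  In polar coordinates a disc without one of its radii is a rectangle, so it is connected. Hence
  a set that meets a disc in a subset of a radius does not separate other points of the disc.
\<close>

lemma slit_disc:
  assumes disj: "X \<inter> ball q \<rho> \<subseteq> closed_segment q (q + rcis \<rho> t1)"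
    and x: "x \<in> ball q \<rho>" "x \<notin> closed_segment q (q + rcis \<rho> t1)"
    and y: "y \<in> ball q \<rho>" "y \<notin> closed_segment q (q + rcis \<rho> t1)" and "0 < \<rho>"
  shows "connected_component (- X) x y"
proof -
  define W where "W = (\<lambda>(r, t). q + rcis r t) ` ({0<..<\<rho>} \<times> {t1<..<t1 + 2 * pi})"
  have "connected W"
    unfolding W_def rcis_def case_prod_unfold
    by (intro connected_continuous_image connected_Times continuous_intros) auto
  have in_W: "w \<in> W" if w: "w \<in> ball q \<rho>" "w \<notin> closed_segment q (q + rcis \<rho> t1)" for w
  proof -
    have "w - q \<noteq> 0"
      using w by auto
    then obtain t where t: "t1 \<le> t" "t < t1 + 2 * pi" "w - q = rcis (cmod (w - q)) t"
      using polar_from by blast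
    define d where "d = cmod (w - q)"
    have d: "0 < d" "d < \<rho>" "w = q + rcis d t"
      using w \<open>w - q \<noteq> 0\<close> t(3) by (auto simp: d_def dist_norm norm_minus_commute algebra_simps)
    have "t \<noteq> t1"
      using w(2) d \<open>0 < \<rho>\<close> by (auto simp: radius_eq)
    then have "(d, t) \<in> {0<..<\<rho>} \<times> {t1<..<t1 + 2 * pi}"
      using t d by auto
    then show ?thesis
      unfolding W_def d(3) by (metis (no_types, lifting) case_prod_conv imageI)
  qed
  have "W \<subseteq> - X"
  proof
    fix w assume "w \<in> W"
    then obtain d t where d: "0 < d" "d < \<rho>" "t1 < t" "t < t1 + 2 * pi" "w = q + rcis d t"
      by (auto simp: W_def)
    have "w \<notin> closed_segment q (q + rcis \<rho> t1)"
    proof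
      assume "w \<in> closed_segment q (q + rcis \<rho> t1)"
      then obtain d' where d': "0 \<le> d'" "rcis d t = rcis d' t1"
        using d(5) \<open>0 < \<rho>\<close> by (auto simp: radius_eq)
      then have "0 < d'"
        using d by (cases "d' = 0") auto
      then show False
        using rcis_inj[OF d'(2)] d by simp
    qed
    moreover have "w \<in> ball q \<rho>"
      using d by (simp add: dist_norm)
    ultimately show "w \<in> - X"
      using disj by blast
  qed
  then show ?thesis
    unfolding connected_component_def using \<open>connected W\<close> in_W x y by blast
qed

text \<open>
  Near a point \<open>q\<close> the level set consists of two radii. If their ends were not
  connected in the level set outside the disc, the level set would be the union of two compact
  sets that meet only in \<open>q\<close>, each of which contains one radius and therefore does
  not separate a higher point near \<open>q\<close> from a lower one. By Janiszewski's theorem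
  the level set would not separate them either. So the ends are connected, and a path between
  them closes up to a Jordan curve.
\<close>

lemma level_simple_closed_curve:
  assumes z: "0 < z" "z < h a"
  shows "simple_closed_curve (level_curve h z)"
proof -
  let ?S = "level_curve h z"
  obtain q where hq: "h q = z"
    using level_nonempty z by blast
  obtain r t1 t2 where "0 < r" and t: "t1 < t2" "t2 < t1 + 2 * pi"
    and only: "\<And>\<rho> t. 0 < \<rho> \<Longrightarrow> \<rho> < r \<Longrightarrow> t1 \<le> t \<Longrightarrow> t < t1 + 2 * pi \<Longrightarrow>
       h (q + rcis \<rho> t) = h q \<longleftrightarrow> t = t1 \<or> t = t2"
    and up: "\<And>\<rho>. 0 < \<rho> \<Longrightarrow> \<rho> < r \<Longrightarrow> \<exists>t. h q < h (q + rcis \<rho> t)"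
    and down: "\<And>\<rho>. 0 < \<rho> \<Longrightarrow> \<rho> < r \<Longrightarrow> \<exists>t. h (q + rcis \<rho> t) < h q"
    using two_radii[of q] z hq by blast
  define \<rho> where "\<rho> = r / 2"
  have \<rho>: "0 < \<rho>" "\<rho> < r"
    using \<open>0 < r\<close> by (auto simp: \<rho>_def)
  let ?b1 = "q + rcis \<rho> t1" and ?b2 = "q + rcis \<rho> t2"
  have near: "?S \<inter> cball q \<rho> = closed_segment q ?b1 \<union> closed_segment q ?b2"
    by (rule level_points_on_radii[OF hq only t \<rho>])
  define S' where "S' = ?S - ball q \<rho>"
  have "compact S'"
    unfolding S'_def by (intro compact_diff compact_level z) simp
  have b: "?b1 \<in> S'" "?b2 \<in> S'"
    using near \<rho> by (auto simp: S'_def dist_norm)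
  have end_only: "x = q + rcis \<rho> t" if "x \<in> closed_segment q (q + rcis \<rho> t)" "x \<notin> ball q \<rho>" for x t
    using that \<rho> by (auto simp: radius_eq dist_norm)
  have meet: "x = q" if x: "x \<in> closed_segment q ?b1" "x \<in> closed_segment q ?b2" for x
  proof -
    obtain d d' where d: "0 \<le> d" "0 \<le> d'" "x = q + rcis d t1" "x = q + rcis d' t2"
      using x \<rho> by (auto simp: radius_eq)
    then have eq: "rcis d t1 = rcis d' t2"
      by simp
    then have "d = d'"
      using d by (metis abs_of_nonneg complex_mod_rcis)
    then show ?thesis
      using rcis_inj[OF eq] t d by (cases "d = 0") auto
  qed
  have sep: "\<not> connected_component (- ?S) u w" if "z < h u" "h w < z" for u w
  proof
    assume "connected_component (- ?S) u w"
    then have "w \<in> inside ?S \<longleftrightarrow> u \<in> inside ?S"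
      by (meson inside_same_component connected_component_sym)
    then show False
      using that z by (simp add: inside_outside_level)
  qed
  have comp: "connected_component S' ?b1 ?b2"
  proof (rule ccontr)
    assume "\<not> connected_component S' ?b1 ?b2"
    define C where "C = connected_component_set S' ?b1"
    have C: "C \<in> components S'" "?b1 \<in> C" "?b2 \<notin> C"
      using b \<open>\<not> connected_component S' ?b1 ?b2\<close> by (auto simp: C_def componentsI)
    have "C = \<Inter>{T. C \<subseteq> T \<and> openin (top_of_set S') T \<and> closedin (top_of_set S') T}"
      by (rule Sura_Bura_compact[OF \<open>compact S'\<close> C(1)])
    then obtain T where T: "C \<subseteq> T" "openin (top_of_set S') T" "closedin (top_of_set S') T" "?b2 \<notin> T"
      using C(3) by blast
    have T': "closedin (top_of_set S') (S' - T)"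
      using T(2) by (simp add: closedin_diff)
    have "compact T" "compact (S' - T)"
      using T(3) T' \<open>compact S'\<close> closedin_compact by blast+
    have "T \<subseteq> S'"
      using T(2) openin_imp_subset by blast
    (* T is open and closed in the level set outside the disc and contains the end of only one
       of the two radii; it exists because components of compact sets are intersections of such
       parts. *)
    define X Y where "X = T \<union> closed_segment q ?b1" and "Y = (S' - T) \<union> closed_segment q ?b2"
    have XY: "X \<union> Y = ?S"
      using near \<open>T \<subseteq> S'\<close> by (auto simp: X_def Y_def S'_def)
    have "T \<inter> closed_segment q ?b2 = {}"
      using end_only[of _ t2] T(4) \<open>T \<subseteq> S'\<close> unfolding S'_def by blast
    moreover have "(S' - T) \<inter> closed_segment q ?b1 = {}"
      using end_only[of _ t1] T(1) C(2) unfolding S'_def by blast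
    ultimately have "X \<inter> Y = {q}"
      using meet by (auto simp: X_def Y_def)
    obtain tp where "z < h (q + rcis (\<rho> / 2) tp)"
      using up[of "\<rho> / 2"] \<rho> hq by auto
    then obtain u where u: "u \<in> ball q \<rho>" "z < h u"
      using \<rho> that[of "q + rcis (\<rho> / 2) tp"] by (auto simp: dist_norm)
    obtain tn where "h (q + rcis (\<rho> / 2) tn) < z"
      using down[of "\<rho> / 2"] \<rho> hq by auto
    then obtain w where w: "w \<in> ball q \<rho>" "h w < z"
      using \<rho> that[of "q + rcis (\<rho> / 2) tn"] by (auto simp: dist_norm)
    have "x \<notin> closed_segment q ?b1 \<union> closed_segment q ?b2" if "h x \<noteq> z" for x
      using near that unfolding level_curve_def by blast
    then have off: "u \<notin> closed_segment q ?b1" "u \<notin> closed_segment q ?b2"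
      "w \<notin> closed_segment q ?b1" "w \<notin> closed_segment q ?b2"
      using u w by fastforce+
    have "connected_component (- X) u w"
      using slit_disc[of X q \<rho> t1 u w] off u w \<rho> \<open>T \<subseteq> S'\<close> by (auto simp: X_def S'_def)
    moreover have "connected_component (- Y) u w"
      using slit_disc[of Y q \<rho> t2 u w] off u w \<rho> by (auto simp: Y_def S'_def)
    ultimately have "connected_component (- (X \<union> Y)) u w"
      using \<open>compact T\<close> \<open>compact (S' - T)\<close> \<open>X \<inter> Y = {q}\<close>
      by (intro Janiszewski) (auto simp: X_def Y_def compact_Un compact_imp_closed closed_Un)
    then show False
      using sep u w XY by metis
  qed
  have "S' \<subseteq> ?S - {q}"
    using \<rho> by (auto simp: S'_def)
  then have "connected_component (?S - {q}) ?b1 ?b2"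
    using comp connected_component_of_subset by blast
  moreover have "locally path_connected (?S - {q})"
    by (intro locally_open_subset[OF locally_path_connected_level[of z]] openin_delete) simp
  ultimately have "path_component (?S - {q}) ?b1 ?b2"
    by (simp add: path_component_eq_connected_component)
  then obtain \<gamma> where \<gamma>: "path \<gamma>" "path_image \<gamma> \<subseteq> ?S - {q}" "pathstart \<gamma> = ?b1" "pathfinish \<gamma> = ?b2"
    unfolding path_component_def by blast
  then have "q \<notin> path_image \<gamma>"
    by blast
  obtain c \<delta> where c: "simple_path c" "pathfinish c = pathstart c" and "0 < \<delta>" "\<delta> < \<rho>"
    and img: "path_image c \<subseteq> path_image \<gamma> \<union> closed_segment q ?b1 \<union> closed_segment q ?b2"
    and "path_image c \<inter> ball q \<delta> = {q + rcis r t | r t. 0 \<le> r \<and> r < \<delta> \<and> t \<in> {t1, t2}}"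
    by (rule simple_loop_at_corner[OF t \<rho>(1) \<gamma>(1,3,4) \<open>q \<notin> path_image \<gamma>\<close>])
  have cS: "path_image c \<subseteq> ?S"
    using img \<gamma>(2) near by blast
  (* The curve is not a proper part of the level set: the sets above and below fill its two
     sides, and every point of the level set is a limit of both. *)
  have "?S \<subseteq> path_image c"
  proof
    let ?I = "inside (path_image c)" and ?O = "outside (path_image c)"
    have J: "open ?I" "open ?O" "?I \<inter> ?O = {}" "?I \<union> ?O = - path_image c" "?I \<noteq> {}"
      "bounded ?I"
      using Jordan_inside_outside[OF c] by simp_all
    have both: "\<exists>u\<in>T. z < h u" "\<exists>w\<in>T. h w < z" if "open T" "x \<in> T" "x \<in> ?S" for T x
    proof -
      obtain e where e: "e > 0" "ball x e \<subseteq> T"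
        using \<open>open T\<close> \<open>x \<in> T\<close> open_contains_ball by blast
      have "h x = z"
        using \<open>x \<in> ?S\<close> by (simp add: level_curve_def)
      then have "\<not> weak_local_extremum h x"
        using no_extremum[of x] z by (metis less_irrefl)
      then show "\<exists>u\<in>T. z < h u" "\<exists>w\<in>T. h w < z"
        using e \<open>h x = z\<close> unfolding weak_local_extremum_def by (metis linorder_not_le subsetD)+
    qed
    have U: "{x. z < h x} \<subseteq> ?I \<or> {x. z < h x} \<subseteq> ?O"
      and D: "{x. h x < z} \<subseteq> ?I \<or> {x. h x < z} \<subseteq> ?O"
    proof -
      have "?I \<inter> A = {} \<or> ?O \<inter> A = {}" if "connected A" "A \<inter> ?S = {}" for A
      proof (rule connectedD[OF that(1) J(1,2)])
        show "?I \<inter> ?O \<inter> A = {}"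
          using J(3) by blast
        show "A \<subseteq> ?I \<union> ?O"
          unfolding J(4) using that cS by blast
      qed
      moreover have "A \<subseteq> ?I \<union> ?O" if "A \<inter> ?S = {}" for A
        unfolding J(4) using that cS by blast
      ultimately have *: "A \<subseteq> ?I \<or> A \<subseteq> ?O" if "connected A" "A \<inter> ?S = {}" for A
        using that by blast
      show "{x. z < h x} \<subseteq> ?I \<or> {x. z < h x} \<subseteq> ?O"
        using connected_above[of z] z by (intro *) (auto simp: level_curve_def)
      show "{x. h x < z} \<subseteq> ?I \<or> {x. h x < z} \<subseteq> ?O"
        using connected_below[of z] z by (intro *) (auto simp: level_curve_def)
    qed
    have D': "{x. h x < z} \<subseteq> ?O"
      using D unbounded_below[OF z(1)] J(6) bounded_subset by blast
    have "\<not> {x. z < h x} \<subseteq> ?O"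
    proof
      assume "{x. z < h x} \<subseteq> ?O"
      then have up: "x \<in> ?O" if "z < h x" for x
        using that by blast
      have I: "?I \<subseteq> ?S"
      proof
        fix x assume "x \<in> ?I"
        then have "x \<notin> ?O"
          using J(3) by blast
        then have "\<not> z < h x" "\<not> h x < z"
          using up D' by auto
        then show "x \<in> ?S"
          by (simp add: level_curve_def)
      qed
      obtain x where "x \<in> ?I"
        using J(5) by blast
      then obtain u where "u \<in> ?I" "z < h u"
        using both(1)[of ?I x] J(1) I by blast
      then show False
        using I by (auto simp: level_curve_def)
    qed
    then have U': "{x. z < h x} \<subseteq> ?I"
      using U by blast
    fix x assume x: "x \<in> ?S"
    show "x \<in> path_image c"
    proof (rule ccontr)
      assume "x \<notin> path_image c"
      then consider "x \<in> ?I" | "x \<in> ?O"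
        using J(4) by blast
      then show False
      proof cases
        case 1
        then obtain w where "w \<in> ?I" "h w < z"
          using both(2)[OF J(1) _ x] by blast
        then show ?thesis
          using D' J(3) by blast
      next
        case 2
        then obtain w where "w \<in> ?O" "z < h w"
          using both(1)[OF J(2) _ x] by blast
        then show ?thesis
          using U' J(3) by blast
      qed
    qed
  qed
  then show ?thesis
    using c cS unfolding simple_closed_curve_def by blast
qed

lemma inside_frontier: "inside (frontier {x. 0 < h x}) = {x. 0 < h x}"
proof -
  let ?K = "closure Out"
  have K: "{x. 0 < h x} = - ?K"
    using zero_iff nonneg by (auto simp: less_le)
  have "Out \<subseteq> interior ?K"
    using Out(1) closure_subset by (rule interior_maximal[rotated])
  then have "connected (interior ?K)" "\<not> bounded (interior ?K)"
    using connected_intermediate_closure[OF Out(2)] interior_subset Out(3) bounded_subset by blast+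
  moreover have "- frontier {x. 0 < h x} = {x. 0 < h x} \<union> interior ?K"
    unfolding K frontier_complement by (auto simp: frontier_def dest: interior_subset[THEN subsetD])
  moreover have "bounded {x. 0 < h x}"
    by (rule bounded_above) simp
  moreover have "{x. 0 < h x} \<inter> interior ?K = {}"
    unfolding K using interior_subset by blast
  ultimately show ?thesis
    using inside_outside_of_split[of _ "{x. 0 < h x}" "interior ?K"] open_above by simp
qed

lemma frontier_zero: assumes "x \<in> frontier {x. 0 < h x}" shows "h x = 0"
proof -
  have "x \<notin> {x. 0 < h x}"
    using assms open_above by (simp add: frontier_def interior_open)
  then show ?thesis
    using nonneg[of x] by simp
qed

text \<open>
  Away from the frontier \<open>h\<close> is bounded below by a positive constant, so low level
  curves are close to the frontier. Conversely, by compactness finitely many small discs cover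
  the frontier; each contains a point of height \<open>0\<close> and a higher one, so all
  sufficiently low level curves pass through it.
\<close>

lemma tends_to_frontier: "hausdorff_tendsto (level_curve h) (frontier {x. 0 < h x}) (at_right 0)"
  unfolding hausdorff_tendsto_def
proof (intro allI impI eventually_conj)
  let ?\<Omega> = "{x. 0 < h x}" and ?B = "frontier {x. 0 < h x}"
  fix e :: real assume "e > 0"
  have b\<Omega>: "bounded ?\<Omega>"
    by (rule bounded_above) simp
  define A where "A = closure ?\<Omega> - (\<Union>b\<in>?B. ball b e)"
  have "compact A"
    unfolding A_def using b\<Omega> by (intro compact_diff) auto
  have A_pos: "0 < h x" if "x \<in> A" for x
  proof -
    have "x \<notin> ?B"
      using that \<open>e > 0\<close> centre_in_ball by (fastforce simp: A_def)
    then show ?thesis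
      using that open_above[of 0] by (simp add: A_def frontier_def interior_open)
  qed
  obtain m where m: "0 < m" "\<And>x. x \<in> A \<Longrightarrow> m \<le> h x"
  proof (cases "A = {}")
    case False
    then obtain y where "y \<in> A" "\<And>x. x \<in> A \<Longrightarrow> h y \<le> h x"
      using continuous_attains_inf[OF \<open>compact A\<close> False, of h] continuous_on_subset[OF cont] by blast
    then show ?thesis
      using that A_pos by blast
  qed (use that[of 1] in auto)
  show "\<forall>\<^sub>F z in at_right 0. \<forall>x\<in>level_curve h z. \<exists>b\<in>?B. dist x b < e"
    unfolding eventually_at_right_field
  proof (intro exI[of _ m] conjI allI impI ballI m(1))
    fix z x assume z: "0 < z" "z < m" and x: "x \<in> level_curve h z"
    have "x \<in> closure ?\<Omega>"
      using x z by (intro closure_subset[THEN subsetD]) (simp add: level_curve_def)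
    moreover have "x \<notin> A"
      using x z m(2)[of x] by (auto simp: level_curve_def)
    ultimately obtain b where "b \<in> ?B" "x \<in> ball b e"
      unfolding A_def by blast
    then show "\<exists>b\<in>?B. dist x b < e"
      by (auto simp: dist_commute)
  qed
  have "compact ?B"
    using b\<Omega> by (simp add: compact_frontier_bounded)
  moreover have "?B \<subseteq> (\<Union>b\<in>?B. ball b (e / 2))"
    using \<open>e > 0\<close> by auto
  ultimately obtain N where N: "N \<subseteq> ?B" "finite N" "?B \<subseteq> (\<Union>b\<in>N. ball b (e / 2))"
    using compactE_image[of ?B ?B "\<lambda>b. ball b (e / 2)"] by auto
  have "\<exists>y. y \<in> ?\<Omega> \<and> dist y b < e / 2" if "b \<in> ?B" for b
    using that \<open>e > 0\<close> unfolding frontier_def closure_approachable Diff_iff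
    by (metis half_gt_zero)
  then obtain y where y: "\<And>b. b \<in> ?B \<Longrightarrow> y b \<in> ?\<Omega> \<and> dist (y b) b < e / 2"
    by metis
  define m' where "m' = Min (insert 1 (h ` y ` N))"
  have "0 < m'"
    unfolding m'_def using N y by (subst Min_gr_iff) auto
  have m': "m' \<le> h (y b)" if "b \<in> N" for b
    unfolding m'_def using N that by (intro Min_le) auto
  show "\<forall>\<^sub>F z in at_right 0. \<forall>b\<in>?B. \<exists>x\<in>level_curve h z. dist x b < e"
    unfolding eventually_at_right_field
  proof (intro exI[of _ m'] conjI allI impI ballI \<open>0 < m'\<close>)
    fix z b assume z: "0 < z" "z < m'" and b: "b \<in> ?B"
    obtain b' where b': "b' \<in> N" "b \<in> ball b' (e / 2)"
      using N(3) b by blast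
    have "h b' = 0"
      using frontier_zero b'(1) N(1) by blast
    moreover have "y b' \<in> ball b' (e / 2)"
      using y[of b'] b'(1) N(1) by (auto simp: dist_commute)
    ultimately obtain x where x: "x \<in> ball b' (e / 2)" "h x = z"
      using connected_ivt[of "ball b' (e / 2)" h b' "y b'" z] m'[OF b'(1)] z \<open>e > 0\<close>
        continuous_on_subset[OF cont] by auto
    have "dist x b < e"
      using x(1) b'(2) dist_triangle_half_r[of b' x e b] by simp
    then show "\<exists>x\<in>level_curve h z. dist x b < e"
      using x(2) by (auto simp: level_curve_def)
  qed
qed

text \<open>
  Outside a disc around \<open>a\<close> the function stays below a constant less than \<open>h
  a\<close>.
\<close>

lemma tends_to_summit: "hausdorff_tendsto (level_curve h) {a} (at_left (h a))"
  unfolding hausdorff_tendsto_def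
proof (intro allI impI)
  fix e :: real assume "e > 0"
  define A where "A = {x. h a / 2 \<le> h x} - ball a e"
  have "compact {x. h a / 2 \<le> h x}"
    using bounded_at_least[of "h a / 2"] summit
    by (auto simp: compact_eq_bounded_closed intro!: closed_Collect_le continuous_intros cont)
  then have "compact A"
    unfolding A_def by (intro compact_diff) auto
  obtain m where m: "m < h a" "\<And>x. x \<in> A \<Longrightarrow> h x \<le> m"
  proof (cases "A = {}")
    case False
    then obtain y where y: "y \<in> A" "\<And>x. x \<in> A \<Longrightarrow> h x \<le> h y"
      using continuous_attains_sup[OF \<open>compact A\<close> False, of h] continuous_on_subset[OF cont] by blast
    then have "y \<noteq> a"
      using \<open>e > 0\<close> by (auto simp: A_def)
    then show ?thesis
      using that y less_summit by blast
  qed (use that[of 0] summit in auto)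
  have m': "max m (h a / 2) < h a"
    using m(1) summit by simp
  show "\<forall>\<^sub>F z in at_left (h a). (\<forall>x\<in>level_curve h z. \<exists>b\<in>{a}. dist x b < e) \<and>
      (\<forall>b\<in>{a}. \<exists>x\<in>level_curve h z. dist x b < e)"
    unfolding eventually_at_left_field
  proof (intro exI[of _ "max m (h a / 2)"] conjI allI impI m')
    fix z assume z: "max m (h a / 2) < z" "z < h a"
    have close: "dist x a < e" if "x \<in> level_curve h z" for x
    proof -
      have "x \<notin> A"
        using m(2)[of x] that z by (auto simp: level_curve_def)
      then show ?thesis
        using that z by (auto simp: A_def level_curve_def dist_commute)
    qed
    then show "\<forall>x\<in>level_curve h z. \<exists>b\<in>{a}. dist x b < e"
      by blast
    have "0 < z"
      using z summit by simp
    then obtain x where "h x = z"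
      using level_nonempty z(2) by blast
    then have "x \<in> level_curve h z"
      by (simp add: level_curve_def)
    then show "\<forall>b\<in>{a}. \<exists>x\<in>level_curve h z. dist x b < e"
      using close by blast
  qed
qed

lemma levels_move_monotonically:
  "moves_monotonically (level_curve h) 0 (h a) (frontier {x. 0 < h x}) a"
  unfolding moves_monotonically_def
  using tends_to_frontier tends_to_summit
  by (auto simp: inside_outside_level inside_frontier) (auto simp: level_curve_def)

end

section \<open>Oriented angles\<close>

definition cross :: "complex \<Rightarrow> complex \<Rightarrow> real" where
  "cross a b = Re a * Im b - Im a * Re b"

lemma inner_ii: "inner (\<i> * a) b = cross a b" "inner b (\<i> * a) = cross a b"
  by (simp_all add: inner_complex_def cross_def)

lemma cross_swap: "cross b a = - cross a b"
  by (simp add: cross_def)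

lemma cross_scale: "cross (s *\<^sub>R a) b = s * cross a b" "cross a (s *\<^sub>R b) = s * cross a b"
  "cross (- a) b = - cross a b" "cross a (- b) = - cross a b"
  by (simp_all add: cross_def algebra_simps)

lemma cross_ii: "cross (\<i> * a) b = - inner a b" "cross (\<i> * a) (\<i> * b) = cross a b"
  by (simp_all add: inner_complex_def cross_def)

lemma perp_ex:
  assumes "inner a b = 0" "b \<noteq> (0::complex)"
  obtains s where "a = s *\<^sub>R (\<i> * b)"
proof -
  let ?n = "(Re b)\<^sup>2 + (Im b)\<^sup>2"
  have n: "?n \<noteq> 0"
    using assms(2) by (simp add: complex_eq_iff sum_power2_eq_zero_iff)
  have eq: "Re a * Re b + Im a * Im b = 0"
    using assms(1) by (simp add: inner_complex_def)
  have "Re a * ?n = - (cross b a) * Im b" "Im a * ?n = cross b a * Re b"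
    using eq unfolding cross_def by algebra+
  then have "a = (cross b a / ?n) *\<^sub>R (\<i> * b)"
    using n by (simp add: complex_eq_iff field_simps)
  then show thesis
    by (rule that)
qed

lemma cone_decomposition:
  assumes "cross a b \<noteq> 0"
  shows "w = (cross w b / cross a b) *\<^sub>R a + (cross a w / cross a b) *\<^sub>R b"
proof -
  have "cross a b * Re w = cross w b * Re a + cross a w * Re b"
    "cross a b * Im w = cross w b * Im a + cross a w * Im b"
    unfolding cross_def by algebra+
  then show ?thesis
    using assms by (simp add: complex_eq_iff field_simps)
qed

lemma ccw_angle_pos: "0 < ccw_angle u w" and ccw_angle_le: "ccw_angle u w \<le> 2 * pi"
  using Arg2pi_lt_2pi[of "u / w"] Arg2pi_ge_0[of "u / w"] by (simp_all add: ccw_angle_def)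

lemma ccw_angle_polar:
  assumes "u \<noteq> 0" "w \<noteq> 0"
  shows "w = rcis (cmod w / cmod u) (ccw_angle u w) * u"
proof -
  let ?A = "Arg2pi (u / w)"
  have "u / w = complex_of_real (cmod u / cmod w) * cis ?A"
    using Arg2pi_eq[of "u / w"] by (simp add: cis_conv_exp norm_divide)
  then have "w * (complex_of_real (cmod u / cmod w) * cis ?A) = u"
    using assms by (metis nonzero_mult_div_cancel_left times_divide_eq_right)
  moreover have "cis ?A * cis (2 * pi - ?A) = 1"
    by (simp add: cis_mult)
  ultimately have "w * (complex_of_real (cmod u / cmod w)) = u * cis (2 * pi - ?A)"
    by (metis (no_types, lifting) mult.assoc mult.right_neutral)
  then have "w * (complex_of_real (cmod u / cmod w)) * complex_of_real (cmod w / cmod u) =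
      u * cis (2 * pi - ?A) * complex_of_real (cmod w / cmod u)"
    by simp
  moreover have "complex_of_real (cmod u / cmod w) * complex_of_real (cmod w / cmod u) = 1"
    using assms by simp
  ultimately show ?thesis
    by (simp add: rcis_def ccw_angle_def mult_ac)
qed

lemma ccw_angle_unique:
  assumes "w = rcis r \<theta> * u" "0 < r" "0 < \<theta>" "\<theta> \<le> 2 * pi" "u \<noteq> 0"
  shows "ccw_angle u w = \<theta>"
proof -
  have "cis (2 * pi - \<theta>) * cis \<theta> = 1"
    by (simp add: cis_mult)
  then have "complex_of_real (1 / r) * cis (2 * pi - \<theta>) * w = u"
    using assms(1,2) by (simp add: rcis_def field_simps)
  moreover have "w \<noteq> 0"
    using assms by (simp add: rcis_def)
  ultimately have "complex_of_real (1 / r) * exp (\<i> * complex_of_real (2 * pi - \<theta>)) = u / w"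
    by (metis cis_conv_exp nonzero_mult_div_cancel_right)
  then have "Arg2pi (u / w) = 2 * pi - \<theta>"
    by (rule Arg2pi_unique) (use assms in auto)
  then show ?thesis
    by (simp add: ccw_angle_def)
qed

lemma ccw_angle_add:
  assumes "a \<noteq> 0" "b \<noteq> 0" "c \<noteq> 0"
  shows "ccw_angle a c = (let s = ccw_angle a b + ccw_angle b c in if s \<le> 2 * pi then s else s - 2 * pi)"
proof -
  let ?s = "ccw_angle a b + ccw_angle b c"
  have "c = rcis (cmod c / cmod b) (ccw_angle b c) * (rcis (cmod b / cmod a) (ccw_angle a b) * a)"
    using ccw_angle_polar assms by metis
  then have c: "c = rcis (cmod c / cmod a) ?s * a"
    using assms by (simp add: mult.assoc[symmetric] rcis_mult add.commute)
  have "rcis (cmod c / cmod a) ?s = rcis (cmod c / cmod a) (?s - 2 * pi)"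
    by (simp add: rcis_def cis_divide[symmetric])
  then have c': "c = rcis (cmod c / cmod a) (?s - 2 * pi) * a"
    using c by simp
  show ?thesis
    using ccw_angle_unique[OF c] ccw_angle_unique[OF c'] assms
      ccw_angle_pos[of a b] ccw_angle_pos[of b c] ccw_angle_le[of a b] ccw_angle_le[of b c]
    by (auto simp: Let_def)
qed

lemma ccw_angle_self: "a \<noteq> 0 \<Longrightarrow> ccw_angle a a = 2 * pi"
  by (rule ccw_angle_unique[of _ 1]) (simp_all add: rcis_def)

lemma ccw_angle_diff:
  assumes "a \<noteq> 0" "b \<noteq> 0" "c \<noteq> 0" "ccw_angle a b < ccw_angle a c"
  shows "ccw_angle b c = ccw_angle a c - ccw_angle a b"
  using ccw_angle_add[OF assms(1-3)] assms(4) ccw_angle_le[of b c]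
  by (auto simp: Let_def split: if_splits)

lemma cross_ccw_angle:
  assumes "u \<noteq> 0" "w \<noteq> 0"
  shows "cross u w = cmod u * cmod w * sin (ccw_angle u w)"
    and "inner u w = cmod u * cmod w * cos (ccw_angle u w)"
proof -
  define \<theta> where "\<theta> = ccw_angle u w"
  have w: "w = rcis (cmod w / cmod u) \<theta> * u"
    unfolding \<theta>_def using ccw_angle_polar assms by blast
  have n: "Re u * Re u + Im u * Im u = cmod u * cmod u"
    by (metis cmod_power2 power2_eq_square)
  have "Re w = Re (rcis (cmod w / cmod u) \<theta> * u)" "Im w = Im (rcis (cmod w / cmod u) \<theta> * u)"
    by (rule arg_cong[OF w])+
  then have "Re w = cmod w / cmod u * (cos \<theta> * Re u - sin \<theta> * Im u)"
    "Im w = cmod w / cmod u * (cos \<theta> * Im u + sin \<theta> * Re u)"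
    using assms by (simp_all add: rcis_def field_simps)
  then have "cross u w = cmod w / cmod u * sin \<theta> * (Re u * Re u + Im u * Im u)"
    "inner u w = cmod w / cmod u * cos \<theta> * (Re u * Re u + Im u * Im u)"
    unfolding cross_def inner_complex_def by algebra+
  then show "cross u w = cmod u * cmod w * sin (ccw_angle u w)"
    "inner u w = cmod u * cmod w * cos (ccw_angle u w)"
    using assms n by (simp_all add: \<theta>_def)
qed

lemma cross_pos_iff:
  assumes "u \<noteq> 0" "w \<noteq> 0"
  shows "0 < cross u w \<longleftrightarrow> ccw_angle u w < pi"
proof (cases "ccw_angle u w < pi")
  case True
  then show ?thesis
    using cross_ccw_angle(1)[OF assms] assms ccw_angle_pos[of u w] sin_gt_zero by simp
next
  case False
  then have "sin (ccw_angle u w) \<le> 0"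
    using sin_le_zero[of "ccw_angle u w"] ccw_angle_le[of u w] by (cases "ccw_angle u w = 2 * pi") auto
  then show ?thesis
    using False cross_ccw_angle(1)[OF assms] assms by (simp add: mult_le_0_iff not_less)
qed

lemma cross_neg_iff:
  assumes "u \<noteq> 0" "w \<noteq> 0"
  shows "cross u w < 0 \<longleftrightarrow> pi < ccw_angle u w \<and> ccw_angle u w < 2 * pi"
proof -
  have "0 < cross w u \<longleftrightarrow> ccw_angle w u < pi"
    using cross_pos_iff assms by blast
  moreover have "ccw_angle u u = 2 * pi"
    using assms by (simp add: ccw_angle_self)
  then have "ccw_angle u w + ccw_angle w u = 2 * pi \<or> ccw_angle u w + ccw_angle w u = 4 * pi"
    using ccw_angle_add[OF assms(1,2,1)] by (auto simp: Let_def split: if_splits)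
  ultimately show ?thesis
    using cross_swap[of u w] ccw_angle_le[of u w] ccw_angle_le[of w u] ccw_angle_pos[of w u] ccw_angle_pos[of u w]
    by auto
qed

lemma ccw_angle_scale:
  assumes "0 < a" "0 < b"
  shows "ccw_angle (a *\<^sub>R u) (b *\<^sub>R w) = ccw_angle u w"
proof -
  have eq: "(a *\<^sub>R u) / (b *\<^sub>R w) = (u / w) * complex_of_real (a / b)"
    by (simp add: scaleR_conv_of_real mult_ac)
  have "Arg2pi ((a *\<^sub>R u) / (b *\<^sub>R w)) = Arg2pi (u / w)"
    unfolding eq by (rule Arg2pi_times_of_real2) (simp add: assms)
  then show ?thesis
    by (simp only: ccw_angle_def)
qed

lemma ccw_angle_mult: "\<eta> \<noteq> 0 \<Longrightarrow> ccw_angle (\<eta> * u) (\<eta> * w) = ccw_angle u w"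
  by (simp add: ccw_angle_def)

lemma dart_angle_eq:
  "dart_angle fst p d d' = ccw_angle (p (snd d) - p (fst d)) (p (snd d') - p (fst d'))"
  by (simp add: dart_angle_def)

lemma minimizer_exists:
  fixes f :: "'a \<Rightarrow> real"
  assumes "finite S" "S \<noteq> {}"
  obtains x where "x \<in> S" "\<And>y. y \<in> S \<Longrightarrow> f x \<le> f y"
  using arg_min_least[OF assms, of _ f] arg_min_if_finite(1)[OF assms, of f] by blast

lemma vertex_succ_exists:
  assumes "finite D" "d \<in> D"
  obtains d' where "vertex_succ D t q d d'"
proof -
  let ?S = "{d'\<in>D. t d' = t d}"
  have "finite ?S" "?S \<noteq> {}"
    using assms by (simp, blast)
  then obtain d' where "d' \<in> ?S" "\<And>e. e \<in> ?S \<Longrightarrow> dart_angle t q d d' \<le> dart_angle t q d e"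
    using minimizer_exists[where f = "dart_angle t q d"] by blast
  then show thesis
    using that[of d'] assms unfolding vertex_succ_def by auto
qed

text \<open>
  The form in which extrema produce points of dual segments: \<open>\<sigma>\<close>
  distinguishes maxima from minima.
\<close>

lemma between_on_line:
  fixes N y :: complex
  assumes "\<sigma> * s \<le> 0" "0 \<le> \<sigma> * s'" "\<sigma> \<noteq> 0" "s \<noteq> s'"
  shows "y \<in> closed_segment (y + s *\<^sub>R N) (y + s' *\<^sub>R N)"
proof -
  define t where "t = s / (s - s')"
  have "(s \<le> 0 \<and> 0 \<le> s') \<or> (0 \<le> s \<and> s' \<le> 0)"
    using assms(1-3) by (auto simp: mult_le_0_iff zero_le_mult_iff)
  then have "0 \<le> t" "t \<le> 1"
    unfolding t_def using assms(4) by (auto simp: field_simps divide_le_eq le_divide_eq zero_le_divide_iff)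
  moreover have "(1 - t) * s + t * s' = s - t * (s - s')"
    by (simp add: algebra_simps)
  then have "(1 - t) * s + t * s' = 0"
    using assms(4) by (simp add: t_def)
  then have "((1 - t) * s + t * s') *\<^sub>R N = 0"
    by simp
  then have "y = (1 - t) *\<^sub>R (y + s *\<^sub>R N) + t *\<^sub>R (y + s' *\<^sub>R N)"
    by (simp add: algebra_simps)
  ultimately show ?thesis
    by (auto simp: in_segment)
qed

section \<open>Reciprocal diagrams\<close>

text \<open>
  The combinatorial data of a lifting without its faces as point sets: \<open>L\<close> assigns
  to a dart the dual vertex on its left, \<open>g\<close> places the dual vertices at the
  gradients, \<open>\<kappa>\<close> is the stress, and \<open>H\<close> is the height at the
  vertices. The assumption \<open>orientation\<close> states that the dual embedding reverses
  the orientation.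
\<close>

locale reciprocal_diagram =
  fixes D :: "('v \<times> 'v) set" and p :: "'v \<Rightarrow> complex" and W :: "'f set" and L :: "'v \<times> 'v \<Rightarrow> 'f"
    and g :: "'f \<Rightarrow> complex" and \<kappa> :: "'v \<times> 'v \<Rightarrow> real" and H :: "'v \<Rightarrow> real"
  assumes finite_darts: "finite D"
    and swap_mem: "d \<in> D \<Longrightarrow> prod.swap d \<in> D"
    and ends_distinct: "d \<in> D \<Longrightarrow> p (fst d) \<noteq> p (snd d)"
    and directions_distinct: "d \<in> D \<Longrightarrow> d' \<in> D \<Longrightarrow> fst d = fst d' \<Longrightarrow> d \<noteq> d' \<Longrightarrow>
      dart_angle fst p d d' < 2 * pi"
    and degree_two: "d \<in> D \<Longrightarrow> \<exists>d'\<in>D. fst d' = fst d \<and> d' \<noteq> d"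
    and noncrossing_dual: "noncrossing W D L g"
    and jump: "d \<in> D \<Longrightarrow> g (L d) - g (L (prod.swap d)) = \<kappa> d *\<^sub>R (\<i> * (p (snd d) - p (fst d)))"
    and slope: "d \<in> D \<Longrightarrow> inner (g (L d)) (p (snd d) - p (fst d)) = H (snd d) - H (fst d)"
    and orientation: "vertex_succ D fst p d d' \<Longrightarrow> vertex_succ D L g d (prod.swap d')"
    and dual_connected: "\<lbrakk>F \<in> W; Q F; \<And>d. d \<in> D \<Longrightarrow> Q (L d) \<Longrightarrow> Q (L (prod.swap d)); F' \<in> W\<rbrakk> \<Longrightarrow> Q F'"
begin

abbreviation dir :: "'v \<times> 'v \<Rightarrow> complex" where "dir d \<equiv> p (snd d) - p (fst d)"
abbreviation ddir :: "'v \<times> 'v \<Rightarrow> complex" where "ddir d \<equiv> g (L (prod.swap d)) - g (L d)"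
abbreviation rise :: "'v \<times> 'v \<Rightarrow> real" where "rise d \<equiv> H (snd d) - H (fst d)"

text \<open>
  For positive \<open>\<sigma>\<close> these are the slopes \<open>y\<close> such that \<open>h
  - \<langle>y, \<cdot>\<rangle>\<close> does not increase along any edge at \<open>u\<close>;
  for negative \<open>\<sigma>\<close> it does not decrease.
\<close>

definition cell :: "real \<Rightarrow> 'v \<Rightarrow> complex set" where
  "cell \<sigma> u = {y. \<forall>d\<in>D. fst d = u \<longrightarrow> 0 \<le> \<sigma> * (inner y (dir d) - rise d)}"

definition convex_star :: "'v \<Rightarrow> bool" where
  "convex_star u \<longleftrightarrow>
     (\<forall>d d'. vertex_succ D fst p d d' \<and> fst d = u \<longrightarrow> dart_angle fst p d d' < pi)"

text \<open>
  The value of \<open>\<sigma>\<close> matters only through its sign, so that maxima (positive)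
  and minima (negative) are treated together.
\<close>

definition peak :: "real \<Rightarrow> 'v \<Rightarrow> bool" where
  "peak \<sigma> u \<longleftrightarrow> \<sigma> \<noteq> 0 \<and> (\<exists>d\<in>D. fst d = u) \<and> convex_star u \<and> (\<exists>F\<in>W. g F \<in> cell \<sigma> u)"

lemma dir_nonzero: "d \<in> D \<Longrightarrow> dir d \<noteq> 0"
  by (metis ends_distinct right_minus_eq)

lemma jump_nonzero: assumes "d \<in> D" shows "\<kappa> d \<noteq> 0" "ddir d \<noteq> 0" "L d \<in> W" "L (prod.swap d) \<in> W"
proof -
  have "L d \<noteq> L (prod.swap d)" and W: "L d \<in> W" "L (prod.swap d) \<in> W" and "inj_on g W"
    using noncrossing_dual assms swap_mem[OF assms] unfolding noncrossing_def by blast+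
  then have ne: "g (L d) \<noteq> g (L (prod.swap d))"
    by (metis inj_onD)
  then show "\<kappa> d \<noteq> 0"
    using jump[OF assms] by auto
  show "ddir d \<noteq> 0" "L d \<in> W" "L (prod.swap d) \<in> W"
    using ne W by auto
qed

lemma slope_right: assumes "d \<in> D" shows "inner (g (L (prod.swap d))) (dir d) = rise d"
proof -
  have "inner (g (L (prod.swap d))) (- dir d) = - rise d"
    using slope[OF swap_mem[OF assms]] by simp
  then show ?thesis
    unfolding inner_minus_right by linarith
qed

lemma succ_props:
  assumes "vertex_succ D fst p d d'"
  shows "d \<in> D" "d' \<in> D" "fst d' = fst d" "L (prod.swap d') = L d"
  using assms orientation[OF assms] unfolding vertex_succ_def by auto

lemma ex_succ: assumes "d \<in> D" obtains d' where "vertex_succ D fst p d d'"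
  using vertex_succ_exists[OF finite_darts assms] by blast

text \<open>
  The dart from which \<open>d\<close> is reached by the smallest counterclockwise turn has
  \<open>d\<close> as its successor: a dart in between would need a smaller turn.
\<close>

lemma ex_pred: assumes "d \<in> D" obtains d0 where "vertex_succ D fst p d0 d"
proof -
  let ?S = "{e\<in>D. fst e = fst d \<and> e \<noteq> d}"
  have "finite ?S" "?S \<noteq> {}"
    using finite_darts degree_two[OF assms] by auto
  then obtain d0 where d0: "d0 \<in> ?S"
      "\<And>e. e \<in> ?S \<Longrightarrow> dart_angle fst p d0 d \<le> dart_angle fst p e d"
    using minimizer_exists[where f = "\<lambda>e. dart_angle fst p e d"] by blast
  have "vertex_succ D fst p d0 d"
    unfolding vertex_succ_def
  proof (intro conjI ballI impI)
    fix e assume e: "e \<in> D" "fst e = fst d0"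
    show "dart_angle fst p d0 d \<le> dart_angle fst p d0 e"
    proof (rule ccontr)
      assume less: "\<not> dart_angle fst p d0 d \<le> dart_angle fst p d0 e"
      then have "dart_angle fst p e d = dart_angle fst p d0 d - dart_angle fst p d0 e"
        using d0(1) e assms unfolding dart_angle_eq
        by (intro ccw_angle_diff dir_nonzero) simp_all
      moreover have "e \<in> ?S"
        using less e d0(1) by auto
      ultimately show False
        using d0(2)[of e] ccw_angle_pos[of "dir d0" "dir e"] by (simp add: dart_angle_eq)
    qed
  qed (use d0 assms in auto)
  then show thesis
    by (rule that)
qed

lemma convex_star_cross:
  assumes "convex_star u" "vertex_succ D fst p d d'" "fst d = u"
  shows "0 < cross (dir d) (dir d')"
  using assms cross_pos_iff[of "dir d" "dir d'"] dir_nonzero succ_props(1,2)[OF assms(2)]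
  unfolding convex_star_def dart_angle_eq by blast

text \<open>
  If \<open>y\<close> satisfies the inequality of \<open>d\<close> with equality, then the
  gradients on both sides of \<open>d\<close> differ from \<open>y\<close> by vectors orthogonal
  to \<open>d\<close>. Each of these two faces contains another edge at \<open>u\<close>, at an
  angle less than \<open>\<pi>\<close>, and the inequality of that edge determines the sign of
  the difference.
\<close>

lemma cell_tight:
  assumes star: "convex_star u" and y: "y \<in> cell \<sigma> u" and d: "d \<in> D" "fst d = u"
    and tight: "inner y (dir d) = rise d"
  obtains s s' where "g (L d) = y + s *\<^sub>R (\<i> * dir d)" "g (L (prod.swap d)) = y + s' *\<^sub>R (\<i> * dir d)"
    "\<sigma> * s \<le> 0" "0 \<le> \<sigma> * s'"
proof -
  have "inner (g (L d) - y) (dir d) = 0" "inner (g (L (prod.swap d)) - y) (dir d) = 0"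
    using slope[OF d(1)] slope_right[OF d(1)] tight by (simp_all add: inner_diff_left)
  then obtain s s' where "g (L d) - y = s *\<^sub>R (\<i> * dir d)" "g (L (prod.swap d)) - y = s' *\<^sub>R (\<i> * dir d)"
    using perp_ex dir_nonzero[OF d(1)] by metis
  then have s: "g (L d) = y + s *\<^sub>R (\<i> * dir d)" "g (L (prod.swap d)) = y + s' *\<^sub>R (\<i> * dir d)"
    by (simp_all add: algebra_simps)
  obtain d' where succ: "vertex_succ D fst p d d'"
    using ex_succ d by blast
  have d': "d' \<in> D" "fst d' = u" "L (prod.swap d') = L d"
    using succ_props[OF succ] d by auto
  have "0 \<le> \<sigma> * (inner y (dir d') - rise d')"
    using y d' by (simp add: cell_def)
  also have "rise d' = inner (g (L d)) (dir d')"
    using slope_right[OF d'(1)] d'(3) by simp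
  also have "inner y (dir d') - inner (g (L d)) (dir d') = - s * cross (dir d) (dir d')"
    unfolding s(1) by (simp add: inner_add_left inner_ii)
  finally have "(\<sigma> * s) * cross (dir d) (dir d') \<le> 0"
    by (simp add: algebra_simps)
  then have 1: "\<sigma> * s \<le> 0"
    using convex_star_cross[OF star succ d(2)] by (simp add: mult_le_0_iff)
  obtain d0 where pred: "vertex_succ D fst p d0 d"
    using ex_pred d by blast
  have d0: "d0 \<in> D" "fst d0 = u" "L (prod.swap d) = L d0"
    using succ_props[OF pred] d by auto
  have "0 \<le> \<sigma> * (inner y (dir d0) - rise d0)"
    using y d0 by (simp add: cell_def)
  also have "rise d0 = inner (g (L (prod.swap d))) (dir d0)"
    using slope[OF d0(1)] d0(3) by simp
  also have "inner y (dir d0) - inner (g (L (prod.swap d))) (dir d0) = s' * cross (dir d0) (dir d)"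
    unfolding s(2) using cross_swap[of "dir d0" "dir d"] by (simp add: inner_add_left inner_ii)
  finally have "0 \<le> (\<sigma> * s') * cross (dir d0) (dir d)"
    by (simp add: algebra_simps)
  then have 2: "0 \<le> \<sigma> * s'"
    using convex_star_cross[OF star pred d0(2)] by (simp add: zero_le_mult_iff)
  show thesis
    by (rule that[OF s 1 2])
qed

text \<open>
  So the boundary of a cell is covered by dual edges, all with the same sign of stress.
\<close>

lemma cell_tight_segment:
  assumes "convex_star u" "y \<in> cell \<sigma> u" "d \<in> D" "fst d = u" "inner y (dir d) = rise d" "\<sigma> \<noteq> 0"
  shows "y \<in> closed_segment (g (L d)) (g (L (prod.swap d)))" "\<sigma> * \<kappa> d < 0"
proof -
  obtain s s' where s: "g (L d) = y + s *\<^sub>R (\<i> * dir d)" "g (L (prod.swap d)) = y + s' *\<^sub>R (\<i> * dir d)"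
    "\<sigma> * s \<le> 0" "0 \<le> \<sigma> * s'"
    using cell_tight[OF assms(1-5)] by blast
  have "(s - s') *\<^sub>R (\<i> * dir d) = \<kappa> d *\<^sub>R (\<i> * dir d)"
    using jump[OF assms(3)] unfolding s by (simp add: algebra_simps)
  then have \<kappa>: "\<kappa> d = s - s'"
    using dir_nonzero[OF assms(3)] by simp
  have ne: "s - s' \<noteq> 0"
    using jump_nonzero(1)[OF assms(3)] \<kappa> by simp
  have "\<sigma> * \<kappa> d \<le> 0"
    unfolding \<kappa> using s by (simp add: algebra_simps)
  moreover have "\<sigma> * \<kappa> d \<noteq> 0"
    using ne \<kappa> assms(6) by simp
  ultimately show "\<sigma> * \<kappa> d < 0"
    by (metis order_le_less)
  show "y \<in> closed_segment (g (L d)) (g (L (prod.swap d)))"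
    unfolding s(1,2) using between_on_line[OF s(3,4) assms(6)] ne by simp
qed

lemma dual_segments_meet:
  assumes "d \<in> D" "d' \<in> D" "d' \<noteq> d" "d' \<noteq> prod.swap d"
    "y \<in> closed_segment (g (L d)) (g (L (prod.swap d)))"
    "y \<in> closed_segment (g (L d')) (g (L (prod.swap d')))"
  obtains F where "y = g F" "F \<in> {L d, L (prod.swap d)}" "F \<in> {L d', L (prod.swap d')}"
proof -
  have "dart_segment L g d \<inter> dart_segment L g d' \<subseteq> g ` (dart_ends L d \<inter> dart_ends L d')"
    using noncrossing_dual assms(1-4) unfolding noncrossing_def by blast
  then have "y \<in> g ` (dart_ends L d \<inter> dart_ends L d')"
    using assms(5,6) unfolding dart_segment_def by blast
  then show thesis
    using that unfolding dart_ends_def by blast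
qed

text \<open>
  At a corner of the cell the next or previous edge at \<open>u\<close> is tight too. As the
  orientation is reversed, the wedge from one of the two dual edges to the other that is free of
  dual edges is the one with angle greater than \<open>\<pi>\<close>. The remaining wedge is the
  one in which the cell lies.
\<close>

lemma corner_wedge:
  assumes star: "convex_star u" and "\<sigma> \<noteq> 0" and d: "d \<in> D" "fst d = u"
    and A: "g A \<in> cell \<sigma> u" "A = L d \<or> A = L (prod.swap d)" and e: "e \<in> D" "L e = A"
  shows "0 \<le> \<sigma> * inner (ddir e) (dir d)"
proof -
  have pos: "\<sigma> * \<kappa> x < 0" if "x \<in> D" "fst x = u" "A = L x \<or> A = L (prod.swap x)" for x
    using cell_tight_segment(2)[OF star A(1) that(1,2) _ \<open>\<sigma> \<noteq> 0\<close>] slope slope_right that by metis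
  have dd: "ddir x = (- \<kappa> x) *\<^sub>R (\<i> * dir x)" "g (L x) - g (L (prod.swap x)) = \<kappa> x *\<^sub>R (\<i> * dir x)" if "x \<in> D" for x
    using jump[OF that] by (simp_all add: algebra_simps)
  have wedge: "cross (ddir x) (ddir e) \<le> 0 \<and> 0 \<le> cross (g (L x') - g (L (prod.swap x'))) (ddir e)"
    if succ: "vertex_succ D fst p x x'" "fst x = u" "L x = A" for x x'
  proof -
    let ?a = "ddir x" and ?b = "g (L x') - g (L (prod.swap x'))" and ?c = "ddir e"
    have x: "x \<in> D" "x' \<in> D" "fst x' = u" "L (prod.swap x') = A"
      using succ_props[OF succ(1)] succ(2,3) by auto
    have nz: "?a \<noteq> 0" "?b \<noteq> 0" "?c \<noteq> 0"
      using jump_nonzero(2)[OF x(1)] jump_nonzero(2)[OF x(2)] jump_nonzero(2)[OF e(1)]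
      by (metis right_minus_eq)+
    have *: "\<forall>y\<in>D. L y = L x \<longrightarrow> dart_angle L g x (prod.swap x') \<le> dart_angle L g x y"
      using orientation[OF succ(1)] by (simp add: vertex_succ_def)
    have "dart_angle L g x (prod.swap x') \<le> dart_angle L g x e"
      using bspec[OF * e(1)] e(2) succ(3) by simp
    then have "ccw_angle ?a ?b \<le> ccw_angle ?a ?c"
      by (simp only: dart_angle_def swap_swap)
    have "\<sigma> * \<kappa> x < 0" "\<sigma> * \<kappa> x' < 0"
      using pos[OF x(1) succ(2)] pos[OF x(2,3)] x(4) succ(3) by simp_all
    then have "0 < (\<sigma> * \<kappa> x) * (\<sigma> * \<kappa> x')"
      by (rule mult_neg_neg)
    then have "0 < \<sigma>\<^sup>2 * (\<kappa> x * \<kappa> x')"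
      by (simp add: power2_eq_square mult_ac)
    then have "0 < \<kappa> x * \<kappa> x'"
      using \<open>\<sigma> \<noteq> 0\<close> by (metis zero_less_mult_pos zero_less_power2)
    then have "0 < (\<kappa> x * \<kappa> x') * cross (dir x) (dir x')"
      using convex_star_cross[OF star succ(1,2)] by (rule mult_pos_pos)
    moreover have "cross ?a ?b = - ((\<kappa> x * \<kappa> x') * cross (dir x) (dir x'))"
      unfolding dd(1)[OF x(1)] dd(2)[OF x(2)] cross_scale cross_ii(2) by simp
    ultimately have "cross ?a ?b < 0"
      by simp
    then have b: "pi < ccw_angle ?a ?b"
      using cross_neg_iff nz by blast
    with \<open>ccw_angle ?a ?b \<le> ccw_angle ?a ?c\<close> have "\<not> ccw_angle ?a ?c < pi"
      by simp
    then have "cross ?a ?c \<le> 0"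
      using cross_pos_iff[OF nz(1,3)] by simp
    moreover have "0 \<le> cross ?b ?c"
    proof (cases "ccw_angle ?a ?b = ccw_angle ?a ?c")
      case True
      then have "ccw_angle ?b ?c = 2 * pi"
        using ccw_angle_add[OF nz] ccw_angle_pos[of ?b ?c] by (auto simp: Let_def split: if_splits)
      then show ?thesis
        using cross_neg_iff[OF nz(2,3)] by auto
    next
      case False
      then have "ccw_angle ?b ?c = ccw_angle ?a ?c - ccw_angle ?a ?b"
        using \<open>ccw_angle ?a ?b \<le> ccw_angle ?a ?c\<close> by (intro ccw_angle_diff nz) simp
      then have "ccw_angle ?b ?c < pi"
        using b ccw_angle_le[of ?a ?c] by simp
      then show ?thesis
        using cross_pos_iff[OF nz(2,3)] by simp
    qed
    ultimately show ?thesis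
      by blast
  qed
  have \<sigma>\<kappa>: "0 < - (\<sigma> * \<kappa> d)"
    using pos[OF d A(2)] by simp
  show ?thesis
  proof (cases "A = L d")
    case True
    obtain d' where "vertex_succ D fst p d d'"
      using ex_succ d by blast
    then have "cross (ddir d) (ddir e) \<le> 0"
      using wedge d True by blast
    then have "\<kappa> d * inner (ddir e) (dir d) \<le> 0"
      unfolding dd(1)[OF d(1)] cross_scale cross_ii by (simp add: inner_commute)
    then have "0 \<le> (- (\<sigma> * \<kappa> d)) * (\<sigma> * inner (ddir e) (dir d))"
      using mult_nonneg_nonpos[of "\<sigma>\<^sup>2" "\<kappa> d * inner (ddir e) (dir d)"]
      by (simp add: power2_eq_square algebra_simps)
    then show ?thesis
      using \<sigma>\<kappa> by (metis linorder_not_le mult_pos_neg)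
  next
    case False
    then have A': "A = L (prod.swap d)"
      using A by simp
    obtain d0 where pred: "vertex_succ D fst p d0 d"
      using ex_pred d by blast
    then have "0 \<le> cross (g (L d) - g (L (prod.swap d))) (ddir e)"
      using wedge[OF pred] succ_props[OF pred] d A' by simp
    then have "\<kappa> d * inner (ddir e) (dir d) \<le> 0"
      unfolding dd(2)[OF d(1)] cross_scale cross_ii by (simp add: inner_commute)
    then have "0 \<le> (- (\<sigma> * \<kappa> d)) * (\<sigma> * inner (ddir e) (dir d))"
      using mult_nonneg_nonpos[of "\<sigma>\<^sup>2" "\<kappa> d * inner (ddir e) (dir d)"]
      by (simp add: power2_eq_square algebra_simps)
    then show ?thesis
      using \<sigma>\<kappa> by (metis linorder_not_le mult_pos_neg)
  qed
qed

text \<open>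
  Otherwise follow the dual edge from \<open>L e\<close> to the point where it leaves the cell.
  There some inequality is tight, so the point lies on a dual edge at \<open>u\<close>. Dual
  edges do not cross, so the point is the starting corner, which \<open>corner_wedge\<close>
  excludes.
\<close>

lemma cell_step:
  assumes star: "convex_star u" and "\<sigma> \<noteq> 0" and e: "e \<in> D" and A: "g (L e) \<in> cell \<sigma> u"
  shows "g (L (prod.swap e)) \<in> cell \<sigma> u"
proof (rule ccontr)
  let ?A = "g (L e)" and ?B = "g (L (prod.swap e))"
  define \<alpha> where "\<alpha> d = \<sigma> * (inner ?A (dir d) - rise d)" for d
  define \<beta> where "\<beta> d = \<sigma> * (inner ?B (dir d) - rise d)" for d
  (* s d is the time at which the inequality of d becomes tight; the smallest of these times is
     the exit time. *)
  define s where "s d = \<alpha> d / (\<alpha> d - \<beta> d)" for d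
  let ?V = "{d\<in>D. fst d = u \<and> \<beta> d < 0}"
  assume "?B \<notin> cell \<sigma> u"
  then have "finite ?V" "?V \<noteq> {}"
    using finite_darts by (auto simp: cell_def \<beta>_def not_le)
  then obtain d where d: "d \<in> ?V" "\<And>d'. d' \<in> ?V \<Longrightarrow> s d \<le> s d'"
    using minimizer_exists[where f = s] by blast
  have \<alpha>: "0 \<le> \<alpha> d'" if "d' \<in> D" "fst d' = u" for d'
    using A that by (simp add: cell_def \<alpha>_def)
  have \<alpha>d: "0 \<le> \<alpha> d" "\<beta> d < 0"
    using d(1) \<alpha> by auto
  then have s01: "0 \<le> s d" "s d < 1"
    by (auto simp: s_def field_simps)
  define y where "y = (1 - s d) *\<^sub>R ?A + s d *\<^sub>R ?B"
  have at_y: "\<sigma> * (inner y (dir d') - rise d') = \<alpha> d' - s d * (\<alpha> d' - \<beta> d')" for d'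
    by (simp add: y_def \<alpha>_def \<beta>_def inner_add_left algebra_simps)
  have y_cell: "y \<in> cell \<sigma> u"
    unfolding cell_def
  proof (intro CollectI ballI impI)
    fix d' assume d': "d' \<in> D" "fst d' = u"
    show "0 \<le> \<sigma> * (inner y (dir d') - rise d')"
    proof (cases "\<beta> d' < 0")
      case True
      then have "s d \<le> \<alpha> d' / (\<alpha> d' - \<beta> d')"
        using d(2)[of d'] d' by (simp add: s_def)
      then show ?thesis
        unfolding at_y using True \<alpha>[OF d'] by (simp add: le_divide_eq)
    next
      case False
      have "\<alpha> d' - s d * (\<alpha> d' - \<beta> d') = (1 - s d) * \<alpha> d' + s d * \<beta> d'"
        by (simp add: algebra_simps)
      then show ?thesis
        unfolding at_y using False \<alpha>[OF d'] s01 by simp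
    qed
  qed
  have "\<alpha> d - s d * (\<alpha> d - \<beta> d) = 0"
    using \<alpha>d by (simp add: s_def)
  then have "inner y (dir d) = rise d"
    using at_y[of d] \<open>\<sigma> \<noteq> 0\<close> by simp
  then have y_seg: "y \<in> closed_segment (g (L d)) (g (L (prod.swap d)))"
    using cell_tight_segment(1)[OF star y_cell _ _ _ \<open>\<sigma> \<noteq> 0\<close>] d(1) by blast
  have neg: "\<sigma> * inner (ddir e) (dir d) < 0"
  proof -
    have "\<sigma> * inner (ddir e) (dir d) = \<beta> d - \<alpha> d"
      by (simp add: \<alpha>_def \<beta>_def inner_diff_left algebra_simps)
    then show ?thesis
      using \<alpha>d by simp
  qed
  have dD: "d \<in> D" "fst d = u"
    using d(1) by simp_all
  have "inner (ddir d) (dir d) = 0" "inner (ddir (prod.swap d)) (dir d) = 0"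
    by (simp_all only: inner_diff_left slope[OF dD(1)] slope_right[OF dD(1)] swap_swap diff_self)
  then have "e \<noteq> d" "e \<noteq> prod.swap d"
    using neg by (metis less_irrefl mult_zero_right)+
  moreover have "y \<in> closed_segment ?A ?B"
    unfolding y_def in_segment using s01 by auto
  ultimately obtain F where F: "y = g F" "F \<in> {L d, L (prod.swap d)}" "F \<in> {L e, L (prod.swap e)}"
    using dual_segments_meet[OF dD(1) e _ _ y_seg] by metis
  have "F \<noteq> L (prod.swap e)"
    using F(1) y_cell \<open>?B \<notin> cell \<sigma> u\<close> by auto
  then have "F = L e"
    using F by simp
  then have "0 \<le> \<sigma> * inner (ddir e) (dir d)"
    using corner_wedge[OF star \<open>\<sigma> \<noteq> 0\<close> dD, of F e] F(2) e A by blast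
  then show False
    using neg by simp
qed

lemma peak_cell_contains_all:
  assumes "peak \<sigma> u" "F \<in> W"
  shows "g F \<in> cell \<sigma> u"
proof -
  obtain F0 where "F0 \<in> W" "g F0 \<in> cell \<sigma> u" "\<sigma> \<noteq> 0" "convex_star u"
    using assms(1) unfolding peak_def by blast
  then show ?thesis
    using dual_connected[of F0 "\<lambda>F. g F \<in> cell \<sigma> u"] cell_step assms(2) by blast
qed

text \<open>
  The first dart \<open>d'\<close> met when turning counterclockwise from \<open>w\<close> and
  its predecessor enclose \<open>w\<close>.
\<close>

lemma between_consecutive:
  assumes star: "convex_star u" and "d0 \<in> D" "fst d0 = u" and "w \<noteq> 0"
  obtains d d' a b where "vertex_succ D fst p d d'" "fst d = u" "0 < a" "0 \<le> b"
    "w = a *\<^sub>R dir d + b *\<^sub>R dir d'"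
proof -
  let ?S = "{d\<in>D. fst d = u}"
  let ?\<phi> = "\<lambda>d. ccw_angle w (dir d)"
  have "finite ?S" "?S \<noteq> {}"
    using finite_darts assms by (simp, blast)
  then obtain d' where d': "d' \<in> ?S" "\<And>e. e \<in> ?S \<Longrightarrow> ?\<phi> d' \<le> ?\<phi> e"
    using minimizer_exists[where f = ?\<phi>] by blast
  obtain d where succ: "vertex_succ D fst p d d'"
    using ex_pred d'(1) by blast
  have d: "d \<in> D" "fst d = u"
    using succ_props[OF succ] d'(1) by auto
  have nz: "dir d \<noteq> 0" "dir d' \<noteq> 0"
    using dir_nonzero d d'(1) by blast+
  have c: "0 < cross (dir d) (dir d')"
    using convex_star_cross[OF star succ d(2)] .
  have alpha: "ccw_angle (dir d) (dir d') < pi"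
    using star succ d unfolding convex_star_def dart_angle_eq by blast
  have ge: "ccw_angle w (dir d') \<le> ccw_angle w (dir d)"
    using d' d by simp
  have add: "ccw_angle w (dir d') = (let s = ccw_angle w (dir d) + ccw_angle (dir d) (dir d')
      in if s \<le> 2 * pi then s else s - 2 * pi)"
    by (rule ccw_angle_add[OF \<open>w \<noteq> 0\<close> nz])
  then have add': "ccw_angle w (dir d') = ccw_angle w (dir d) + ccw_angle (dir d) (dir d') - 2 * pi"
    using ge ccw_angle_pos[of "dir d" "dir d'"] by (auto simp: Let_def split: if_splits)
  have "ccw_angle w (dir d') < pi"
    using add' alpha ccw_angle_le[of w "dir d"] by simp
  then have "0 < cross w (dir d')"
    using cross_pos_iff \<open>w \<noteq> 0\<close> nz by blast
  moreover have "pi < ccw_angle w (dir d)"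
    using add' alpha ccw_angle_pos[of w "dir d'"] by simp
  then have "0 \<le> cross (dir d) w"
    using cross_pos_iff[OF \<open>w \<noteq> 0\<close> nz(1)] cross_swap[of "dir d" w] by simp
  ultimately have "0 < cross w (dir d') / cross (dir d) (dir d')"
    "0 \<le> cross (dir d) w / cross (dir d) (dir d')"
    using c by simp_all
  then show thesis
    using that[OF succ d(2)] cone_decomposition[of "dir d" "dir d'" w] c by auto
qed

text \<open>
  For an edge \<open>e\<close> at \<open>v\<close>, all gradients lie on one side of the line
  through the dual of \<open>e\<close>. The normal of this line is a nonnegative combination of
  two consecutive directions at \<open>u\<close>, so the minimum of the corresponding linear
  form is attained where the inequalities of \<open>u\<close> with positive coefficient are
  tight. Thus both ends of the dual of \<open>e\<close> lie on the dual of an edge at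
  \<open>u\<close>, and two dual edges that overlap are equal.
\<close>

lemma peak_darts_shared:
  assumes u: "peak \<sigma> u" and v: "peak \<tau> v" and e: "e \<in> D" "fst e = v"
  obtains d where "d \<in> D" "fst d = u" "e = d \<or> e = prod.swap d"
proof -
  have \<sigma>: "\<sigma> \<noteq> 0" and star: "convex_star u" and "\<tau> \<noteq> 0"
    using u v by (auto simp: peak_def)
  obtain d0 where d0: "d0 \<in> D" "fst d0 = u"
    using u unfolding peak_def by blast
  define w where "w = (\<sigma> * \<tau>) *\<^sub>R dir e"
  have "w \<noteq> 0"
    using \<sigma> \<open>\<tau> \<noteq> 0\<close> dir_nonzero[OF e(1)] by (simp add: w_def)
  then obtain d d' a b where succ: "vertex_succ D fst p d d'" "fst d = u" and ab: "0 < a" "0 \<le> b"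
    and w: "w = a *\<^sub>R dir d + b *\<^sub>R dir d'"
    using between_consecutive[OF star d0] by blast
  have d: "d \<in> D" "d' \<in> D" "fst d' = u" "L (prod.swap d') = L d"
    using succ_props[OF succ(1)] succ(2) by auto
  have tight: "inner (g F) (dir d) = rise d" if F: "F = L e \<or> F = L (prod.swap e)" for F
  proof -
    have FW: "F \<in> W"
      using F jump_nonzero(3,4)[OF e(1)] by auto
    have Fe: "inner (g F) (dir e) = rise e"
      using F slope[OF e(1)] slope_right[OF e(1)] by auto
    have "0 \<le> \<tau> * (inner (g (L d)) (dir e) - rise e)"
      using peak_cell_contains_all[OF v, of "L d"] jump_nonzero(3)[OF d(1)] e by (simp add: cell_def)
    then have "0 \<le> \<tau> * inner (g (L d) - g F) (dir e)"
      using Fe by (simp add: inner_diff_left)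
    then have "0 \<le> \<sigma>\<^sup>2 * (\<tau> * inner (g (L d) - g F) (dir e))"
      by simp
    also have "\<dots> = \<sigma> * inner (g (L d) - g F) w"
      by (simp add: w_def power2_eq_square)
    also have "\<dots> = a * (\<sigma> * inner (g (L d) - g F) (dir d)) + b * (\<sigma> * inner (g (L d) - g F) (dir d'))"
      unfolding w by (simp add: inner_add_right algebra_simps)
    also have "\<sigma> * inner (g (L d) - g F) (dir d) = - (\<sigma> * (inner (g F) (dir d) - rise d))"
      unfolding inner_diff_left slope[OF d(1)] by (simp add: algebra_simps)
    also have "\<sigma> * inner (g (L d) - g F) (dir d') = - (\<sigma> * (inner (g F) (dir d') - rise d'))"
      unfolding inner_diff_left slope_right[OF d(2), unfolded d(4)] by (simp add: algebra_simps)
    finally have sum: "a * (\<sigma> * (inner (g F) (dir d) - rise d)) + b * (\<sigma> * (inner (g F) (dir d') - rise d')) \<le> 0"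
      by simp
    have "0 \<le> \<sigma> * (inner (g F) (dir d) - rise d)" "0 \<le> \<sigma> * (inner (g F) (dir d') - rise d')"
      using peak_cell_contains_all[OF u FW] d succ(2) by (simp_all add: cell_def)
    then have "\<sigma> * (inner (g F) (dir d) - rise d) = 0"
      using sum ab by (metis add_nonneg_nonneg add_nonneg_eq_0_iff mult_eq_0_iff mult_nonneg_nonneg
          order_antisym less_imp_le less_irrefl)
    then show ?thesis
      using \<sigma> by simp
  qed
  have on_seg: "g F \<in> closed_segment (g (L d)) (g (L (prod.swap d)))" if "F = L e \<or> F = L (prod.swap e)" for F
    using cell_tight_segment(1)[OF star peak_cell_contains_all[OF u] d(1) succ(2) tight \<sigma>] that
      jump_nonzero(3,4)[OF e(1)] by auto
  have "e = d \<or> e = prod.swap d"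
  proof (rule ccontr)
    assume ne: "\<not> (e = d \<or> e = prod.swap d)"
    let ?m = "midpoint (g (L e)) (g (L (prod.swap e)))"
    have "?m \<in> closed_segment (g (L d)) (g (L (prod.swap d)))"
      using on_seg by (metis closed_segment_subset convex_closed_segment midpoint_in_closed_segment subsetD)
    moreover have "?m \<in> closed_segment (g (L e)) (g (L (prod.swap e)))"
      by simp
    ultimately obtain F where "?m = g F" "F \<in> {L e, L (prod.swap e)}"
      using dual_segments_meet[OF d(1) e(1)] ne by metis
    then have "g (L e) = g (L (prod.swap e))"
      by (auto simp: midpoint_eq_endpoint)
    then show False
      using jump_nonzero(2)[OF e(1)] by simp
  qed
  then show thesis
    using that[of d] d(1) succ(2) by blast
qed

text \<open>
  The edges at \<open>v\<close> are edges at \<open>u\<close>; if \<open>u \<noteq> v\<close>,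
  only one edge joins them.
\<close>

theorem peak_unique:
  assumes u: "peak \<sigma> u" and v: "peak \<tau> v"
  shows "u = v"
proof (rule ccontr)
  assume "u \<noteq> v"
  obtain e where e: "e \<in> D" "fst e = v"
    using v unfolding peak_def by blast
  obtain e' where e': "e' \<in> D" "fst e' = v" "e' \<noteq> e"
    using degree_two[OF e(1)] e(2) by auto
  have "snd x = u" if "x \<in> D" "fst x = v" for x
    using peak_darts_shared[OF u v that] that(2) \<open>u \<noteq> v\<close> by (metis fst_swap snd_swap)
  then show False
    using e e' by (metis prod.expand)
qed

text \<open>
  Around \<open>v\<close> the lifting is locally the minimum (or maximum) of the linear
  functions given by the faces at \<open>v\<close>: a face that minimizes the linear form of a
  direction \<open>w\<close> does at least as well as its two neighbours, so \<open>w\<close>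
  lies to the left of the first and to the right of the second edge of this face. Hence the
  gradients at \<open>v\<close> themselves belong to the cell. A straight angle at
  \<open>v\<close> would make all these linear functions agree on the line through its two
  edges, so that there would be no edge besides these two and both angles would be straight.
\<close>

lemma monochromatic_nonpointed_peak:
  assumes "\<sigma> \<noteq> 0" and ex: "d0 \<in> D" "fst d0 = v"
    and sign: "\<And>d. d \<in> D \<Longrightarrow> fst d = v \<Longrightarrow> \<sigma> * \<kappa> d < 0"
    and nonreflex: "\<And>d d'. vertex_succ D fst p d d' \<Longrightarrow> fst d = v \<Longrightarrow> dart_angle fst p d d' \<le> pi"
    and flat_once: "\<And>d1 d1' d2 d2'. vertex_succ D fst p d1 d1' \<Longrightarrow> vertex_succ D fst p d2 d2' \<Longrightarrow>
      fst d1 = v \<Longrightarrow> fst d2 = v \<Longrightarrow> dart_angle fst p d1 d1' = pi \<Longrightarrow> dart_angle fst p d2 d2' = pi \<Longrightarrow> d1 = d2"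
  shows "peak \<sigma> v"
proof -
  let ?S = "{d\<in>D. fst d = v}"
  have fin: "finite ?S" "?S \<noteq> {}"
    using finite_darts ex by (simp, blast)
  have min_at: "e = d \<or> vertex_succ D fst p d e"
    if e: "e \<in> ?S" and d: "d \<in> ?S"
      and min: "\<And>x. x \<in> ?S \<Longrightarrow> \<sigma> * inner (g (L d)) (dir e) \<le> \<sigma> * inner (g (L x)) (dir e)" for d e
  proof (rule disjCI)
    assume "\<not> vertex_succ D fst p d e"
    obtain d' where succ: "vertex_succ D fst p d d'"
      using ex_succ d by blast
    have d': "d' \<in> ?S" "L (prod.swap d') = L d"
      using succ_props[OF succ] d by auto
    obtain c where pred: "vertex_succ D fst p c d"
      using ex_pred d by blast
    have c: "c \<in> ?S" "L (prod.swap d) = L c"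
      using succ_props[OF pred] d by auto
    have nz: "dir d \<noteq> 0" "dir d' \<noteq> 0" "dir e \<noteq> 0"
      using dir_nonzero d d' e by blast+
    have "g (L d) - g (L c) = \<kappa> d *\<^sub>R (\<i> * dir d)" "g (L d') - g (L d) = \<kappa> d' *\<^sub>R (\<i> * dir d')"
      using jump[of d, unfolded c(2)] jump[of d', unfolded d'(2)] d d' by blast+
    then have "inner (g (L d) - g (L c)) (dir e) = \<kappa> d * cross (dir d) (dir e)"
      "inner (g (L d') - g (L d)) (dir e) = \<kappa> d' * cross (dir d') (dir e)"
      by (simp_all add: inner_ii)
    moreover have "\<sigma> * inner (g (L d) - g (L c)) (dir e) \<le> 0" "0 \<le> \<sigma> * inner (g (L d') - g (L d)) (dir e)"
      using min[OF c(1)] min[OF d'(1)] by (simp_all add: inner_diff_left algebra_simps)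
    ultimately have "(\<sigma> * \<kappa> d) * cross (dir d) (dir e) \<le> 0" "0 \<le> (\<sigma> * \<kappa> d') * cross (dir d') (dir e)"
      by (simp_all add: mult.assoc)
    then have "0 \<le> cross (dir d) (dir e)" "cross (dir d') (dir e) \<le> 0"
      using sign[of d] sign[of d'] d d'(1)
      by (metis (mono_tags, lifting) linorder_not_le mem_Collect_eq mult_neg_neg,
          metis (mono_tags, lifting) linorder_not_le mem_Collect_eq mult_neg_pos)
    then have 1: "ccw_angle (dir d) (dir e) \<le> pi \<or> ccw_angle (dir d) (dir e) = 2 * pi"
      and 2: "pi \<le> ccw_angle (dir d') (dir e)"
      using cross_neg_iff[OF nz(1,3)] cross_pos_iff[OF nz(2,3)] ccw_angle_le[of "dir d" "dir e"] by auto
    have le: "dart_angle fst p d d' \<le> dart_angle fst p d e"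
      using succ d e unfolding vertex_succ_def by auto
    have "dart_angle fst p d d' \<noteq> dart_angle fst p d e"
      using \<open>\<not> vertex_succ D fst p d e\<close> succ d e unfolding vertex_succ_def by auto
    then have "ccw_angle (dir d') (dir e) = ccw_angle (dir d) (dir e) - ccw_angle (dir d) (dir d')"
      using le by (intro ccw_angle_diff nz) (simp add: dart_angle_eq)
    then have "ccw_angle (dir d) (dir e) = 2 * pi"
      using 1 2 ccw_angle_pos[of "dir d" "dir d'"] by auto
    then show "e = d"
      using directions_distinct[of d e] d e by (auto simp: dart_angle_eq)
  qed
  have min_val: "rise e = inner (g (L d)) (dir e)"
    if "e \<in> ?S" "d \<in> ?S" "e = d \<or> vertex_succ D fst p d e" for d e
    using that(3) slope[of e] slope_right[of e] succ_props(4)[of d e] that(1) by auto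
  have in_cell: "0 \<le> \<sigma> * (inner (g (L x)) (dir e) - rise e)" if x: "x \<in> ?S" and e: "e \<in> ?S" for x e
  proof -
    obtain d where d: "d \<in> ?S" "\<And>x. x \<in> ?S \<Longrightarrow> \<sigma> * inner (g (L d)) (dir e) \<le> \<sigma> * inner (g (L x)) (dir e)"
      using fin minimizer_exists[where f = "\<lambda>d. \<sigma> * inner (g (L d)) (dir e)"] by blast
    have eq: "rise e = inner (g (L d)) (dir e)"
      using min_val[OF e d(1) min_at[OF e d]] .
    show ?thesis
      unfolding eq right_diff_distrib using d(2)[OF x] by simp
  qed
  have star: "convex_star v"
    unfolding convex_star_def
  proof (intro allI impI)
    fix d d' assume dd: "vertex_succ D fst p d d' \<and> fst d = v"
    show "dart_angle fst p d d' < pi"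
    proof (rule ccontr)
      assume "\<not> dart_angle fst p d d' < pi"
      then have flat: "dart_angle fst p d d' = pi"
        using nonreflex[of d d'] dd by simp
      have d: "d \<in> ?S" "d' \<in> ?S" "L (prod.swap d') = L d"
        using succ_props[of d d'] dd by auto
      have nz: "dir d \<noteq> 0" "dir d' \<noteq> 0"
        using dir_nonzero d by blast+
      define r where "r = cmod (dir d') / cmod (dir d)"
      have "dir d' = rcis r pi * dir d"
        using ccw_angle_polar[OF nz] flat by (simp add: dart_angle_eq r_def)
      then have opp: "dir d' = (- r) *\<^sub>R dir d"
        by (simp add: rcis_def scaleR_conv_of_real)
      have "0 < r"
        using nz by (simp add: r_def)
      have all: "inner (g (L x)) (dir d) = rise d" if x: "x \<in> ?S" for x
      proof -
        have "rise d' = - r * rise d"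
          using slope_right[of d'] slope[of d] d opp by (simp add: inner_minus_right)
        then have "inner (g (L x)) (dir d') - rise d' = - r * (inner (g (L x)) (dir d) - rise d)"
          by (simp only: opp inner_scaleR_right right_diff_distrib)
        then have "\<sigma> * (inner (g (L x)) (dir d') - rise d') = - r * (\<sigma> * (inner (g (L x)) (dir d) - rise d))"
          by (simp only: mult.left_commute)
        then have "0 \<le> - r * (\<sigma> * (inner (g (L x)) (dir d) - rise d))"
          using in_cell[OF x d(2)] by simp
        then have "\<sigma> * (inner (g (L x)) (dir d) - rise d) \<le> 0"
          using \<open>0 < r\<close> by (simp add: mult_le_0_iff)
        then have "\<sigma> * (inner (g (L x)) (dir d) - rise d) = 0"
          using in_cell[OF x d(1)] by simp
        then show ?thesis
          using \<open>\<sigma> \<noteq> 0\<close> by simp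
      qed
      have "d' \<noteq> d"
        using flat ccw_angle_self[OF nz(1)] by (auto simp: dart_angle_eq)
      have "d = d' \<or> vertex_succ D fst p d' d"
        using min_at[OF d(1,2)] all by (metis (no_types, lifting) d(2) order_refl)
      then have succ': "vertex_succ D fst p d' d"
        using \<open>d' \<noteq> d\<close> by simp
      have "ccw_angle (dir d) (dir d') = pi"
        using flat by (simp add: dart_angle_eq)
      then have "ccw_angle (dir d') (dir d) = pi"
        using ccw_angle_add[OF nz nz(1)] ccw_angle_self[OF nz(1)] ccw_angle_le[of "dir d'" "dir d"]
        by (auto simp: Let_def split: if_splits)
      then have "dart_angle fst p d' d = pi"
        by (simp add: dart_angle_eq)
      then show False
        using flat_once[of d d' d' d] succ' dd flat \<open>d' \<noteq> d\<close> d(2) by auto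
    qed
  qed
  have "g (L d0) \<in> cell \<sigma> v"
    using in_cell[of d0] ex by (auto simp: cell_def)
  then show ?thesis
    unfolding peak_def using star ex \<open>\<sigma> \<noteq> 0\<close> jump_nonzero(3)[OF ex(1)] by blast
qed

end

section \<open>Half discs\<close>

definition left_half_disc :: "complex \<Rightarrow> complex \<Rightarrow> real \<Rightarrow> complex set" where
  "left_half_disc z x r = {y \<in> ball x r. 0 < cross z (y - x)}"

lemma cross_add_right: "cross z (a + b) = cross z a + cross z b" "cross z (a - b) = cross z a - cross z b"
  by (simp_all add: cross_def algebra_simps)

lemma cross_self: "cross z z = 0"
  by (simp add: cross_def)

lemma cross_ii_right: "cross z (\<i> * w) = inner z w"
  by (simp add: cross_def inner_complex_def)

lemma convex_left: "convex {y. 0 < cross z (y - x)}"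
proof -
  have "{y. 0 < cross z (y - x)} = {y. inner (\<i> * z) y > inner (\<i> * z) x}"
    by (auto simp: inner_ii(1) cross_add_right)
  then show ?thesis
    by (simp add: convex_halfspace_gt)
qed

lemma convex_left_half_disc: "convex (left_half_disc z x r)"
proof -
  have "left_half_disc z x r = ball x r \<inter> {y. 0 < cross z (y - x)}"
    by (auto simp: left_half_disc_def)
  then show ?thesis
    by (simp add: convex_Int convex_left)
qed

lemma left_half_disc_mono: "r \<le> r' \<Longrightarrow> left_half_disc z x r \<subseteq> left_half_disc z x r'"
  by (auto simp: left_half_disc_def)

lemma left_half_disc_point:
  assumes "z \<noteq> 0" "0 < \<epsilon>" "\<epsilon> * (1 + \<bar>t\<bar>) * cmod z < r"
  shows "x + \<epsilon> *\<^sub>R (\<i> * z + t *\<^sub>R z) \<in> left_half_disc z x r"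
proof -
  have "cmod (\<i> * z + t *\<^sub>R z) \<le> (1 + \<bar>t\<bar>) * cmod z"
    by (rule order_trans[OF norm_triangle_ineq]) (simp add: norm_mult algebra_simps)
  then have "\<epsilon> * cmod (\<i> * z + t *\<^sub>R z) \<le> \<epsilon> * ((1 + \<bar>t\<bar>) * cmod z)"
    using \<open>0 < \<epsilon>\<close> by (intro mult_left_mono) auto
  also have "\<dots> < r"
    using assms(3) by (simp only: mult.assoc)
  finally have "dist x (x + \<epsilon> *\<^sub>R (\<i> * z + t *\<^sub>R z)) < r"
    using assms(2) by (simp add: dist_norm)
  moreover have "cross z (\<epsilon> *\<^sub>R (\<i> * z + t *\<^sub>R z)) = \<epsilon> * inner z z"
    by (simp add: cross_scale cross_add_right cross_ii_right cross_self)
  then have "0 < cross z (\<epsilon> *\<^sub>R (\<i> * z + t *\<^sub>R z))"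
    using assms by simp
  ultimately show ?thesis
    by (simp add: left_half_disc_def)
qed

lemma small_step:
  assumes "0 < (r::real)" "0 \<le> b"
  obtains \<epsilon> where "0 < \<epsilon>" "\<epsilon> * b < r" "\<epsilon> < 1"
proof (rule that[of "min (1 / 2) (r / (2 * (b + 1)))"])
  have "min (1 / 2) (r / (2 * (b + 1))) * b \<le> (r / (2 * (b + 1))) * b"
    using assms by (intro mult_right_mono) auto
  also have "\<dots> = r / 2 * (b / (b + 1))"
    by simp
  also have "\<dots> \<le> r / 2 * 1"
    using assms by (intro mult_left_mono) (auto simp: field_simps)
  also have "\<dots> < r"
    using assms by simp
  finally show "min (1 / 2) (r / (2 * (b + 1))) * b < r" .
qed (use assms in auto)

lemma left_half_disc_nonempty: assumes "z \<noteq> 0" "0 < r" shows "left_half_disc z x r \<noteq> {}"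
proof -
  obtain \<epsilon> where "0 < \<epsilon>" "\<epsilon> * cmod z < r"
    using small_step[of r "cmod z"] assms by auto
  then show ?thesis
    using left_half_disc_point[of z \<epsilon> 0 r x] assms by auto
qed

lemma in_closure_left_half_disc:
  assumes "z \<noteq> 0" "0 < r"
  shows "x \<in> closure (left_half_disc z x r)"
  unfolding closure_approachable
proof (intro allI impI)
  fix e :: real assume "0 < e"
  obtain y where "y \<in> left_half_disc z x (min r e)"
    using left_half_disc_nonempty[of z "min r e" x] assms \<open>0 < e\<close> by auto
  then show "\<exists>y\<in>left_half_disc z x r. dist y x < e"
    by (auto simp: left_half_disc_def dist_commute)
qed

text \<open>
  The half disc contains small multiples of \<open>\<i> * z + t *\<^sub>R z\<close> for all
  \<open>t\<close>, of either sign.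
\<close>

lemma linear_nonpos_on_left_half_disc:
  assumes "z \<noteq> 0" "0 < r" and le: "\<And>y. y \<in> left_half_disc z x r \<Longrightarrow> inner a (y - x) \<le> 0"
  shows "inner a z = 0" "inner a (\<i> * z) \<le> 0"
proof -
  have *: "inner a (\<i> * z) + t * inner a z \<le> 0" for t
  proof -
    obtain \<epsilon> where \<epsilon>: "0 < \<epsilon>" "\<epsilon> * ((1 + \<bar>t\<bar>) * cmod z) < r"
      using small_step[of r "(1 + \<bar>t\<bar>) * cmod z"] assms by auto
    then have "inner a (\<epsilon> *\<^sub>R (\<i> * z + t *\<^sub>R z)) \<le> 0"
      using le[OF left_half_disc_point[of z \<epsilon> t r x]] assms by (simp add: mult.assoc)
    then have "\<epsilon> * (inner a (\<i> * z) + t * inner a z) \<le> 0"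
      by (simp add: inner_add_right)
    then show ?thesis
      using \<epsilon>(1) by (simp add: mult_le_0_iff)
  qed
  show "inner a z = 0"
  proof (rule ccontr)
    assume ne: "inner a z \<noteq> 0"
    then have "inner a (\<i> * z) + ((1 - inner a (\<i> * z)) / inner a z) * inner a z = 1"
      by simp
    then show False
      using *[of "(1 - inner a (\<i> * z)) / inner a z"] by simp
  qed
  show "inner a (\<i> * z) \<le> 0"
    using *[of 0] by simp
qed

lemma midpoint_toward:
  fixes a b :: complex
  shows "midpoint a (a + s *\<^sub>R (b - a)) = (1 - s / 2) *\<^sub>R a + (s / 2) *\<^sub>R b"
  by (simp add: midpoint_def scaleR_conv_of_real field_simps)

text \<open>
  If two edges left a vertex in the same direction, the shorter one would be contained in the
  longer one, and its midpoint would be a common point that is no vertex.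
\<close>

lemma noncrossing_directions_distinct:
  assumes nc: "noncrossing W D t q" and swap: "\<And>d. d \<in> D \<Longrightarrow> prod.swap d \<in> D"
    and d: "d \<in> D" "d' \<in> D" "t d = t d'" "d \<noteq> d'"
  shows "dart_angle t q d d' < 2 * pi"
proof (rule ccontr)
  let ?dir = "\<lambda>d. q (t (prod.swap d)) - q (t d)"
  assume "\<not> dart_angle t q d d' < 2 * pi"
  then have ang: "dart_angle t q d d' = 2 * pi"
    using ccw_angle_le unfolding dart_angle_def by (metis linorder_not_le order_antisym)
  have tails: "t d \<in> W" "t d \<noteq> t (prod.swap d)" if "d \<in> D" for d
    using nc that unfolding noncrossing_def by blast+
  have "inj_on q W"
    using nc unfolding noncrossing_def by blast
  then have nz: "q (t d) \<noteq> q (t (prod.swap d))" if "d \<in> D" for d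
    using tails that swap inj_onD by metis
  have "d' \<noteq> prod.swap d"
    using tails(2)[OF d(1)] d(3) by auto
  have key: "False" if d: "d \<in> D" "d' \<in> D" "t d = t d'" "d' \<noteq> d" "d' \<noteq> prod.swap d"
    and dir: "?dir d' = s *\<^sub>R ?dir d" "0 < s" "s \<le> 1" for d d' s
  proof -
    define m where "m = midpoint (q (t d')) (q (t (prod.swap d')))"
    have "q (t (prod.swap d')) = q (t d) + s *\<^sub>R ?dir d"
      using dir(1) d(3) by (metis add_diff_cancel_left' diff_add_cancel add.commute)
    then have "m = (1 - s / 2) *\<^sub>R q (t d) + (s / 2) *\<^sub>R q (t (prod.swap d))"
      by (simp only: m_def d(3)[symmetric] midpoint_toward)
    then have "m \<in> dart_segment t q d"
      unfolding dart_segment_def in_segment using dir by (intro exI[of _ "s / 2"]) auto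
    moreover have "m \<in> dart_segment t q d'"
      unfolding dart_segment_def m_def by simp
    moreover have "dart_segment t q d \<inter> dart_segment t q d' \<subseteq> q ` (dart_ends t d \<inter> dart_ends t d')"
      using nc d unfolding noncrossing_def by blast
    ultimately have "m \<in> q ` dart_ends t d'"
      by blast
    then have "q (t d') = q (t (prod.swap d'))"
      unfolding dart_ends_def m_def by (auto simp: midpoint_eq_endpoint)
    then show False
      using nz[OF d(2)] by simp
  qed
  have ne: "?dir d \<noteq> 0" "?dir d' \<noteq> 0"
    using nz[OF d(1)] nz[OF d(2)] by auto
  define s where "s = cmod (?dir d') / cmod (?dir d)"
  have s: "0 < s"
    using ne by (simp add: s_def)
  have "?dir d' = rcis s (2 * pi) * ?dir d"
    using ccw_angle_polar[OF ne] ang unfolding dart_angle_def s_def by simp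
  then have b: "?dir d' = s *\<^sub>R ?dir d"
    by (simp add: rcis_def scaleR_conv_of_real)
  show False
  proof (cases "s \<le> 1")
    case True
    then show ?thesis
      using key[OF d(1-3) d(4)[symmetric] \<open>d' \<noteq> prod.swap d\<close> b s] by simp
  next
    case False
    have "?dir d = (1 / s) *\<^sub>R ?dir d'"
      unfolding b using s by simp
    moreover have "d \<noteq> prod.swap d'"
      using \<open>d' \<noteq> prod.swap d\<close> by auto
    ultimately show ?thesis
      using key[OF d(2,1) d(3)[symmetric] d(4), of "1 / s"] s False by simp
  qed
qed

section \<open>Faces of a straight-line drawing\<close>

locale plane_framework =
  fixes V :: "'v set" and E :: "'v set set" and p :: "'v \<Rightarrow> complex"
  assumes framework: "noncrossing_framework V E p" and two_conn: "two_connected V E"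
begin

abbreviation D :: "('v \<times> 'v) set" where "D \<equiv> darts E"
abbreviation dr :: "complex set" where "dr \<equiv> drawing V E p"
abbreviation Fs :: "complex set set" where "Fs \<equiv> faces V E p"
abbreviation Lf :: "'v \<times> 'v \<Rightarrow> complex set" where "Lf \<equiv> left_face V E p"
abbreviation Out :: "complex set" where "Out \<equiv> outer_face V E p"
abbreviation dir :: "'v \<times> 'v \<Rightarrow> complex" where "dir d \<equiv> p (snd d) - p (fst d)"
abbreviation seg :: "'v \<times> 'v \<Rightarrow> complex set" where "seg d \<equiv> closed_segment (p (fst d)) (p (snd d))"
abbreviation oseg :: "'v \<times> 'v \<Rightarrow> complex set" where "oseg d \<equiv> open_segment (p (fst d)) (p (snd d))"

lemma finite_V: "finite V"
  using framework by (simp add: noncrossing_framework_def simple_graph_def)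

lemma edge_pair: assumes "{i, j} \<in> E" shows "i \<in> V" "j \<in> V" "i \<noteq> j"
proof -
  have "{i, j} \<subseteq> V" "card {i, j} = 2"
    using framework assms by (auto simp: noncrossing_framework_def simple_graph_def)
  then show "i \<in> V" "j \<in> V" "i \<noteq> j"
    by auto
qed

lemma dart_iff: "d \<in> D \<longleftrightarrow> {fst d, snd d} \<in> E"
  by (cases d) (simp add: darts_def)

lemma dart_ends: assumes "d \<in> D" shows "fst d \<in> V" "snd d \<in> V" "fst d \<noteq> snd d" "prod.swap d \<in> D"
  using assms edge_pair[of "fst d" "snd d"] by (simp_all add: dart_iff insert_commute)

lemma finite_D: "finite D"
proof (rule finite_subset)
  show "D \<subseteq> V \<times> V"
    using dart_ends(1,2) by (force simp: mem_Times_iff)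
qed (simp add: finite_V)

lemma noncrossing_p: "noncrossing V D fst p"
  using framework by (simp add: noncrossing_framework_def)

lemma inj_p: "inj_on p V"
  using noncrossing_p by (simp add: noncrossing_def)

lemma dir_nonzero: "d \<in> D \<Longrightarrow> dir d \<noteq> 0"
  using inj_p dart_ends(1-3)[of d] by (metis inj_onD right_minus_eq)

lemma vertex_on_edge:
  assumes "d \<in> D" "w \<in> V" "p w \<in> seg d" shows "w = fst d \<or> w = snd d"
proof -
  have "w \<in> dart_ends fst d"
    using noncrossing_p assms unfolding noncrossing_def dart_segment_def fst_swap by blast
  then show ?thesis
    by (simp add: dart_ends_def)
qed

lemma edges_meet:
  assumes "d \<in> D" "d' \<in> D" "d' \<noteq> d" "d' \<noteq> prod.swap d" "x \<in> seg d" "x \<in> seg d'"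
  shows "\<exists>w\<in>{fst d, snd d} \<inter> {fst d', snd d'}. x = p w"
proof -
  have "dart_segment fst p d \<inter> dart_segment fst p d' \<subseteq> p ` (dart_ends fst d \<inter> dart_ends fst d')"
    using noncrossing_p assms(1-4) unfolding noncrossing_def by blast
  then show ?thesis
    using assms(5,6) unfolding dart_segment_def dart_ends_def fst_swap by blast
qed

lemma card_V: "3 \<le> card V"
  using two_conn by (simp add: two_connected_def)

text \<open>
  Deleting one neighbour leaves a connected graph with at least two vertices, so there is a
  second neighbour.
\<close>

lemma two_darts:
  assumes "i \<in> V" obtains d d' where "d \<in> D" "d' \<in> D" "fst d = i" "fst d' = i" "d \<noteq> d'"
proof -
  have nb: "\<exists>j\<in>U. {i, j} \<in> E \<and> j \<noteq> i" if "graph_connected U E" "i \<in> U" "w \<in> U" "w \<noteq> i" for U w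
  proof -
    have "(i, w) \<in> {(x, y). x \<in> U \<and> y \<in> U \<and> {x, y} \<in> E}\<^sup>*"
      using that by (simp add: graph_connected_def)
    then obtain j where "(i, j) \<in> {(x, y). x \<in> U \<and> y \<in> U \<and> {x, y} \<in> E}"
      using \<open>w \<noteq> i\<close> by (cases rule: converse_rtranclE) auto
    then show ?thesis
      using edge_pair(3) by auto
  qed
  have "card (V - {i}) \<ge> 2"
    using card_V assms finite_V by simp
  then obtain w where "w \<in> V - {i}"
    by (metis card.empty ex_in_conv not_numeral_le_zero)
  then obtain j where j: "j \<in> V" "{i, j} \<in> E" "j \<noteq> i"
    using nb[of V w] two_conn assms by (auto simp: two_connected_def)
  have "card (V - {i, j}) \<ge> 1"
    using card_V assms finite_V j by (subst card_Diff_subset) auto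
  then obtain w' where "w' \<in> V - {i, j}"
    by (metis card.empty ex_in_conv not_one_le_zero)
  moreover have "graph_connected (V - {j}) E"
    using two_conn j by (simp add: two_connected_def)
  ultimately obtain k where "k \<in> V - {j}" "{i, k} \<in> E"
    using nb[of "V - {j}" w'] assms j by auto
  then show thesis
    using that[of "(i, j)" "(i, k)"] j by (auto simp: darts_def)
qed

lemma degree_two: assumes "d \<in> D" shows "\<exists>d'\<in>D. fst d' = fst d \<and> d' \<noteq> d"
  using two_darts[OF dart_ends(1)[OF assms]] by metis

lemma drawing_eq: "dr = (\<Union>d\<in>D. seg d)"
proof
  show "dr \<subseteq> (\<Union>d\<in>D. seg d)"
  proof
    fix x assume "x \<in> dr"
    then consider i where "i \<in> V" "x = p i" | e where "e \<in> E" "x \<in> convex hull (p ` e)"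
      unfolding drawing_def by blast
    then show "x \<in> (\<Union>d\<in>D. seg d)"
    proof cases
      case 1
      obtain d where "d \<in> D" "fst d = i"
        using two_darts[OF 1(1)] by metis
      then show ?thesis
        using 1(2) by auto
    next
      case 2
      have "card e = 2"
        using framework 2(1) by (simp add: noncrossing_framework_def simple_graph_def)
      then obtain i j where "e = {i, j}"
        by (meson card_2_iff)
      then have "(i, j) \<in> D" "x \<in> seg (i, j)"
        using 2 by (simp_all add: darts_def segment_convex_hull)
      then show ?thesis
        by blast
    qed
  qed
  show "(\<Union>d\<in>D. seg d) \<subseteq> dr"
    unfolding drawing_def by (fastforce simp: darts_def segment_convex_hull)
qed

lemma compact_dr: "compact dr"
  unfolding drawing_eq by (intro compact_UN finite_D) auto

lemma closed_dr: "closed dr"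
  by (simp add: compact_dr compact_imp_closed)

lemma interior_dr: "interior dr = {}"
proof -
  have "interior (\<Union>d\<in>S. seg d) = {}" if "finite S" for S
    using that
  proof induction
    case (insert d S)
    have "interior (seg d \<union> (\<Union>d\<in>S. seg d)) = interior (seg d)"
      using insert.IH by (intro interior_closed_Un_empty_interior) auto
    then show ?case
      by (simp add: interior_closed_segment_ge2)
  qed simp
  then show ?thesis
    unfolding drawing_eq using finite_D by blast
qed

lemma open_meets_complement: assumes "open U" "U \<noteq> {}" shows "U - dr \<noteq> {}"
  using assms by (metis Diff_eq_empty_iff interior_dr interior_maximal subset_empty)

lemma face_props: assumes "F \<in> Fs" shows "open F" "connected F" "F \<inter> dr = {}" "F \<noteq> {}"
  using assms open_components[of "- dr" F] closed_dr in_components_connected in_components_nonempty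
    in_components_subset[of F "- dr"]
  by (auto simp: faces_def open_Compl)

lemma face_unique: "F \<in> Fs \<Longrightarrow> F' \<in> Fs \<Longrightarrow> x \<in> F \<Longrightarrow> x \<in> F' \<Longrightarrow> F = F'"
  unfolding faces_def using components_eq by blast

lemma ex_face: "x \<notin> dr \<Longrightarrow> \<exists>F\<in>Fs. x \<in> F"
  unfolding faces_def by (metis Compl_iff UnionE Union_components)

lemma connected_in_face: assumes "connected S" "S \<inter> dr = {}" "F \<in> Fs" "S \<inter> F \<noteq> {}" shows "S \<subseteq> F"
  using components_maximal[of F "- dr" S] assms unfolding faces_def by blast

text \<open>
  A compact part of an open edge has a positive distance from all other edges.
\<close>

lemma edge_tube:
  assumes d: "d \<in> D" and K: "compact K" "K \<subseteq> oseg d"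
  obtains r where "0 < r" "\<And>y x. y \<in> K \<Longrightarrow> x \<in> ball y r \<Longrightarrow> x \<in> dr \<Longrightarrow> x \<in> seg d"
proof -
  define R where "R = (\<Union>d'\<in>D - {d, prod.swap d}. seg d')"
  have "closed R"
    unfolding R_def using finite_D by (intro closed_UN) auto
  moreover have "K \<inter> R = {}"
  proof (rule ccontr)
    assume "K \<inter> R \<noteq> {}"
    then obtain x d' where x: "x \<in> oseg d" "d' \<in> D" "d' \<noteq> d" "d' \<noteq> prod.swap d" "x \<in> seg d'"
      using K unfolding R_def by blast
    then have "\<exists>w\<in>{fst d, snd d} \<inter> {fst d', snd d'}. x = p w"
      using edges_meet[OF d x(2-4)] segment_open_subset_closed by blast
    then show False
      using x(1) by (auto simp: open_segment_def)
  qed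
  ultimately have "\<exists>r>0. \<forall>y\<in>K. \<forall>x\<in>R. r \<le> dist y x"
    by (rule separate_compact_closed[OF K(1)])
  then obtain r where r: "0 < r" "\<And>y x. y \<in> K \<Longrightarrow> x \<in> R \<Longrightarrow> r \<le> dist y x"
    by blast
  show thesis
  proof (rule that[OF r(1)])
    fix y x assume y: "y \<in> K" "x \<in> ball y r" "x \<in> dr"
    then obtain d' where d': "d' \<in> D" "x \<in> seg d'"
      unfolding drawing_eq by blast
    have "x \<notin> R"
      using r(2)[OF y(1), of x] y(2) by auto
    then have "d' = d \<or> d' = prod.swap d"
      using d' unfolding R_def by blast
    then show "x \<in> seg d"
      using d'(2) by (auto simp: closed_segment_commute)
  qed
qed

lemma cross_on_segment: assumes "x \<in> seg d" "y \<in> seg d" shows "cross (dir d) (x - y) = 0"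
proof -
  obtain s t where xy: "x = (1 - s) *\<^sub>R p (fst d) + s *\<^sub>R p (snd d)"
    "y = (1 - t) *\<^sub>R p (fst d) + t *\<^sub>R p (snd d)"
    using assms by (auto simp: in_segment)
  have "x - y = (s - t) *\<^sub>R dir d"
    unfolding xy by (simp add: algebra_simps)
  then show ?thesis
    by (simp only: cross_scale cross_self mult_zero_right)
qed

lemma half_disc_off_drawing:
  assumes "d \<in> D" "x \<in> oseg d"
  obtains r where "0 < r" "left_half_disc (dir d) x r \<inter> dr = {}"
proof -
  obtain r where r: "0 < r" "\<And>z y. z \<in> {x} \<Longrightarrow> y \<in> ball z r \<Longrightarrow> y \<in> dr \<Longrightarrow> y \<in> seg d"
    by (rule edge_tube[OF assms(1), of "{x}"]) (use assms(2) in auto)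
  have xs: "x \<in> seg d"
    using assms(2) segment_open_subset_closed by blast
  have "y \<notin> dr" if "y \<in> left_half_disc (dir d) x r" for y
    using r(2)[of x y] cross_on_segment[OF _ xs, of y] that by (auto simp: left_half_disc_def)
  then have "left_half_disc (dir d) x r \<inter> dr = {}"
    by blast
  then show thesis
    using that r by blast
qed

lemma half_discs_connected:
  assumes d: "d \<in> D" and x: "x \<in> oseg d" and m: "m \<in> oseg d"
  obtains T r where "0 < r" "connected T" "T \<inter> dr = {}"
    "left_half_disc (dir d) x r \<subseteq> T" "left_half_disc (dir d) m r \<subseteq> T"
proof -
  let ?K = "closed_segment m x"
  have K: "?K \<subseteq> oseg d"
    using x m by (simp add: closed_segment_subset)
  obtain r where r: "0 < r" "\<And>y x. y \<in> ?K \<Longrightarrow> x \<in> ball y r \<Longrightarrow> x \<in> dr \<Longrightarrow> x \<in> seg d"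
    using edge_tube[OF d _ K] by auto
  define T where "T = (\<Union>k\<in>?K. \<Union>b\<in>ball 0 r. {k + b}) \<inter> {y. 0 < cross (dir d) (y - m)}"
  have "convex T"
    unfolding T_def by (intro convex_Int convex_sums convex_left) auto
  moreover have "T \<inter> dr = {}"
  proof -
    have "k + b \<in> seg d" if "k \<in> ?K" "b \<in> ball 0 r" "k + b \<in> dr" for k b
      using r(2)[of k "k + b"] that by (simp add: dist_norm)
    moreover have "m \<in> seg d"
      using m segment_open_subset_closed by blast
    ultimately have "cross (dir d) (k + b - m) = 0" if "k \<in> ?K" "b \<in> ball 0 r" "k + b \<in> dr" for k b
      using cross_on_segment that by blast
    then show ?thesis
      unfolding T_def by fastforce
  qed
  moreover have "left_half_disc (dir d) y r \<subseteq> T" if y: "y \<in> ?K" for y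
  proof
    fix w assume w: "w \<in> left_half_disc (dir d) y r"
    have "w = y + (w - y)" "w - y \<in> ball 0 r"
      using w by (auto simp: left_half_disc_def dist_norm norm_minus_commute)
    moreover have "cross (dir d) (y - m) = 0"
      using cross_on_segment K y m segment_open_subset_closed by blast
    then have "cross (dir d) (w - m) = cross (dir d) (w - y)"
      by (simp add: cross_add_right)
    then have "0 < cross (dir d) (w - m)"
      using w by (simp add: left_half_disc_def)
    ultimately show "w \<in> T"
      using y unfolding T_def by blast
  qed
  ultimately show thesis
    using that[of r T] r(1) by (simp add: convex_connected)
qed

text \<open>
  The face to the left of the midpoint is to the left of the whole edge, because half discs
  along the edge are joined by a convex strip off the drawing.
\<close>

lemma left_face_props:
  assumes d: "d \<in> D"
  shows "Lf d \<in> Fs" "\<And>x. x \<in> oseg d \<Longrightarrow> \<exists>r>0. left_half_disc (dir d) x r \<subseteq> Lf d"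
proof -
  let ?m = "midpoint (p (fst d)) (p (snd d))"
  have m: "?m \<in> oseg d"
    using dir_nonzero[OF d] by (simp add: midpoint_in_open_segment)
  obtain r0 where r0: "0 < r0" "left_half_disc (dir d) ?m r0 \<inter> dr = {}"
    by (rule half_disc_off_drawing[OF d m])
  obtain y0 where y0: "y0 \<in> left_half_disc (dir d) ?m r0"
    using left_half_disc_nonempty dir_nonzero[OF d] r0(1) by blast
  then obtain F where F: "F \<in> Fs" "y0 \<in> F"
    using ex_face r0(2) by blast
  have mF: "left_half_disc (dir d) ?m r0 \<subseteq> F"
    using connected_in_face[OF convex_connected[OF convex_left_half_disc] r0(2) F(1)] y0 F(2) by blast
  have ev: "\<forall>\<^sub>F \<epsilon> in at_right 0. ?m + \<epsilon> *\<^sub>R (\<i> * dir d) \<in> left_half_disc (dir d) ?m r0"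
  proof -
    have "0 < r0 / cmod (dir d)"
      using r0 dir_nonzero[OF d] by simp
    moreover have "?m + \<epsilon> *\<^sub>R (\<i> * dir d) \<in> left_half_disc (dir d) ?m r0"
      if "0 < \<epsilon>" "\<epsilon> < r0 / cmod (dir d)" for \<epsilon>
      using left_half_disc_point[OF dir_nonzero[OF d] that(1), of 0 r0 ?m] that dir_nonzero[OF d]
      by (simp add: pos_less_divide_eq)
    ultimately show ?thesis
      unfolding eventually_at_right_field by blast
  qed
  have evF: "\<forall>\<^sub>F \<epsilon> in at_right 0. ?m + \<epsilon> *\<^sub>R (\<i> * dir d) \<in> F"
    using ev by (rule eventually_mono) (rule subsetD[OF mF])
  have "Lf d = F"
    unfolding left_face_def
  proof (rule the_equality)
    show "F \<in> Fs \<and> (\<forall>\<^sub>F \<epsilon> in at_right 0. ?m + \<epsilon> *\<^sub>R (\<i> * dir d) \<in> F)"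
      using F(1) evF by (rule conjI)
    fix F' assume F': "F' \<in> Fs \<and> (\<forall>\<^sub>F \<epsilon> in at_right 0. ?m + \<epsilon> *\<^sub>R (\<i> * dir d) \<in> F')"
    have "\<forall>\<^sub>F \<epsilon> in at_right (0::real). \<exists>y. y \<in> F \<and> y \<in> F'"
      using evF conjunct2[OF F'] by (rule eventually_elim2) (rule exI, rule conjI)
    then have "\<exists>y. y \<in> F \<and> y \<in> F'"
      by (simp add: eventually_const_iff)
    then show "F' = F"
      using face_unique F(1) F' by blast
  qed
  then show "Lf d \<in> Fs"
    using F by simp
  fix x assume x: "x \<in> oseg d"
  obtain T r where T: "0 < r" "connected T" "T \<inter> dr = {}"
    "left_half_disc (dir d) x r \<subseteq> T" "left_half_disc (dir d) ?m r \<subseteq> T"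
    by (rule half_discs_connected[OF d x m])
  obtain y where "y \<in> left_half_disc (dir d) ?m (min r r0)"
    using left_half_disc_nonempty dir_nonzero[OF d] T(1) r0(1) by (metis ex_in_conv min_less_iff_conj)
  then have "y \<in> T" "y \<in> F"
    using T(5) mF left_half_disc_mono[OF min.cobounded1] left_half_disc_mono[OF min.cobounded2]
    by (meson subsetD)+
  then have "T \<subseteq> F"
    using connected_in_face[OF T(2,3) F(1)] by blast
  then show "\<exists>r>0. left_half_disc (dir d) x r \<subseteq> Lf d"
    using T(1,4) \<open>Lf d = F\<close> by blast
qed

lemma edge_in_closure: assumes "d \<in> D" shows "seg d \<subseteq> closure (Lf d)"
proof -
  have "oseg d \<subseteq> closure (Lf d)"
  proof
    fix x assume "x \<in> oseg d"
    then obtain r where "r > 0" "left_half_disc (dir d) x r \<subseteq> Lf d"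
      using left_face_props(2) assms by blast
    then show "x \<in> closure (Lf d)"
      using in_closure_left_half_disc[OF dir_nonzero[OF assms]] closure_mono by blast
  qed
  then have "closure (oseg d) \<subseteq> closure (Lf d)"
    by (rule closure_minimal) simp
  moreover have "closure (oseg d) = seg d"
    using dir_nonzero[OF assms] by (simp add: closure_open_segment)
  ultimately show ?thesis
    by simp
qed

lemma near_edge:
  assumes d: "d \<in> D" and x: "x \<in> oseg d"
  obtains r where "0 < r" "ball x r \<subseteq> Lf d \<union> Lf (prod.swap d) \<union> seg d"
proof -
  have d': "prod.swap d \<in> D" and x': "x \<in> oseg (prod.swap d)"
    using dart_ends(4)[OF d] x by (simp_all add: open_segment_commute)
  obtain r1 where r1: "r1 > 0" "left_half_disc (dir d) x r1 \<subseteq> Lf d"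
    using left_face_props(2)[OF d x] by blast
  obtain r2 where r2: "r2 > 0" "left_half_disc (dir (prod.swap d)) x r2 \<subseteq> Lf (prod.swap d)"
    using left_face_props(2)[OF d' x'] by blast
  obtain t where t: "0 < t" "t < 1" "x = (1 - t) *\<^sub>R p (fst d) + t *\<^sub>R p (snd d)"
    using x by (auto simp: in_segment)
  define r where "r = min (min r1 r2) (min t (1 - t) * cmod (dir d))"
  have "0 < r"
    using r1 r2 t dir_nonzero[OF d] by (simp add: r_def)
  moreover have "y \<in> Lf d \<union> Lf (prod.swap d) \<union> seg d" if y: "y \<in> ball x r" for y
  proof -
    have "dir (prod.swap d) = - dir d"
      by simp
    then have neg: "cross (dir (prod.swap d)) (y - x) = - cross (dir d) (y - x)"
      by (simp only: cross_scale(3))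
    consider "0 < cross (dir d) (y - x)" | "cross (dir d) (y - x) < 0" | "cross (dir d) (y - x) = 0"
      by linarith
    then show ?thesis
    proof cases
      case 1
      then have "y \<in> left_half_disc (dir d) x r1"
        using y by (simp add: left_half_disc_def r_def)
      then show ?thesis
        using r1(2) by blast
    next
      case 2
      then have "y \<in> left_half_disc (dir (prod.swap d)) x r2"
        unfolding left_half_disc_def mem_Collect_eq neg using y by (simp add: r_def)
      then show ?thesis
        using r2(2) by blast
    next
      case 3
      then have "inner (y - x) (\<i> * dir d) = 0"
        by (simp add: inner_ii)
      moreover have "\<i> * dir d \<noteq> 0"
        using dir_nonzero[OF d] by simp
      ultimately obtain s where "y - x = s *\<^sub>R (\<i> * (\<i> * dir d))"
        by (rule perp_ex)
      moreover have "\<i> * (\<i> * dir d) = - dir d"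
        by (simp flip: mult.assoc)
      ultimately have s: "y - x = (- s) *\<^sub>R dir d"
        by (simp only: scaleR_minus_left scaleR_minus_right)
      have "cmod (y - x) < min t (1 - t) * cmod (dir d)"
        using y by (simp add: r_def dist_norm norm_minus_commute)
      then have "\<bar>s\<bar> < min t (1 - t)"
        unfolding s using dir_nonzero[OF d] by simp
      then have "0 \<le> t - s" "t - s \<le> 1"
        by auto
      moreover have "y = (1 - (t - s)) *\<^sub>R p (fst d) + (t - s) *\<^sub>R p (snd d)"
        using s t(3) by (simp add: algebra_simps)
      ultimately have "y \<in> seg d"
        unfolding in_segment by blast
      then show ?thesis
        by blast
    qed
  qed
  ultimately show thesis
    using that by blast
qed

lemma edge_point:
  assumes "x \<in> dr" "x \<notin> p ` V"
  obtains d where "d \<in> D" "x \<in> oseg d"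
proof -
  obtain d where d: "d \<in> D" "x \<in> seg d"
    using assms(1) unfolding drawing_eq by blast
  then have "x \<noteq> p (fst d)" "x \<noteq> p (snd d)"
    using assms(2) dart_ends(1,2)[OF d(1)] by auto
  then have "x \<in> oseg d"
    using d(2) by (simp add: open_segment_def)
  then show thesis
    using that d(1) by blast
qed

text \<open>
  The plane without the finitely many vertices is connected, so it is not the disjoint union of
  two nonempty open sets formed by the faces with and without the property \<open>Q\<close>,
  each enlarged by the edges that have such faces on both sides.
\<close>

lemma dual_connected:
  assumes F: "F \<in> Fs" "Q F" and step: "\<And>d. d \<in> D \<Longrightarrow> Q (Lf d) \<Longrightarrow> Q (Lf (prod.swap d))" and F': "F' \<in> Fs"
  shows "Q F'"
proof (rule ccontr)
  assume "\<not> Q F'"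
  define U where "U P = {x. \<exists>r>0. ball x r - dr \<subseteq> \<Union>{F\<in>Fs. P F}}" for P
  have opU: "open (U P)" for P
    unfolding open_contains_ball
  proof
    fix x assume "x \<in> U P"
    then obtain r where r: "r > 0" "ball x r - dr \<subseteq> \<Union>{F\<in>Fs. P F}"
      unfolding U_def by blast
    have "ball x r \<subseteq> U P"
    proof
      fix y assume y: "y \<in> ball x r"
      have "ball y (r - dist x y) \<subseteq> ball x r"
      proof
        fix z assume "z \<in> ball y (r - dist x y)"
        then show "z \<in> ball x r"
          using dist_triangle[of x z y] by simp
      qed
      then show "y \<in> U P"
        using r y unfolding U_def by (intro CollectI exI[of _ "r - dist x y"]) auto
    qed
    then show "\<exists>e>0. ball x e \<subseteq> U P"
      using r(1) by blast
  qed
  have face_U: "G \<subseteq> U P" if "G \<in> Fs" "P G" for G P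
    using face_props(1)[OF that(1)] that unfolding open_contains_ball U_def by blast
  have disj: "U Q \<inter> U (\<lambda>F. \<not> Q F) = {}"
  proof (rule ccontr)
    assume "U Q \<inter> U (\<lambda>F. \<not> Q F) \<noteq> {}"
    then obtain x r r' where x: "r > 0" "ball x r - dr \<subseteq> \<Union>{F\<in>Fs. Q F}"
      "r' > 0" "ball x r' - dr \<subseteq> \<Union>{F\<in>Fs. \<not> Q F}"
      unfolding U_def by blast
    have "ball x (min r r') - dr \<noteq> {}"
      using x by (intro open_meets_complement) auto
    then obtain y where "y \<in> ball x (min r r') - dr"
      by blast
    then have "y \<in> ball x r - dr" "y \<in> ball x r' - dr"
      by simp_all
    then obtain G G' where "G \<in> Fs" "Q G" "y \<in> G" "G' \<in> Fs" "\<not> Q G'" "y \<in> G'"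
      using x by blast
    then show False
      using face_unique by blast
  qed
  have sym: "Q (Lf (prod.swap d)) \<longleftrightarrow> Q (Lf d)" if "d \<in> D" for d
    using step[OF that] step[OF dart_ends(4)[OF that]] by auto
  have cover: "x \<in> U Q \<union> U (\<lambda>F. \<not> Q F)" if np: "x \<notin> p ` V" for x
  proof (cases "x \<in> dr")
    case True
    obtain d where d: "d \<in> D" "x \<in> oseg d"
      by (rule edge_point[OF True np])
    obtain r where r: "0 < r" "ball x r \<subseteq> Lf d \<union> Lf (prod.swap d) \<union> seg d"
      by (rule near_edge[OF d])
    have "ball x r - dr \<subseteq> Lf d \<union> Lf (prod.swap d)"
      using r(2) d(1) unfolding drawing_eq by blast
    moreover have LF: "Lf d \<in> Fs" "Lf (prod.swap d) \<in> Fs"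
      using left_face_props(1) dart_ends(4) d(1) by blast+
    moreover have "Lf d \<union> Lf (prod.swap d) \<subseteq> \<Union>{F\<in>Fs. P F}" if "P (Lf d)" "P (Lf (prod.swap d))" for P
      using LF that by blast
    ultimately have U_mem: "x \<in> U P" if "P (Lf d)" "P (Lf (prod.swap d))" for P
      using that r(1) unfolding U_def by (intro CollectI exI[of _ r] conjI) (assumption, meson order_trans)
    show ?thesis
      using U_mem[of Q] U_mem[of "\<lambda>F. \<not> Q F"] sym[OF d(1)] by (cases "Q (Lf d)") simp_all
  next
    case False
    then obtain G where "G \<in> Fs" "x \<in> G"
      using ex_face by blast
    then show ?thesis
      using face_U[of G Q] face_U[of G "\<lambda>F. \<not> Q F"] by (cases "Q G") (simp_all add: subset_iff)
  qed
  have "connected (UNIV - p ` V)"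
    using finite_V by (intro connected_open_delete_finite) auto
  then have "U Q \<inter> (UNIV - p ` V) = {} \<or> U (\<lambda>F. \<not> Q F) \<inter> (UNIV - p ` V) = {}"
    using disj cover by (intro connectedD opU) auto
  moreover have "G \<inter> (UNIV - p ` V) \<noteq> {}" if "G \<in> Fs" for G
  proof -
    have "p ` V \<subseteq> dr"
      by (auto simp: drawing_def)
    then show ?thesis
      using face_props(3,4)[OF that] by blast
  qed
  ultimately show False
    using face_U[of F Q] face_U[of F' "\<lambda>F. \<not> Q F"] F F' \<open>\<not> Q F'\<close> by blast
qed

lemma outer_is_face: "Out \<in> Fs"
  unfolding outer_face_def faces_def outside_in_components
  using connected_outside[of dr] compact_dr compact_imp_bounded outside_bounded_nonempty[of dr] by auto

lemma bounded_complement_outer: "bounded (- Out)"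
proof -
  obtain B where B: "dr \<subseteq> ball 0 B"
    using compact_imp_bounded[OF compact_dr] by (meson bounded_subset_ballD)
  then have "- ball 0 B \<subseteq> Out"
    unfolding outer_face_def by (intro outside_subset_convex convex_ball)
  then show ?thesis
    by (metis bounded_ball bounded_subset double_compl Compl_subset_Compl_iff)
qed

lemma unbounded_outer: "\<not> bounded Out"
  using bounded_complement_outer by (metis bounded_Un Compl_partition not_bounded_UNIV)

text \<open>
  If no edge at the vertex lies to the left of \<open>d\<close>, a half disc around the vertex
  itself is free of the drawing. This replaces a discussion of non-convex sectors.
\<close>

lemma vertex_half_disc:
  assumes d: "d \<in> D" and free: "\<And>d'. d' \<in> D \<Longrightarrow> fst d' = fst d \<Longrightarrow> cross (dir d) (dir d') \<le> 0"
  obtains r where "0 < r" "left_half_disc (dir d) (p (fst d)) r \<subseteq> Lf d"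
proof -
  let ?u = "fst d"
  define R where "R = (\<Union>d'\<in>{d'\<in>D. fst d' \<noteq> ?u \<and> snd d' \<noteq> ?u}. seg d')"
  have "closed R"
    unfolding R_def using finite_D by (intro closed_UN) auto
  moreover have "p ?u \<notin> R"
    unfolding R_def by (auto dest!: vertex_on_edge[OF _ dart_ends(1)[OF d]])
  ultimately have "\<exists>r>0. \<forall>x\<in>R. r \<le> dist (p ?u) x"
    by (rule separate_point_closed)
  then obtain r where r: "0 < r" "\<And>x. x \<in> R \<Longrightarrow> r \<le> dist (p ?u) x"
    by blast
  let ?H = "left_half_disc (dir d) (p ?u) r"
  have off: "?H \<inter> dr = {}"
  proof (rule ccontr)
    assume "?H \<inter> dr \<noteq> {}"
    then obtain y d' where y: "y \<in> ?H" "d' \<in> D" "y \<in> seg d'"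
      unfolding drawing_eq by blast
    have "y \<notin> R"
      using r(2)[of y] y(1) by (auto simp: left_half_disc_def)
    then have "fst d' = ?u \<or> snd d' = ?u"
      using y unfolding R_def by blast
    then obtain e where e: "e \<in> D" "fst e = ?u" "y \<in> seg e"
      using y(2,3) dart_ends(4)[of d'] by (metis closed_segment_commute fst_swap snd_swap)
    then obtain t where t: "0 \<le> t" "y = (1 - t) *\<^sub>R p ?u + t *\<^sub>R p (snd e)"
      by (auto simp: in_segment)
    then have "y - p ?u = t *\<^sub>R dir e"
      using e(2) by (simp add: algebra_simps)
    then have "cross (dir d) (y - p ?u) = t * cross (dir d) (dir e)"
      by (simp only: cross_scale)
    then have "cross (dir d) (y - p ?u) \<le> 0"
      using free[OF e(1,2)] t(1) by (simp add: mult_nonneg_nonpos)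
    then show False
      using y(1) by (simp add: left_half_disc_def)
  qed
  obtain s where s: "0 < s" "s * cmod (dir d) < r / 2" "s < 1"
    using small_step[of "r / 2" "cmod (dir d)"] r(1) by auto
  define x where "x = p ?u + s *\<^sub>R dir d"
  have "x = (1 - s) *\<^sub>R p ?u + s *\<^sub>R p (snd d)"
    by (simp add: x_def algebra_simps)
  then have x: "x \<in> oseg d"
    using s dir_nonzero[OF d] by (auto simp: in_segment)
  obtain r1 where r1: "r1 > 0" "left_half_disc (dir d) x r1 \<subseteq> Lf d"
    using left_face_props(2)[OF d x] by blast
  obtain y where y: "y \<in> left_half_disc (dir d) x (min r1 (r / 2))"
    using left_half_disc_nonempty[OF dir_nonzero[OF d], of "min r1 (r / 2)" x] r(1) r1(1) by auto
  have "y \<in> Lf d"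
    using y r1(2) left_half_disc_mono[of "min r1 (r / 2)" r1] by auto
  moreover have "y \<in> ?H"
  proof -
    have "dist (p ?u) x < r / 2"
      using s by (simp add: x_def dist_norm)
    moreover have "dist x y < r / 2"
      using y by (simp add: left_half_disc_def)
    ultimately have "dist (p ?u) y < r"
      using dist_triangle[of "p ?u" y x] by simp
    moreover have "cross (dir d) (y - p ?u) = cross (dir d) (y - x) + cross (dir d) (x - p ?u)"
      by (simp add: cross_add_right)
    then have "cross (dir d) (y - p ?u) = cross (dir d) (y - x)"
      by (simp add: x_def cross_scale cross_self)
    ultimately show ?thesis
      using y by (simp add: left_half_disc_def)
  qed
  ultimately have "?H \<subseteq> Lf d"
    using connected_in_face[OF convex_connected[OF convex_left_half_disc] off left_face_props(1)[OF d]]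
    by blast
  then show thesis
    using that r(1) by blast
qed

end

section \<open>The convex hull of a drawing\<close>

lemma closed_segment_similar:
  fixes \<eta> :: complex
  assumes "\<eta> \<noteq> 0"
  shows "\<eta> * x + k \<in> closed_segment (\<eta> * a + k) (\<eta> * b + k) \<longleftrightarrow> x \<in> closed_segment a b"
proof -
  have "(1 - u) *\<^sub>R (\<eta> * a + k) + u *\<^sub>R (\<eta> * b + k) = \<eta> * ((1 - u) *\<^sub>R a + u *\<^sub>R b) + k" for u :: real
    by (simp add: scaleR_conv_of_real algebra_simps)
  then show ?thesis
    using assms by (simp add: in_segment)
qed

lemma noncrossing_similar:
  assumes nc: "noncrossing W D t q" and swap: "\<And>d. d \<in> D \<Longrightarrow> prod.swap d \<in> D"
    and "\<eta> \<noteq> 0" and q': "\<And>w. w \<in> W \<Longrightarrow> q' w = \<eta> * q w + k"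
  shows "vertex_succ D t q' = vertex_succ D t q" "noncrossing W D t q'"
proof -
  note nc' = nc[unfolded noncrossing_def]
  note inj = conjunct1[OF nc'] and tails = conjunct1[OF conjunct2[OF nc']]
    and on_edge = conjunct1[OF conjunct2[OF conjunct2[OF nc']]]
    and meet = conjunct1[OF conjunct2[OF conjunct2[OF conjunct2[OF nc']]]]
    and flat = conjunct2[OF conjunct2[OF conjunct2[OF conjunct2[OF nc']]]]
  have W: "t d \<in> W" "t (prod.swap d) \<in> W" if "d \<in> D" for d
    using bspec[OF tails that] bspec[OF tails swap[OF that]] by simp_all
  have ang: "dart_angle t q' d d' = dart_angle t q d d'" if "d \<in> D" "d' \<in> D" for d d'
  proof -
    have "q' (t (prod.swap d)) - q' (t d) = \<eta> * (q (t (prod.swap d)) - q (t d))" if "d \<in> D" for d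
      using W[OF that] q' by (simp add: algebra_simps)
    then show ?thesis
      using that \<open>\<eta> \<noteq> 0\<close> by (simp add: dart_angle_def ccw_angle_mult)
  qed
  show succ: "vertex_succ D t q' = vertex_succ D t q"
    unfolding vertex_succ_def by (intro ext) (use ang in auto)
  have seg: "y \<in> dart_segment t q' d \<longleftrightarrow> (y - k) / \<eta> \<in> dart_segment t q d" if "d \<in> D" for y d
    using closed_segment_similar[OF \<open>\<eta> \<noteq> 0\<close>, of "(y - k) / \<eta>" k "q (t d)" "q (t (prod.swap d))"]
      q' W[OF that] \<open>\<eta> \<noteq> 0\<close> by (simp add: dart_segment_def)
  have pt: "(q' w - k) / \<eta> = q w" if "w \<in> W" for w
    using q'[OF that] \<open>\<eta> \<noteq> 0\<close> by simp
  have "inj_on q' W"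
    using inj q' \<open>\<eta> \<noteq> 0\<close> by (simp add: inj_on_def)
  moreover note tails
  moreover have "\<forall>d\<in>D. \<forall>w\<in>W. q' w \<in> dart_segment t q' d \<longrightarrow> w \<in> dart_ends t d"
    using on_edge seg pt by simp
  moreover have "dart_segment t q' d \<inter> dart_segment t q' d' \<subseteq> q' ` (dart_ends t d \<inter> dart_ends t d')"
    if d: "d \<in> D" "d' \<in> D" "d' \<noteq> d" "d' \<noteq> prod.swap d" for d d'
  proof
    fix y assume "y \<in> dart_segment t q' d \<inter> dart_segment t q' d'"
    then have "(y - k) / \<eta> \<in> dart_segment t q d \<inter> dart_segment t q d'"
      using seg d by simp
    moreover have "dart_segment t q d \<inter> dart_segment t q d' \<subseteq> q ` (dart_ends t d \<inter> dart_ends t d')"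
      using meet d by simp
    ultimately obtain w where w: "w \<in> dart_ends t d \<inter> dart_ends t d'" "(y - k) / \<eta> = q w"
      by blast
    then have "w \<in> W"
      using W[OF d(1)] by (auto simp: dart_ends_def)
    then have "y = q' w"
      using q' w(2) \<open>\<eta> \<noteq> 0\<close> by (simp add: field_simps)
    then show "y \<in> q' ` (dart_ends t d \<inter> dart_ends t d')"
      using w(1) by blast
  qed
  moreover have "\<not> (\<exists>d1 d1' d2 d2'. vertex_succ D t q' d1 d1' \<and> vertex_succ D t q' d2 d2' \<and>
          t d1 = t d2 \<and> d1 \<noteq> d2 \<and> dart_angle t q' d1 d1' = pi \<and> dart_angle t q' d2 d2' = pi)"
  proof -
    have "dart_angle t q' d d' = dart_angle t q d d'" if "vertex_succ D t q d d'" for d d'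
      using ang that by (simp add: vertex_succ_def)
    then show ?thesis
      using flat unfolding succ by metis
  qed
  ultimately show "noncrossing W D t q'"
    unfolding noncrossing_def by (intro conjI) simp_all
qed

context plane_framework
begin

lemma half_plane_in_outer:
  assumes "n \<noteq> 0" and "\<And>j. j \<in> V \<Longrightarrow> inner n (p j - y) \<le> 0" and "0 < inner n (x - y)"
  shows "x \<in> Out"
proof -
  let ?X = "{x. inner n y < inner n x}"
  have conv: "convex ?X"
    using convex_halfspace_gt[of "inner n y" n] by simp
  have "dr \<subseteq> {x. inner n x \<le> inner n y}"
  proof
    fix x assume "x \<in> dr"
    then obtain d where d: "d \<in> D" "x \<in> seg d"
      unfolding drawing_eq by blast
    have "p (fst d) \<in> {x. inner n x \<le> inner n y}" "p (snd d) \<in> {x. inner n x \<le> inner n y}"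
      using assms(2)[of "fst d"] assms(2)[of "snd d"] dart_ends[OF d(1)] by (simp_all add: inner_diff_right)
    then have "seg d \<subseteq> {x. inner n x \<le> inner n y}"
      by (intro closed_segment_subset convex_halfspace_le)
    then show "x \<in> {x. inner n x \<le> inner n y}"
      using d(2) by blast
  qed
  then have disj: "?X \<subseteq> - dr"
    by force
  have xX: "x \<in> ?X"
    using assms(3) by (simp add: inner_diff_right)
  have "\<not> bounded ?X"
  proof
    assume "bounded ?X"
    then obtain B where B: "0 < B" "\<And>z. z \<in> ?X \<Longrightarrow> cmod z \<le> B"
      by (meson bounded_pos)
    define s where "s = (B + cmod x + 1) / cmod n"
    have s: "0 < s"
      using B(1) \<open>n \<noteq> 0\<close> by (simp add: s_def add_pos_nonneg)
    have "inner n (x + s *\<^sub>R n) = inner n x + s * inner n n"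
      by (simp add: inner_add_right)
    moreover have "0 \<le> s * inner n n"
      using s by simp
    ultimately have "x + s *\<^sub>R n \<in> ?X"
      using xX by simp
    then have "cmod (x + s *\<^sub>R n) \<le> B"
      using B(2) by blast
    moreover have "cmod (s *\<^sub>R n) = B + cmod x + 1"
      using s \<open>n \<noteq> 0\<close> B(1) by (simp add: s_def)
    moreover have "cmod (s *\<^sub>R n) \<le> cmod (x + s *\<^sub>R n) + cmod x"
      using norm_triangle_ineq4[of "x + s *\<^sub>R n" x] by simp
    ultimately show False
      by linarith
  qed
  moreover have "?X \<subseteq> connected_component_set (- dr) x"
    using conv disj xX by (intro connected_component_maximal) (auto simp: convex_connected)
  ultimately show ?thesis
    using disj xX bounded_subset unfolding outer_face_def outside_def by blast
qed

text \<open>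
  All edges at \<open>u\<close> point into an open half-plane. The last one before the outward
  normal \<open>n\<close> in counterclockwise order is followed by an angle of at least
  \<open>\<pi>\<close>, and the half disc to its left reaches beyond the supporting line.
\<close>

lemma hull_corner:
  assumes u: "u \<in> V" and n: "\<And>j. j \<in> V \<Longrightarrow> j \<noteq> u \<Longrightarrow> inner n (p j - p u) < 0"
  obtains d d' where "vertex_succ D fst p d d'" "fst d = u" "pi \<le> dart_angle fst p d d'"
    "dart_angle fst p d d' < 2 * pi" "Lf d = Out"
proof -
  let ?S = "{d\<in>D. fst d = u}" and ?\<phi> = "\<lambda>d. ccw_angle (dir d) n"
  obtain d1 where d1: "d1 \<in> D" "fst d1 = u"
    using two_darts[OF u] by metis
  have down: "inner n (dir d) < 0" if "d \<in> ?S" for d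
    using n[of "snd d"] dart_ends[of d] that by auto
  have n0: "n \<noteq> 0"
    using down[of d1] d1 by auto
  have "finite ?S" "?S \<noteq> {}"
    using finite_D d1 by (simp, blast)
  then obtain d where d: "d \<in> ?S" "\<And>e. e \<in> ?S \<Longrightarrow> ?\<phi> d \<le> ?\<phi> e"
    using minimizer_exists[where f = ?\<phi>] by blast
  have dD: "d \<in> D" "fst d = u"
    using d(1) by simp_all
  obtain d' where succ: "vertex_succ D fst p d d'"
    using vertex_succ_exists[OF finite_D dD(1)] by blast
  have d': "d' \<in> D" "fst d' = u"
    using succ dD unfolding vertex_succ_def by auto
  have nz: "dir d \<noteq> 0" "dir d' \<noteq> 0"
    using dir_nonzero dD d' by blast+
  obtain e where e: "e \<in> D" "fst e = fst d" "e \<noteq> d"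
    using degree_two[OF dD(1)] by blast
  have "dart_angle fst p d d' \<le> dart_angle fst p d e"
    using succ e unfolding vertex_succ_def by blast
  also have "\<dots> < 2 * pi"
    using noncrossing_directions_distinct[OF noncrossing_p dart_ends(4)] dD e by metis
  finally have less: "dart_angle fst p d d' < 2 * pi" .
  have ge: "pi \<le> dart_angle fst p d d'"
  proof (rule ccontr)
    let ?\<alpha> = "ccw_angle (dir d) (dir d')"
    assume "\<not> pi \<le> dart_angle fst p d d'"
    then have \<alpha>: "?\<alpha> < pi"
      by (simp add: dart_angle_eq)
    have "0 \<le> cos (?\<phi> d)" if "?\<phi> d \<le> pi / 2"
      using that ccw_angle_pos[of "dir d" n] by (intro cos_ge_zero) auto
    moreover have "cos (?\<phi> d) < 0"
      using down[OF d(1)] cross_ccw_angle(2)[OF nz(1) n0] nz n0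
      by (simp add: inner_commute mult_less_0_iff)
    ultimately have \<phi>: "pi / 2 < ?\<phi> d"
      by fastforce
    show False
    proof (cases "?\<alpha> < ?\<phi> d")
      case True
      then have "?\<phi> d' = ?\<phi> d - ?\<alpha>"
        by (intro ccw_angle_diff nz n0)
      then show False
        using d(2)[of d'] d' ccw_angle_pos[of "dir d" "dir d'"] by simp
    next
      case False
      let ?x = "ccw_angle n (dir d')"
      have "?\<alpha> = (let s = ?\<phi> d + ?x in if s \<le> 2 * pi then s else s - 2 * pi)"
        by (rule ccw_angle_add[OF nz(1) n0 nz(2)])
      then have "?x < pi / 2 \<or> ?x = 2 * pi"
        using False \<alpha> \<phi> ccw_angle_le[of n "dir d'"] by (auto simp: Let_def split: if_splits)
      then have "0 < cos ?x"
        using ccw_angle_pos[of n "dir d'"] cos_gt_zero[of ?x] by (elim disjE) simp_all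
      then have "0 < inner n (dir d')"
        using cross_ccw_angle(2)[OF n0 nz(2)] n0 nz(2) by simp
      then show False
        using down[of d'] d' by simp
    qed
  qed
  have free: "cross (dir d) (dir x) \<le> 0" if "x \<in> D" "fst x = fst d" for x
  proof -
    have "pi \<le> ccw_angle (dir d) (dir x)"
      using succ that ge unfolding vertex_succ_def dart_angle_eq by force
    then show ?thesis
      using cross_pos_iff[OF nz(1) dir_nonzero[OF that(1)]] by simp
  qed
  obtain r where r: "0 < r" "left_half_disc (dir d) (p (fst d)) r \<subseteq> Lf d"
    by (rule vertex_half_disc[OF dD(1) free])
  (* The direction i * dir d + t * dir d points to the left of d and, since t is negative
     enough, beyond the supporting line. *)
  define t where "t = (1 + \<bar>inner n (\<i> * dir d)\<bar>) / inner n (dir d)"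
  have t: "inner n (\<i> * dir d + t *\<^sub>R dir d) > 0"
    using down[OF d(1)] by (simp add: inner_add_right t_def)
  obtain s where s: "0 < s" "s * ((1 + \<bar>t\<bar>) * cmod (dir d)) < r"
    using small_step[of r "(1 + \<bar>t\<bar>) * cmod (dir d)"] r(1) by auto
  define x where "x = p u + s *\<^sub>R (\<i> * dir d + t *\<^sub>R dir d)"
  have "x \<in> left_half_disc (dir d) (p (fst d)) r"
    unfolding x_def dD(2)[symmetric] by (rule left_half_disc_point[OF nz(1) s(1)]) (use s(2) in \<open>simp only: mult.assoc\<close>)
  then have "x \<in> Lf d"
    using r(2) by blast
  moreover have "x \<in> Out"
  proof (rule half_plane_in_outer[OF n0])
    show "inner n (p j - p u) \<le> 0" if "j \<in> V" for j
      using n[OF that] by (cases "j = u") auto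
    show "0 < inner n (x - p u)"
      using t s(1) by (simp add: x_def)
  qed
  ultimately have "Lf d = Out"
    using face_unique left_face_props(1)[OF dD(1)] outer_is_face by blast
  then show thesis
    using that succ dD(2) ge less by blast
qed

text \<open>
  The ends of a diameter of the vertex set are extreme vertices.
\<close>

lemma two_hull_corners:
  obtains d1 d1' d2 d2' where
    "vertex_succ D fst p d1 d1'" "pi \<le> dart_angle fst p d1 d1'" "dart_angle fst p d1 d1' < 2 * pi" "Lf d1 = Out"
    "vertex_succ D fst p d2 d2'" "pi \<le> dart_angle fst p d2 d2'" "dart_angle fst p d2 d2' < 2 * pi" "Lf d2 = Out"
    "fst d1 \<noteq> fst d2"
proof -
  define f where "f a = dist (p (fst a)) (p (snd a))" for a
  have "V \<noteq> {}"
    using card_V by auto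
  then have "Max (f ` (V \<times> V)) \<in> f ` (V \<times> V)"
    using finite_V by (intro Max_in) auto
  then obtain a where a: "a \<in> V \<times> V" "f a = Max (f ` (V \<times> V))"
    by (metis imageE)
  define u1 u2 where "u1 = fst a" and "u2 = snd a"
  have u: "u1 \<in> V" "u2 \<in> V"
    using a(1) by (auto simp: u1_def u2_def)
  have le: "dist (p i) (p j) \<le> dist (p u1) (p u2)" if "i \<in> V" "j \<in> V" for i j
  proof -
    have "f (i, j) \<le> f a"
      unfolding a(2) using finite_V that by (intro Max_ge) auto
    then show ?thesis
      by (simp add: f_def u1_def u2_def)
  qed
  have ext: "inner (p x - p y) (p j - p x) < 0"
    if "j \<in> V" "j \<noteq> x" "x \<in> V" "dist (p j) (p y) \<le> dist (p x) (p y)" for j x y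
  proof -
    let ?w = "p j - p x" and ?n = "p x - p y"
    have "(cmod (?n + ?w))\<^sup>2 \<le> (cmod ?n)\<^sup>2"
      using that(4) by (intro power_mono) (simp_all add: dist_norm)
    moreover have "(cmod (?n + ?w))\<^sup>2 = (cmod ?n)\<^sup>2 + 2 * inner ?n ?w + (cmod ?w)\<^sup>2"
      by (simp only: power2_norm_eq_inner inner_add_left inner_add_right inner_commute)
    moreover have "?w \<noteq> 0"
      using inj_p that(1-3) by (metis inj_onD right_minus_eq)
    then have "0 < (cmod ?w)\<^sup>2"
      by simp
    ultimately show ?thesis
      by linarith
  qed
  obtain j where "j \<in> V" "j \<noteq> u1"
    using two_darts[OF u(1)] dart_ends by metis
  then have "p j \<noteq> p u1"
    using inj_p u(1) by (metis inj_onD)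
  then have "0 < dist (p j) (p u1)"
    by simp
  also have "\<dots> \<le> dist (p u1) (p u2)"
    using le u \<open>j \<in> V\<close> by blast
  finally have "u1 \<noteq> u2"
    by auto
  have e1: "inner (p u1 - p u2) (p j - p u1) < 0" if "j \<in> V" "j \<noteq> u1" for j
    using ext[OF that u(1)] le u that(1) by blast
  have e2: "inner (p u2 - p u1) (p j - p u2) < 0" if "j \<in> V" "j \<noteq> u2" for j
    using ext[OF that u(2), of u1] le[OF that(1) u(1)] by (simp add: dist_commute)
  show thesis
    using hull_corner[OF u(1) e1] hull_corner[OF u(2) e2] that \<open>u1 \<noteq> u2\<close> by metis
qed

lemma boundary_dart: "d \<in> D \<Longrightarrow> Lf d = Out \<Longrightarrow> {fst d, snd d} \<in> boundary_edges V E p"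
  unfolding boundary_edges_def by (cases d) (auto simp: darts_def)

end

section \<open>Liftings of good self-stresses\<close>

text \<open>
  The witnesses in the definitions of a good self-stress and of its standard lifting are fixed
  here.
\<close>

locale good_lifting = plane_framework V E p
  for V :: "'v set" and E :: "'v set set" and p :: "'v \<Rightarrow> complex" +
  fixes \<omega> :: "'v set \<Rightarrow> real" and r :: "complex set \<Rightarrow> complex" and h :: "complex \<Rightarrow> real"
    and g :: "complex set \<Rightarrow> complex" and c :: real
  assumes stress_nonzero: "e \<in> E \<Longrightarrow> \<omega> e \<noteq> 0"
    and recip: "reciprocal V E p \<omega> r" and nc_recip: "noncrossing_reciprocal V E p r"
    and cont_h: "continuous_on UNIV h" and outer_zero: "x \<in> outer_face V E p \<Longrightarrow> h x = 0"
    and c: "c \<in> {1, - 1}" and valley: "e \<in> boundary_edges V E p \<Longrightarrow> 0 < c * \<omega> e"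
    and affine: "F \<in> faces V E p \<Longrightarrow> \<exists>b. \<forall>x\<in>F. h x = inner (g F) x + b"
    and gradient_jump: "(i, j) \<in> darts E \<Longrightarrow>
      g (left_face V E p (i, j)) - g (right_face V E p (i, j)) = (c * \<omega> {i, j}) *\<^sub>R (\<i> * (p j - p i))"
begin

abbreviation \<kappa> :: "'v \<times> 'v \<Rightarrow> real" where "\<kappa> d \<equiv> c * \<omega> {fst d, snd d}"

lemma c_nonzero: "c \<noteq> 0"
  using c by auto

lemma kappa_nonzero: "d \<in> D \<Longrightarrow> \<kappa> d \<noteq> 0"
  using stress_nonzero c_nonzero by (simp add: dart_iff)

lemma jump: "d \<in> D \<Longrightarrow> g (Lf d) - g (Lf (prod.swap d)) = \<kappa> d *\<^sub>R (\<i> * dir d)"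
  using gradient_jump[of "fst d" "snd d"] by simp

lemma reciprocal_edge: "d \<in> D \<Longrightarrow> r (Lf d) - r (Lf (prod.swap d)) = \<omega> {fst d, snd d} *\<^sub>R dir d"
  using recip unfolding reciprocal_def by (cases d) auto

lemma affine_closure:
  assumes "F \<in> Fs" obtains b where "\<And>x. x \<in> closure F \<Longrightarrow> h x = inner (g F) x + b"
proof -
  obtain b where b: "\<forall>x\<in>F. h x = inner (g F) x + b"
    using affine[OF assms] by blast
  have "closed {x. h x = inner (g F) x + b}"
    by (intro closed_Collect_eq cont_h continuous_intros)
  then have "closure F \<subseteq> {x. h x = inner (g F) x + b}"
    using b by (intro closure_minimal) auto
  then show thesis
    using that by blast
qed

lemma affine_difference:
  assumes "F \<in> Fs" "x \<in> closure F" "y \<in> closure F"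
  shows "h y - h x = inner (g F) (y - x)"
proof -
  obtain b where "\<And>x. x \<in> closure F \<Longrightarrow> h x = inner (g F) x + b"
    using affine_closure[OF assms(1)] by blast
  then show ?thesis
    using assms(2,3) by (simp add: inner_diff_right)
qed

lemma slope: assumes "d \<in> D" shows "inner (g (Lf d)) (dir d) = h (p (snd d)) - h (p (fst d))"
  using affine_difference[OF left_face_props(1)[OF assms], of "p (fst d)" "p (snd d)"]
    edge_in_closure[OF assms] by (simp add: subset_iff)

lemma zero_on_closure_outer: assumes "x \<in> closure Out" shows "h x = 0"
proof -
  have "closed {x. h x = 0}"
    by (intro closed_Collect_eq cont_h continuous_intros)
  then have "closure Out \<subseteq> {x. h x = 0}"
    using outer_zero by (intro closure_minimal) auto
  then show ?thesis
    using assms by blast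
qed

lemma gradient_outer: "g Out = 0"
proof -
  obtain x where "x \<in> Out"
    using face_props(4)[OF outer_is_face] by blast
  then obtain e where e: "e > 0" "ball x e \<subseteq> Out"
    using face_props(1)[OF outer_is_face] open_contains_ball by blast
  obtain \<epsilon> where \<epsilon>: "0 < \<epsilon>" "\<epsilon> * cmod (g Out) < e"
    using small_step[of e "cmod (g Out)"] e(1) by auto
  have y: "x + \<epsilon> *\<^sub>R g Out \<in> Out"
    using e(2) \<epsilon> by (auto simp: dist_norm)
  have "0 = inner (g Out) (\<epsilon> *\<^sub>R g Out)"
    using affine_difference[OF outer_is_face, of x "x + \<epsilon> *\<^sub>R g Out"] y \<open>x \<in> Out\<close>
      closure_subset[of Out] outer_zero by (simp add: subset_iff)
  then show ?thesis
    using \<epsilon>(1) by simp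
qed

text \<open>
  Gradients and reciprocal change by proportional vectors across every edge, so they agree up to
  a similarity on the connected dual graph.
\<close>

lemma gradient_reciprocal:
  assumes "F \<in> Fs"
  shows "g F = (complex_of_real c * \<i>) * r F + (- (complex_of_real c * \<i>) * r Out)"
proof -
  have "g F = (complex_of_real c * \<i>) * (r F - r Out)"
  proof (rule dual_connected[OF outer_is_face _ _ assms])
    show "g Out = (complex_of_real c * \<i>) * (r Out - r Out)"
      by (simp add: gradient_outer)
    fix d assume d: "d \<in> D" and eq: "g (Lf d) = (complex_of_real c * \<i>) * (r (Lf d) - r Out)"
    have "g (Lf (prod.swap d)) = g (Lf d) - \<kappa> d *\<^sub>R (\<i> * dir d)"
      using jump[OF d] by (metis diff_diff_eq2 diff_add_cancel add_diff_cancel_left' add.commute)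
    also have "\<kappa> d *\<^sub>R (\<i> * dir d) = (complex_of_real c * \<i>) * (r (Lf d) - r (Lf (prod.swap d)))"
      unfolding reciprocal_edge[OF d] by (simp add: scaleR_conv_of_real)
    finally show "g (Lf (prod.swap d)) = (complex_of_real c * \<i>) * (r (Lf (prod.swap d)) - r Out)"
      unfolding eq by (simp add: algebra_simps)
  qed
  then show ?thesis
    by (simp add: algebra_simps)
qed

lemma noncrossing_r: "noncrossing Fs D Lf r"
  using nc_recip by (simp add: noncrossing_reciprocal_def)

lemma noncrossing_g: "noncrossing Fs D Lf g" "vertex_succ D Lf g = vertex_succ D Lf r"
  using noncrossing_similar[OF noncrossing_r dart_ends(4) _ gradient_reciprocal] c_nonzero by simp_all

lemma left_ne_right: "d \<in> D \<Longrightarrow> Lf d \<noteq> Lf (prod.swap d)"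
  using noncrossing_r by (simp add: noncrossing_def)

text \<open>
  Both edges at a corner of the outer face have the same sign of stress. In an
  orientation-preserving reciprocal an outer angle \<open>\<alpha> \<ge> \<pi>\<close> between
  such edges becomes the dual angle \<open>3 * \<pi> - \<alpha>\<close>.
\<close>

lemma preserving_corner_angle:
  assumes pres: "\<And>d d'. d \<in> D \<Longrightarrow> d' \<in> D \<Longrightarrow> face_succ D fst p d d' \<Longrightarrow> vertex_succ D Lf r d d'"
    and succ: "vertex_succ D fst p d d'" and \<alpha>: "pi \<le> dart_angle fst p d d'" "dart_angle fst p d d' < 2 * pi"
    and L: "Lf d = Out"
  shows "vertex_succ D Lf r (prod.swap d') d" "Lf (prod.swap d') = Out"
    "pi < dart_angle Lf r (prod.swap d') d"
proof -
  have d: "d \<in> D" "d' \<in> D" "prod.swap d' \<in> D"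
    using succ dart_ends(4) by (auto simp: vertex_succ_def)
  have "face_succ D fst p (prod.swap d') d"
    using succ d by (simp add: face_succ_def)
  then show dual: "vertex_succ D Lf r (prod.swap d') d"
    using pres d by blast
  then show L': "Lf (prod.swap d') = Out"
    using L by (simp add: vertex_succ_def)
  have "0 < \<kappa> d" "0 < \<kappa> (prod.swap d')"
    using valley boundary_dart[OF d(1) L] boundary_dart[OF d(3) L'] by blast+
  then have s: "0 < c * \<omega> {fst d, snd d}" "0 < c * \<omega> {fst d', snd d'}"
    by (simp_all add: insert_commute)
  let ?a = "dir d" and ?b = "dir d'"
  have nz: "?a \<noteq> 0" "?b \<noteq> 0" "- ?a \<noteq> 0"
    using dir_nonzero[OF d(1)] dir_nonzero[OF d(2)] by simp_all
  have "dart_angle Lf r (prod.swap d') d = ccw_angle (r (Lf d') - r (Lf (prod.swap d'))) (- (r (Lf d) - r (Lf (prod.swap d))))"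
    by (simp add: dart_angle_def)
  also have "\<dots> = ccw_angle (\<omega> {fst d', snd d'} *\<^sub>R ?b) (- (\<omega> {fst d, snd d} *\<^sub>R ?a))"
    by (simp only: reciprocal_edge[OF d(1)] reciprocal_edge[OF d(2)])
  also have "\<dots> = ccw_angle (complex_of_real c * (\<omega> {fst d', snd d'} *\<^sub>R ?b)) (complex_of_real c * (- (\<omega> {fst d, snd d} *\<^sub>R ?a)))"
    using c_nonzero by (subst ccw_angle_mult) simp_all
  also have "\<dots> = ccw_angle ((c * \<omega> {fst d', snd d'}) *\<^sub>R ?b) ((c * \<omega> {fst d, snd d}) *\<^sub>R (- ?a))"
    by (simp only: scaleR_conv_of_real mult_minus_right of_real_mult mult.assoc)
  also have "\<dots> = ccw_angle ?b (- ?a)"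
    using s by (rule ccw_angle_scale[rotated])
  finally have eq: "dart_angle Lf r (prod.swap d') d = ccw_angle ?b (- ?a)" .
  have aa: "ccw_angle ?a (- ?a) = pi"
    using ccw_angle_unique[of "- ?a" 1 pi ?a] nz by (simp add: rcis_def)
  have "ccw_angle ?b ?a + ccw_angle ?a ?b = 2 * pi \<or> ccw_angle ?b ?a + ccw_angle ?a ?b = 4 * pi"
    using ccw_angle_add[OF nz(2,1,2)] ccw_angle_self[OF nz(2)] by (auto simp: Let_def split: if_splits)
  then have ba: "ccw_angle ?b ?a = 2 * pi - ccw_angle ?a ?b"
    using \<alpha>(2) ccw_angle_le[of ?b ?a] by (auto simp: dart_angle_eq)
  have "ccw_angle ?b (- ?a) = 3 * pi - ccw_angle ?a ?b"
    using ccw_angle_add[OF nz(2,1,3)] aa ba \<alpha>(1) by (simp add: Let_def dart_angle_eq)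
  then show "pi < dart_angle Lf r (prod.swap d') d"
    unfolding eq using \<alpha>(2) by (simp add: dart_angle_eq)
qed

text \<open>
  Two angles greater than \<open>\<pi>\<close> do not fit around the dual vertex of the outer
  face.
\<close>

lemma not_orientation_preserving:
  "\<not> (\<forall>d\<in>D. \<forall>d'\<in>D. face_succ D fst p d d' \<longleftrightarrow> vertex_succ D Lf r d d')"
proof
  assume "\<forall>d\<in>D. \<forall>d'\<in>D. face_succ D fst p d d' \<longleftrightarrow> vertex_succ D Lf r d d'"
  then have pres: "\<And>d d'. d \<in> D \<Longrightarrow> d' \<in> D \<Longrightarrow> face_succ D fst p d d' \<Longrightarrow> vertex_succ D Lf r d d'"
    by blast
  obtain d1 d1' d2 d2' where
    1: "vertex_succ D fst p d1 d1'" "pi \<le> dart_angle fst p d1 d1'" "dart_angle fst p d1 d1' < 2 * pi" "Lf d1 = Out" and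
    2: "vertex_succ D fst p d2 d2'" "pi \<le> dart_angle fst p d2 d2'" "dart_angle fst p d2 d2' < 2 * pi" "Lf d2 = Out"
    and ne: "fst d1 \<noteq> fst d2"
    by (rule two_hull_corners)
  let ?e1 = "prod.swap d1'" and ?e2 = "prod.swap d2'"
  note c1 = preserving_corner_angle[OF pres 1] and c2 = preserving_corner_angle[OF pres 2]
  have e: "?e1 \<in> D" "?e2 \<in> D" "Lf ?e1 = Lf ?e2"
    using c1(1,2) c2(1,2) by (simp_all add: vertex_succ_def)
  have "fst d1' = fst d1" "fst d2' = fst d2"
    using 1(1) 2(1) by (simp_all add: vertex_succ_def)
  then have "?e1 \<noteq> ?e2"
    using ne by (metis snd_swap)
  then have lt: "dart_angle Lf r ?e1 ?e2 < 2 * pi" "dart_angle Lf r ?e2 ?e1 < 2 * pi"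
    using noncrossing_directions_distinct[OF noncrossing_r dart_ends(4)] e by metis+
  have "dart_angle Lf r ?e1 d1 \<le> dart_angle Lf r ?e1 ?e2" "dart_angle Lf r ?e2 d2 \<le> dart_angle Lf r ?e2 ?e1"
    using c1(1) c2(1) e by (simp_all add: vertex_succ_def)
  then have gt: "pi < dart_angle Lf r ?e1 ?e2" "pi < dart_angle Lf r ?e2 ?e1"
    using c1(3) c2(3) by linarith+
  let ?a = "r (Lf (prod.swap ?e1)) - r (Lf ?e1)" and ?b = "r (Lf (prod.swap ?e2)) - r (Lf ?e2)"
  have nz: "?a \<noteq> 0" "?b \<noteq> 0"
    using reciprocal_edge[OF e(1)] reciprocal_edge[OF e(2)] dir_nonzero[OF e(1)] dir_nonzero[OF e(2)]
      stress_nonzero e(1,2) unfolding dart_iff by (metis eq_iff_diff_eq_0 scaleR_eq_0_iff)+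
  have "ccw_angle ?a ?a = 2 * pi"
    using nz(1) by (rule ccw_angle_self)
  then have "ccw_angle ?a ?b + ccw_angle ?b ?a = 2 * pi \<or> ccw_angle ?a ?b + ccw_angle ?b ?a = 4 * pi"
    using ccw_angle_add[OF nz nz(1)] by (auto simp: Let_def split: if_splits)
  then show False
    using lt gt unfolding dart_angle_def by linarith
qed

lemma orientation_reversing:
  assumes succ: "vertex_succ D fst p d d'" shows "vertex_succ D Lf g d (prod.swap d')"
proof -
  have "dual_embedding V E p r"
    using nc_recip by (simp add: noncrossing_reciprocal_def)
  then have rev: "\<forall>d\<in>D. \<forall>d'\<in>D. face_succ D fst p d d' \<longleftrightarrow> vertex_succ D Lf r d' d"
    using not_orientation_preserving unfolding dual_embedding_def Let_def by blast
  have d: "d \<in> D" "prod.swap d' \<in> D"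
    using succ dart_ends(4) by (auto simp: vertex_succ_def)
  then have "face_succ D fst p (prod.swap d') d"
    using succ by (simp add: face_succ_def)
  then show ?thesis
    unfolding noncrossing_g(2) using rev d by blast
qed

sublocale diagram: reciprocal_diagram D p Fs Lf g \<kappa> "\<lambda>i. h (p i)"
proof
  show "finite D"
    by (rule finite_D)
  show "prod.swap d \<in> D" if "d \<in> D" for d
    using that by (rule dart_ends(4))
  show "p (fst d) \<noteq> p (snd d)" if "d \<in> D" for d
    using dir_nonzero[OF that] by auto
  show "dart_angle fst p d d' < 2 * pi" if "d \<in> D" "d' \<in> D" "fst d = fst d'" "d \<noteq> d'" for d d'
    using noncrossing_directions_distinct[OF noncrossing_p dart_ends(4)] that by blast
  show "\<exists>d'\<in>D. fst d' = fst d \<and> d' \<noteq> d" if "d \<in> D" for d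
    using that by (rule degree_two)
  show "noncrossing Fs D Lf g"
    by (rule noncrossing_g)
  show "g (Lf d) - g (Lf (prod.swap d)) = \<kappa> d *\<^sub>R (\<i> * dir d)" if "d \<in> D" for d
    using that by (rule jump)
  show "inner (g (Lf d)) (dir d) = h (p (snd d)) - h (p (fst d))" if "d \<in> D" for d
    using that by (rule slope)
  show "vertex_succ D Lf g d (prod.swap d')" if "vertex_succ D fst p d d'" for d d'
    using that by (rule orientation_reversing)
  show "Q F'" if "F \<in> Fs" "Q F" "\<And>d. d \<in> D \<Longrightarrow> Q (Lf d) \<Longrightarrow> Q (Lf (prod.swap d))" "F' \<in> Fs" for F Q F'
    using dual_connected[of F Q F'] that by blast
qed

text \<open>
  Maxima have positive and minima negative \<open>\<sigma>\<close>.
\<close>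

definition extremum_sign :: "real \<Rightarrow> complex \<Rightarrow> bool" where
  "extremum_sign \<sigma> q \<longleftrightarrow> \<sigma> \<noteq> 0 \<and> (\<exists>e>0. \<forall>x\<in>ball q e. \<sigma> * (h x - h q) \<le> 0)"

lemma weak_local_extremum_sign: assumes "weak_local_extremum h q" obtains \<sigma> where "extremum_sign \<sigma> q"
proof -
  obtain e where "e > 0" "(\<forall>x\<in>ball q e. h x \<le> h q) \<or> (\<forall>x\<in>ball q e. h x \<ge> h q)"
    using assms unfolding weak_local_extremum_def by blast
  then have "extremum_sign 1 q \<or> extremum_sign (- 1) q"
    unfolding extremum_sign_def by auto
  then show thesis
    using that by blast
qed

lemma extremum_beside_edge:
  assumes d: "d \<in> D" and q: "q \<in> closure (Lf d)" and ext: "extremum_sign \<sigma> q"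
    and half: "0 < e" "left_half_disc (dir d) q e \<subseteq> Lf d"
  shows "inner (g (Lf d)) (dir d) = 0" "\<sigma> * inner (g (Lf d)) (\<i> * dir d) \<le> 0"
proof -
  obtain e' where e': "e' > 0" "\<And>x. x \<in> ball q e' \<Longrightarrow> \<sigma> * (h x - h q) \<le> 0" and "\<sigma> \<noteq> 0"
    using ext unfolding extremum_sign_def by blast
  have le: "inner (\<sigma> *\<^sub>R g (Lf d)) (y - q) \<le> 0" if y: "y \<in> left_half_disc (dir d) q (min e e')" for y
  proof -
    have "y \<in> Lf d"
      using y half(2) left_half_disc_mono[OF min.cobounded1] by (meson subsetD)
    then have "h y - h q = inner (g (Lf d)) (y - q)"
      using affine_difference[OF left_face_props(1)[OF d] q] closure_subset by blast
    moreover have "y \<in> ball q e'"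
      using y by (simp add: left_half_disc_def)
    then have "\<sigma> * (h y - h q) \<le> 0"
      by (rule e'(2))
    ultimately show ?thesis
      by simp
  qed
  have pos: "0 < min e e'"
    using half(1) e'(1) by simp
  have "inner (\<sigma> *\<^sub>R g (Lf d)) (dir d) = 0" "inner (\<sigma> *\<^sub>R g (Lf d)) (\<i> * dir d) \<le> 0"
    by (rule linear_nonpos_on_left_half_disc[OF dir_nonzero[OF d] pos], rule le, assumption)+
  then show "inner (g (Lf d)) (dir d) = 0" "\<sigma> * inner (g (Lf d)) (\<i> * dir d) \<le> 0"
    using \<open>\<sigma> \<noteq> 0\<close> by simp_all
qed

lemma no_extremum_in_face:
  assumes F: "F \<in> Fs" "q \<in> F" "F \<noteq> Out" shows "\<not> extremum_sign \<sigma> q"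
proof
  assume "extremum_sign \<sigma> q"
  then obtain e where e: "e > 0" "\<And>x. x \<in> ball q e \<Longrightarrow> \<sigma> * (h x - h q) \<le> 0" and "\<sigma> \<noteq> 0"
    unfolding extremum_sign_def by blast
  obtain e' where e': "e' > 0" "ball q e' \<subseteq> F"
    using face_props(1)[OF F(1)] F(2) open_contains_ball by blast
  have "inner (\<sigma> *\<^sub>R g F) (y - q) \<le> 0" if "y \<in> ball q (min e e')" for y
  proof -
    have "h y - h q = inner (g F) (y - q)"
      using affine_difference[OF F(1), of q y] that e'(2) F(2) closure_subset[of F] by (auto simp: subset_iff)
    then show ?thesis
      using e(2)[of y] that by simp
  qed
  moreover obtain \<epsilon> where \<epsilon>: "0 < \<epsilon>" "\<epsilon> * cmod (\<sigma> *\<^sub>R g F) < min e e'"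
    using small_step[of "min e e'" "cmod (\<sigma> *\<^sub>R g F)"] e(1) e'(1) by auto
  ultimately have "inner (\<sigma> *\<^sub>R g F) (\<epsilon> *\<^sub>R (\<sigma> *\<^sub>R g F)) \<le> 0"
    by (metis add_diff_cancel_left' dist_norm dist_commute mem_ball norm_scaleR abs_of_pos)
  then have "\<epsilon> * inner (\<sigma> *\<^sub>R g F) (\<sigma> *\<^sub>R g F) \<le> 0"
    by (simp only: inner_scaleR_right[of _ \<epsilon>])
  then have "\<sigma> *\<^sub>R g F = 0"
    using \<epsilon>(1) by (metis inner_gt_zero_iff mult_pos_pos not_le)
  then have "g F = g Out"
    using \<open>\<sigma> \<noteq> 0\<close> gradient_outer by simp
  moreover have "inj_on g Fs"
    using noncrossing_g(1) by (simp add: noncrossing_def)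
  ultimately show False
    using F(1,3) outer_is_face by (metis inj_onD)
qed

text \<open>
  The gradients on the two sides of the edge are orthogonal to it and have opposite directions,
  so \<open>0\<close>, the gradient of the outer face, is on the dual edge. In a non-crossing
  reciprocal the outer face is then one of the two sides.
\<close>

lemma no_extremum_in_edge:
  assumes d: "d \<in> D" "q \<in> oseg d" and q: "q \<notin> closure Out" shows "\<not> extremum_sign \<sigma> q"
proof
  assume ext: "extremum_sign \<sigma> q"
  let ?d' = "prod.swap d"
  have d': "?d' \<in> D" "q \<in> oseg ?d'"
    using dart_ends(4)[OF d(1)] d(2) by (simp_all add: open_segment_commute)
  have cl: "q \<in> closure (Lf d)" "q \<in> closure (Lf ?d')"
    using edge_in_closure[OF d(1)] edge_in_closure[OF d'(1)] d(2) d'(2) segment_open_subset_closed by blast+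
  obtain e e' where e: "e > 0" "left_half_disc (dir d) q e \<subseteq> Lf d"
    "e' > 0" "left_half_disc (dir ?d') q e' \<subseteq> Lf ?d'"
    using left_face_props(2)[OF d] left_face_props(2)[OF d'] by blast
  let ?l = "g (Lf d)" and ?r = "g (Lf ?d')" and ?z = "dir d"
  have l: "inner ?l ?z = 0" "\<sigma> * inner ?l (\<i> * ?z) \<le> 0"
    using extremum_beside_edge[OF d(1) cl(1) ext e(1,2)] .
  have "inner ?r (dir ?d') = 0" "\<sigma> * inner ?r (\<i> * dir ?d') \<le> 0"
    using extremum_beside_edge[OF d'(1) cl(2) ext e(3,4)] .
  moreover have "dir ?d' = - ?z" "\<i> * - ?z = - (\<i> * ?z)"
    by (simp_all add: algebra_simps)
  ultimately have r: "inner ?r ?z = 0" "0 \<le> \<sigma> * inner ?r (\<i> * ?z)"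
    by (simp_all only: inner_minus_right mult_minus_right neg_equal_0_iff_equal neg_le_0_iff_le)
  have nz: "?z \<noteq> 0"
    by (rule dir_nonzero[OF d(1)])
  obtain s where s: "?l = s *\<^sub>R (\<i> * ?z)"
    using perp_ex[OF l(1) nz] by blast
  obtain s' where s': "?r = s' *\<^sub>R (\<i> * ?z)"
    using perp_ex[OF r(1) nz] by blast
  have n: "0 < inner (\<i> * ?z) (\<i> * ?z)"
    using nz by simp
  have "\<sigma> \<noteq> 0"
    using ext by (simp add: extremum_sign_def)
  have ss: "\<sigma> * s \<le> 0" "0 \<le> \<sigma> * s'"
    using l(2) r(2) n unfolding s s' inner_scaleR_left mult.assoc[symmetric]
    by (simp_all only: mult_le_0_iff zero_le_mult_iff) (metis less_le_not_le)+
  have ne: "s - s' \<noteq> 0"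
    using jump[OF d(1)] kappa_nonzero[OF d(1)] nz unfolding s s'
    by (metis diff_self eq_iff_diff_eq_0 mult_eq_0_iff scaleR_eq_0_iff complex_i_not_zero)
  have "0 \<in> closed_segment (0 + s *\<^sub>R (\<i> * ?z)) (0 + s' *\<^sub>R (\<i> * ?z))"
    by (rule between_on_line[OF ss \<open>\<sigma> \<noteq> 0\<close>]) (use ne in simp)
  then have "g Out \<in> dart_segment Lf g d"
    unfolding dart_segment_def gradient_outer by (simp only: s s' add_0_left)
  then have "Out \<in> dart_ends Lf d"
    using noncrossing_g(1) d(1) outer_is_face unfolding noncrossing_def by simp
  then show False
    using cl q by (auto simp: dart_ends_def)
qed

text \<open>
  An edge along which \<open>h\<close> is constant would have extrema in its interior. At an
  angle of at least \<open>\<pi>\<close> a half disc with diameter along \<open>d\<close> lies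
  in one face, and an extremum of a linear function at the centre of a half disc forces slope
  \<open>0\<close> along the diameter. The cell contains \<open>0\<close>, the gradient of the
  outer face.
\<close>

lemma extremum_vertex_peak:
  assumes u: "u \<in> V" and ext: "extremum_sign \<sigma> (p u)" and q: "p u \<notin> closure Out"
  shows "diagram.peak \<sigma> u"
proof -
  obtain e where e: "e > 0" "\<And>x. x \<in> ball (p u) e \<Longrightarrow> \<sigma> * (h x - h (p u)) \<le> 0" and "\<sigma> \<noteq> 0"
    using ext unfolding extremum_sign_def by blast
  obtain d1 where d1: "d1 \<in> D" "fst d1 = u"
    using two_darts[OF u] by metis
  have along: "h (p u + t *\<^sub>R dir d) - h (p u) = t * diagram.rise d"
    if "d \<in> D" "fst d = u" "0 \<le> t" "t \<le> 1" for d t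
  proof -
    have eq: "p u + t *\<^sub>R dir d = (1 - t) *\<^sub>R p (fst d) + t *\<^sub>R p (snd d)"
      using that(2) by (simp add: algebra_simps)
    have "p u + t *\<^sub>R dir d \<in> seg d"
      unfolding eq in_segment using that(3,4) by blast
    then have "p u + t *\<^sub>R dir d \<in> closure (Lf d)" "p u \<in> closure (Lf d)"
      using edge_in_closure[OF that(1)] that(2) by auto
    then have "h (p u + t *\<^sub>R dir d) - h (p u) = inner (g (Lf d)) (p u + t *\<^sub>R dir d - p u)"
      using affine_difference[OF left_face_props(1)[OF that(1)]] by blast
    then show ?thesis
      using slope[OF that(1)] by simp
  qed
  have rise: "\<sigma> * diagram.rise d \<le> 0" "diagram.rise d \<noteq> 0" if d: "d \<in> D" "fst d = u" for d
  proof -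
    have "open (- closure Out)"
      by auto
    then obtain e1 where e1: "e1 > 0" "ball (p u) e1 \<subseteq> - closure Out"
      using q open_contains_ball by blast
    obtain t where t: "0 < t" "t * cmod (dir d) < min e e1" "t < 1"
      using small_step[of "min e e1" "cmod (dir d)"] e(1) e1(1) by auto
    let ?x = "p u + t *\<^sub>R dir d"
    have x: "?x \<in> ball (p u) e" "?x \<in> ball (p u) e1"
      using t by (simp_all add: dist_norm)
    have hx: "h ?x - h (p u) = t * diagram.rise d"
      using along[OF d] t by simp
    have "t * (\<sigma> * diagram.rise d) \<le> 0"
      using e(2)[OF x(1)] hx by (simp add: mult.left_commute)
    then show "\<sigma> * diagram.rise d \<le> 0"
      using t(1) by (metis linorder_not_le mult_pos_pos)
    show "diagram.rise d \<noteq> 0"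
    proof
      assume "diagram.rise d = 0"
      then have "h ?x = h (p u)"
        using hx by simp
      obtain e2 where e2: "e2 > 0" "ball ?x e2 \<subseteq> ball (p u) e"
        using x(1) open_ball open_contains_ball by blast
      have "extremum_sign \<sigma> ?x"
        unfolding extremum_sign_def using \<open>\<sigma> \<noteq> 0\<close> e2 e(2) \<open>h ?x = h (p u)\<close> by (metis subsetD)
      moreover have "?x = (1 - t) *\<^sub>R p (fst d) + t *\<^sub>R p (snd d)"
        using d(2) by (simp add: algebra_simps)
      then have "?x \<in> oseg d"
        unfolding in_segment using t dir_nonzero[OF d(1)] by auto
      moreover have "?x \<notin> closure Out"
        using x(2) e1(2) by blast
      ultimately show False
        using no_extremum_in_edge[OF d(1)] by blast
    qed
  qed
  have "diagram.convex_star u"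
    unfolding diagram.convex_star_def
  proof (intro allI impI)
    fix d d' assume dd: "vertex_succ D fst p d d' \<and> fst d = u"
    then have d: "d \<in> D" "fst d = u"
      by (auto simp: vertex_succ_def)
    show "dart_angle fst p d d' < pi"
    proof (rule ccontr)
      assume ge: "\<not> dart_angle fst p d d' < pi"
      have free: "cross (dir d) (dir x) \<le> 0" if "x \<in> D" "fst x = fst d" for x
      proof -
        have "dart_angle fst p d d' \<le> dart_angle fst p d x"
          using dd that by (simp add: vertex_succ_def)
        then show ?thesis
          using ge cross_pos_iff[OF dir_nonzero[OF d(1)] dir_nonzero[OF that(1)]]
          unfolding dart_angle_eq by linarith
      qed
      obtain e3 where e3: "0 < e3" "left_half_disc (dir d) (p (fst d)) e3 \<subseteq> Lf d"
        by (rule vertex_half_disc[OF d(1) free])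
      have "p (fst d) \<in> closure (Lf d)"
        using edge_in_closure[OF d(1)] by auto
      then have "inner (g (Lf d)) (dir d) = 0"
        using extremum_beside_edge(1)[OF d(1) _ _ e3] ext d(2) by simp
      then show False
        using slope[OF d(1)] rise(2)[OF d] by simp
    qed
  qed
  moreover have "g Out \<in> diagram.cell \<sigma> u"
    unfolding diagram.cell_def gradient_outer
  proof (intro CollectI ballI impI)
    fix d assume "d \<in> D" "fst d = u"
    then show "0 \<le> \<sigma> * (inner 0 (dir d) - diagram.rise d)"
      using rise(1)[of d] by (simp only: inner_zero_left diff_0 mult_minus_right neg_0_le_iff_le)
  qed
  ultimately show ?thesis
    unfolding diagram.peak_def using \<open>\<sigma> \<noteq> 0\<close> d1 outer_is_face by blast
qed

lemma extremum_is_peak: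
  assumes ext: "weak_local_extremum h q" and q: "q \<notin> closure Out"
  obtains u \<sigma> where "u \<in> V" "q = p u" "diagram.peak \<sigma> u"
proof -
  obtain \<sigma> where \<sigma>: "extremum_sign \<sigma> q"
    by (rule weak_local_extremum_sign[OF ext])
  have "q \<in> dr"
  proof (rule ccontr)
    assume "q \<notin> dr"
    then obtain F where "F \<in> Fs" "q \<in> F"
      using ex_face by blast
    then show False
      using no_extremum_in_face \<sigma> q closure_subset by blast
  qed
  moreover have "q \<notin> oseg d" if "d \<in> D" for d
    using no_extremum_in_edge[OF that _ q] \<sigma> by blast
  ultimately have "q \<in> p ` V"
    using edge_point[of q] by blast
  then obtain u where u: "u \<in> V" "q = p u"
    by blast
  then show thesis
    using that[OF u, of \<sigma>] extremum_vertex_peak[of u \<sigma>] \<sigma> q by simp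
qed

text \<open>
  Since \<open>c\<close> is \<open>1\<close> or \<open>-1\<close>, the stress and the gradient
  jumps have equal or opposite signs throughout.
\<close>

lemma distinguished_peak:
  assumes "distinguished_vertex V E p \<omega> v"
  obtains \<sigma> where "diagram.peak \<sigma> v"
proof -
  have v: "v \<in> V" "\<not> pointed E p v"
    and s: "(\<forall>e\<in>E. v \<in> e \<longrightarrow> \<omega> e > 0) \<or> (\<forall>e\<in>E. v \<in> e \<longrightarrow> \<omega> e < 0)"
    using assms by (simp_all add: distinguished_vertex_def)
  have cc: "c * (c * x) = x" for x
    using c by auto
  obtain \<sigma> where "\<sigma> \<noteq> 0" and sign: "\<And>e. e \<in> E \<Longrightarrow> v \<in> e \<Longrightarrow> \<sigma> * (c * \<omega> e) < 0"
  proof (cases "\<forall>e\<in>E. v \<in> e \<longrightarrow> \<omega> e > 0")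
    case True
    have neg: "(- c) * (c * \<omega> e) < 0" if "e \<in> E" "v \<in> e" for e
      using True that by (simp add: cc)
    show ?thesis
      by (rule that[of "- c"]) (use c_nonzero in simp, rule neg)
  next
    case False
    have neg: "c * (c * \<omega> e) < 0" if "e \<in> E" "v \<in> e" for e
      using False s that by (auto simp: cc)
    show ?thesis
      by (rule that[of c]) (use c_nonzero in simp, rule neg)
  qed
  obtain d0 where d0: "d0 \<in> D" "fst d0 = v"
    using two_darts[OF v(1)] by metis
  note flat = noncrossing_p[unfolded noncrossing_def, THEN conjunct2, THEN conjunct2, THEN conjunct2, THEN conjunct2]
  have "diagram.peak \<sigma> v"
  proof (rule diagram.monochromatic_nonpointed_peak[OF \<open>\<sigma> \<noteq> 0\<close> d0])
    show "\<sigma> * \<kappa> d < 0" if "d \<in> D" "fst d = v" for d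
      using sign[of "{fst d, snd d}"] that by (simp add: dart_iff)
    show "dart_angle fst p d d' \<le> pi" if "vertex_succ D fst p d d'" "fst d = v" for d d'
      using v(2) that unfolding pointed_def by (metis linorder_not_le)
    show "d1 = d2" if "vertex_succ D fst p d1 d1'" "vertex_succ D fst p d2 d2'" "fst d1 = v" "fst d2 = v"
      "dart_angle fst p d1 d1' = pi" "dart_angle fst p d2 d2' = pi" for d1 d1' d2 d2'
    proof (rule ccontr)
      assume "d1 \<noteq> d2"
      then show False
        using that
        by - (rule flat[THEN notE], rule exI[of _ d1], rule exI[of _ d1'], rule exI[of _ d2],
            rule exI[of _ d2'], simp)
    qed
  qed
  then show thesis
    by (rule that)
qed

text \<open>
  Boundary edges are valleys and the outer face is flat, so the surface rises on their inner
  side.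
\<close>

lemma positive_somewhere: obtains y where "0 < h y"
proof -
  obtain d1 d1' d2 d2' where "vertex_succ D fst p d1 d1'" and L: "Lf d1 = Out"
    using two_hull_corners by metis
  then have d: "d1 \<in> D"
    by (simp add: vertex_succ_def)
  let ?d' = "prod.swap d1" and ?m = "midpoint (p (fst d1)) (p (snd d1))"
  have d': "?d' \<in> D" "?m \<in> oseg ?d'" "?m \<in> seg d1" "?m \<in> seg ?d'"
    using dart_ends(4)[OF d] dir_nonzero[OF d]
    by (simp_all add: midpoint_in_open_segment open_segment_commute closed_segment_commute)
  obtain e where e: "e > 0" "left_half_disc (dir ?d') ?m e \<subseteq> Lf ?d'"
    using left_face_props(2)[OF d'(1,2)] by blast
  obtain \<epsilon> where \<epsilon>: "0 < \<epsilon>" "\<epsilon> * cmod (dir ?d') < e"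
    using small_step[of e "cmod (dir ?d')"] e(1) by auto
  let ?y = "?m + \<epsilon> *\<^sub>R (\<i> * dir ?d' + 0 *\<^sub>R dir ?d')"
  have "?y \<in> left_half_disc (dir ?d') ?m e"
    using \<epsilon> by (intro left_half_disc_point dir_nonzero[OF d'(1)]) simp_all
  then have y: "?y \<in> Lf ?d'"
    using e(2) by blast
  have "h ?m = 0"
    using edge_in_closure[OF d] d'(3) unfolding L by (intro zero_on_closure_outer) (rule subsetD)
  moreover have "h ?y - h ?m = inner (g (Lf ?d')) (?y - ?m)"
    using affine_difference[OF left_face_props(1)[OF d'(1)]] y edge_in_closure[OF d'(1)] d'(4) closure_subset
    by blast
  moreover have "g (Lf ?d') = (- \<kappa> d1) *\<^sub>R (\<i> * dir d1)"
    using jump[OF d] L gradient_outer by (simp add: algebra_simps)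
  moreover have "?y - ?m = (- \<epsilon>) *\<^sub>R (\<i> * dir d1)"
    by (simp add: algebra_simps)
  ultimately have "h ?y = (\<kappa> d1 * \<epsilon>) * inner (\<i> * dir d1) (\<i> * dir d1)"
    by (simp only: inner_scaleR_left inner_scaleR_right) (simp add: algebra_simps)
  moreover have "0 < \<kappa> d1"
    using valley boundary_dart[OF d L] by blast
  ultimately have "0 < h ?y"
    using \<epsilon>(1) dir_nonzero[OF d] by simp
  then show thesis
    by (rule that)
qed

lemma complement_outer_compact: "compact (- Out)"
  using bounded_complement_outer face_props(1)[OF outer_is_face]
  by (simp add: compact_eq_bounded_closed closed_Compl)

lemma attains_extrema:
  obtains x y where "0 < h x" "\<forall>z. h z \<le> h x" "\<forall>z. h y \<le> h z \<or> (h z = 0 \<and> 0 \<le> h y)"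
proof -
  obtain w where w: "0 < h w"
    by (rule positive_somewhere)
  then have wO: "w \<in> - Out"
    using outer_zero by force
  obtain x where x: "x \<in> - Out" "\<And>z. z \<in> - Out \<Longrightarrow> h z \<le> h x"
    using continuous_attains_sup[OF complement_outer_compact _ continuous_on_subset[OF cont_h]] wO by blast
  obtain y where y: "y \<in> - Out" "\<And>z. z \<in> - Out \<Longrightarrow> h y \<le> h z"
    using continuous_attains_inf[OF complement_outer_compact _ continuous_on_subset[OF cont_h]] wO by blast
  show thesis
  proof (rule that)
    show pos: "0 < h x"
      using x(2)[OF wO] w by simp
    show "\<forall>z. h z \<le> h x"
      using x(2) outer_zero pos by (metis Compl_iff less_imp_le)
    show "\<forall>z. h y \<le> h z \<or> (h z = 0 \<and> 0 \<le> h y)"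
      using y(2) outer_zero by (metis Compl_iff linorder_not_le less_imp_le)
  qed
qed

text \<open>
  A segment through \<open>q\<close> coincides near \<open>q\<close> with one or two rays from
  \<open>q\<close>.
\<close>

lemma conic_drawing: "\<exists>e>0. \<forall>x\<in>ball q e. \<forall>t\<in>{0<..1}. q + t *\<^sub>R (x - q) \<in> dr \<longrightarrow> x \<in> dr"
proof -
  have single: "\<exists>e>0. \<forall>x\<in>ball q e. \<forall>t\<in>{0<..1}. q + t *\<^sub>R (x - q) \<in> seg d \<longrightarrow> x \<in> seg d" if d: "d \<in> D" for d
  proof (cases "q \<in> seg d")
    case False
    then obtain e where e: "e > 0" "\<And>x. x \<in> seg d \<Longrightarrow> e \<le> dist q x"
      using separate_point_closed[of "seg d" q] by auto
    have "q + t *\<^sub>R (x - q) \<notin> seg d" if "x \<in> ball q e" "t \<in> {0<..1}" for x t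
    proof -
      have "t * cmod (x - q) \<le> 1 * cmod (x - q)"
        using that by (intro mult_right_mono) auto
      then have "dist q (q + t *\<^sub>R (x - q)) < e"
        using that by (simp add: dist_norm norm_minus_commute)
      then show ?thesis
        using e(2) by force
    qed
    then show ?thesis
      using e(1) by blast
  next
    case True
    then obtain \<mu> where \<mu>: "0 \<le> \<mu>" "\<mu> \<le> 1" "q = (1 - \<mu>) *\<^sub>R p (fst d) + \<mu> *\<^sub>R p (snd d)"
      by (auto simp: in_segment)
    define m where "m = min (if 0 < \<mu> then \<mu> else 1) (if \<mu> < 1 then 1 - \<mu> else 1)"
    define e where "e = m * cmod (dir d)"
    have "m > 0"
      using \<mu> by (simp add: m_def)
    then have "e > 0"
      using dir_nonzero[OF d] by (simp add: e_def)
    moreover have "x \<in> seg d" if x: "x \<in> ball q e" and t: "t \<in> {0<..1}" and s: "q + t *\<^sub>R (x - q) \<in> seg d" for x t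
    proof -
      obtain l where l: "0 \<le> l" "l \<le> 1" "q + t *\<^sub>R (x - q) = (1 - l) *\<^sub>R p (fst d) + l *\<^sub>R p (snd d)"
        using s by (auto simp: in_segment)
      define k where "k = (l - \<mu>) / t"
      have "t *\<^sub>R (x - q) = ((1 - l) *\<^sub>R p (fst d) + l *\<^sub>R p (snd d)) - q"
        using l(3) by (metis add_diff_cancel_left')
      also have "\<dots> = (l - \<mu>) *\<^sub>R dir d"
        unfolding \<mu>(3) by (simp add: algebra_simps)
      finally have "t *\<^sub>R (x - q) = (l - \<mu>) *\<^sub>R dir d" .
      then have "x - q = (1 / t) *\<^sub>R ((l - \<mu>) *\<^sub>R dir d)"
        using t by (metis divideR_right greaterThanAtMost_iff inverse_eq_divide less_irrefl)
      then have xq: "x - q = k *\<^sub>R dir d"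
        by (simp add: k_def)
      have "cmod (x - q) < e"
        using x by (simp add: dist_norm norm_minus_commute)
      then have "\<bar>k\<bar> * cmod (dir d) < m * cmod (dir d)"
        unfolding xq e_def norm_scaleR .
      then have km: "\<bar>k\<bar> < m"
        using dir_nonzero[OF d] by simp
      have "0 \<le> \<mu> + k"
      proof (cases "0 < \<mu>")
        case True
        then have "m \<le> \<mu>"
          by (simp add: m_def)
        then show ?thesis using km by linarith
      next
        case False
        then have "0 \<le> k"
          using \<mu> l t by (simp add: k_def)
        then show ?thesis using \<mu> by simp
      qed
      moreover have "\<mu> + k \<le> 1"
      proof (cases "\<mu> < 1")
        case True
        then have "m \<le> 1 - \<mu>"
          by (simp add: m_def)
        then show ?thesis using km by linarith
      next
        case False
        then have "k \<le> 0"
          using \<mu> l t by (simp add: k_def divide_le_0_iff)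
        then show ?thesis using \<mu> by simp
      qed
      moreover have "x = (1 - (\<mu> + k)) *\<^sub>R p (fst d) + (\<mu> + k) *\<^sub>R p (snd d)"
        using xq \<mu>(3) by (simp add: algebra_simps)
      ultimately show ?thesis
        unfolding in_segment by blast
    qed
    ultimately show ?thesis
      by blast
  qed
  then obtain e where e: "\<And>d. d \<in> D \<Longrightarrow> e d > 0"
    "\<And>d x t. d \<in> D \<Longrightarrow> x \<in> ball q (e d) \<Longrightarrow> t \<in> {0<..1} \<Longrightarrow> q + t *\<^sub>R (x - q) \<in> seg d \<Longrightarrow> x \<in> seg d"
    by metis
  define m where "m = Min (insert 1 (e ` D))"
  have "0 < m"
    unfolding m_def using finite_D e(1) by (subst Min_gr_iff) auto
  have m: "m \<le> e d" if "d \<in> D" for d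
    unfolding m_def using finite_D that by (intro Min_le) auto
  have "x \<in> dr" if x: "x \<in> ball q m" "t \<in> {0<..1}" "q + t *\<^sub>R (x - q) \<in> dr" for x t
  proof -
    obtain d where d: "d \<in> D" "q + t *\<^sub>R (x - q) \<in> seg d"
      using x(3) unfolding drawing_eq by blast
    then have "x \<in> seg d"
      using e(2)[OF d(1) _ x(2) d(2)] m[OF d(1)] x(1) by simp
    then show ?thesis
      using d(1) unfolding drawing_eq by blast
  qed
  then show ?thesis
    using \<open>0 < m\<close> by blast
qed

text \<open>
  A point off the drawing is joined to \<open>q\<close> within one face, where \<open>h\<close>
  is affine. The points on the drawing follow by continuity, as the complement of the drawing is
  dense.
\<close>

lemma conic_lifting:
  "\<exists>e>0. \<forall>x\<in>ball q e. \<forall>t\<in>{0..1}. h (q + t *\<^sub>R (x - q)) - h q = t * (h x - h q)"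
proof -
  obtain e where e: "e > 0" "\<And>x t. x \<in> ball q e \<Longrightarrow> t \<in> {0<..1} \<Longrightarrow> q + t *\<^sub>R (x - q) \<in> dr \<Longrightarrow> x \<in> dr"
    using conic_drawing[of q] by blast
  have off: "h (q + t *\<^sub>R (x - q)) - h q = t * (h x - h q)"
    if x: "x \<in> ball q e" "x \<notin> dr" and t: "t \<in> {0..1}" for x t
  proof -
    obtain F where F: "F \<in> Fs" "x \<in> F"
      using ex_face x(2) by blast
    let ?S = "(\<lambda>t. q + t *\<^sub>R (x - q)) ` {0<..1}"
    have "connected ?S"
      by (intro connected_continuous_image continuous_intros) auto
    moreover have "?S \<inter> dr = {}"
      using e(2)[OF x(1)] x(2) by blast
    moreover have "x \<in> ?S"
      by (rule image_eqI[of _ _ 1]) auto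
    ultimately have S: "?S \<subseteq> F"
      using connected_in_face[OF _ _ F(1)] F(2) by blast
    have "(\<lambda>t. q + t *\<^sub>R (x - q)) ` closure {0<..1::real} \<subseteq> closure ?S"
      by (rule image_closure_subset) (auto intro!: continuous_intros closure_subset[THEN subsetD])
    then have "(\<lambda>t. q + t *\<^sub>R (x - q)) ` {0..1} \<subseteq> closure F"
      using closure_mono[OF S] by simp
    then have cl: "q + t *\<^sub>R (x - q) \<in> closure F" if "t \<in> {0..1}" for t
      using that by blast
    have "q \<in> closure F" "x \<in> closure F"
      using cl[of 0] cl[of 1] by simp_all
    then show ?thesis
      using affine_difference[OF F(1) _ cl[OF t]] affine_difference[OF F(1)]
      by (metis add_diff_cancel_left' inner_scaleR_right)
  qed
  have "h (q + t *\<^sub>R (x - q)) - h q = t * (h x - h q)" if x: "x \<in> ball q e" and t: "t \<in> {0..1}" for x t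
  proof -
    let ?Z = "{x. h (q + t *\<^sub>R (x - q)) - h q = t * (h x - h q)}"
    have "closed ?Z"
      by (intro closed_Collect_eq continuous_intros continuous_on_compose2[OF cont_h] cont_h) auto
    moreover have "x \<in> closure (ball q e - dr)"
      unfolding closure_approachable
    proof (intro allI impI)
      fix e' :: real assume "0 < e'"
      have "ball q e \<inter> ball x e' - dr \<noteq> {}"
        using x \<open>0 < e'\<close> by (intro open_meets_complement) auto
      then obtain y where "y \<in> ball q e \<inter> ball x e' - dr"
        by blast
      then have "y \<in> ball q e - dr" "dist y x < e'"
        by (simp_all add: dist_commute)
      then show "\<exists>y\<in>ball q e - dr. dist y x < e'"
        by blast
    qed
    moreover have "ball q e - dr \<subseteq> ?Z"
      using off t by blast
    ultimately show ?thesis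
      using closure_minimal[of "ball q e - dr" ?Z] by blast
  qed
  then show ?thesis
    using e(1) by blast
qed

lemma boundary_cycle_eq: "boundary_cycle V E p = (\<Union>d\<in>{d\<in>D. Lf d = Out}. seg d)"
proof
  show "boundary_cycle V E p \<subseteq> (\<Union>d\<in>{d\<in>D. Lf d = Out}. seg d)"
  proof
    fix x assume "x \<in> boundary_cycle V E p"
    then obtain i j where ij: "{i, j} \<in> E" "Lf (i, j) = Out" "x \<in> convex hull (p ` {i, j})"
      unfolding boundary_cycle_def boundary_edges_def by blast
    then have "(i, j) \<in> {d\<in>D. Lf d = Out}" "x \<in> seg (i, j)"
      by (simp_all add: darts_def segment_convex_hull)
    then show "x \<in> (\<Union>d\<in>{d\<in>D. Lf d = Out}. seg d)"
      by blast
  qed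
  show "(\<Union>d\<in>{d\<in>D. Lf d = Out}. seg d) \<subseteq> boundary_cycle V E p"
  proof
    fix x assume "x \<in> (\<Union>d\<in>{d\<in>D. Lf d = Out}. seg d)"
    then obtain d where d: "d \<in> D" "Lf d = Out" "x \<in> seg d"
      by blast
    then have "x \<in> convex hull (p ` {fst d, snd d})"
      by (simp add: segment_convex_hull)
    then show "x \<in> boundary_cycle V E p"
      using boundary_dart[OF d(1,2)] unfolding boundary_cycle_def by blast
  qed
qed

text \<open>
  Inside an edge, the faces next to it decide whether a point is on the frontier. A vertex on
  the frontier is not an isolated frontier point, since a punctured disc around it is connected
  and contains points of the outer face and points of edges.
\<close>

lemma boundary_cycle_frontier: "boundary_cycle V E p = frontier (- closure Out)"
proof
  let ?\<Omega> = "- closure Out"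
  have fr: "frontier ?\<Omega> = closure ?\<Omega> \<inter> closure Out"
    using interior_open[OF open_Compl[OF closed_closure[of Out]]] unfolding frontier_def by blast
  show "boundary_cycle V E p \<subseteq> frontier ?\<Omega>"
    unfolding boundary_cycle_eq fr
  proof
    fix x assume "x \<in> (\<Union>d\<in>{d\<in>D. Lf d = Out}. seg d)"
    then obtain d where d: "d \<in> D" "Lf d = Out" and x: "x \<in> seg d"
      by blast
    let ?d' = "prod.swap d"
    have d': "?d' \<in> D"
      by (rule dart_ends(4)[OF d(1)])
    have "Lf ?d' \<noteq> Out"
      using left_ne_right[OF d(1)] d(2) by simp
    then have "Lf ?d' \<inter> Out = {}"
      using face_unique left_face_props(1)[OF d'] outer_is_face by blast
    then have "Lf ?d' \<inter> closure Out = {}"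
      using open_Int_closure_eq_empty[of "Lf ?d'" Out] face_props(1)[OF left_face_props(1)[OF d']] by blast
    then have "closure (Lf ?d') \<subseteq> closure ?\<Omega>"
      by (intro closure_mono) blast
    moreover have "x \<in> closure (Lf ?d')" "x \<in> closure Out"
      using edge_in_closure[OF d'] edge_in_closure[OF d(1)] d(2) x
      by (simp_all add: closed_segment_commute subset_iff)
    ultimately show "x \<in> closure ?\<Omega> \<inter> closure Out"
      by blast
  qed
  show "frontier ?\<Omega> \<subseteq> boundary_cycle V E p"
  proof
    have on_edge: "x \<in> boundary_cycle V E p" if x: "x \<in> closure Out" "x \<notin> Out" "x \<notin> p ` V" for x
    proof -
      have "x \<in> dr"
      proof (rule ccontr)
        assume "x \<notin> dr"
        then obtain F where F: "F \<in> Fs" "x \<in> F"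
          using ex_face by blast
        then have "F \<inter> Out \<noteq> {}"
          using x(1) face_props(1)[OF F(1)] open_Int_closure_eq_empty[of F Out] by blast
        then show False
          using face_unique[OF F(1) outer_is_face] F(2) x(2) by blast
      qed
      then obtain d where d: "d \<in> D" "x \<in> oseg d"
        by (rule edge_point[OF _ x(3)])
      obtain e where e: "0 < e" "ball x e \<subseteq> Lf d \<union> Lf (prod.swap d) \<union> seg d"
        by (rule near_edge[OF d])
      obtain y where y: "y \<in> Out" "y \<in> ball x e"
        using x(1) e(1) by (metis closure_approachable mem_ball dist_commute)
      have "y \<notin> seg d"
        using y(1) face_props(3)[OF outer_is_face] d(1) unfolding drawing_eq by blast
      then have "y \<in> Lf d \<or> y \<in> Lf (prod.swap d)"
        using e(2) y(2) by blast
      then have "Lf d = Out \<or> Lf (prod.swap d) = Out"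
        using face_unique[OF _ outer_is_face _ y(1)] left_face_props(1) dart_ends(4)[OF d(1)] d(1) by blast
      moreover have "x \<in> seg d" "x \<in> seg (prod.swap d)"
        using d(2) segment_open_subset_closed by (auto simp: closed_segment_commute)
      ultimately show ?thesis
        unfolding boundary_cycle_eq using d(1) dart_ends(4)[OF d(1)] by blast
    qed
    fix x assume "x \<in> frontier ?\<Omega>"
    then have x: "x \<in> closure ?\<Omega>" "x \<in> closure Out"
      using fr by auto
    have "Out \<inter> ?\<Omega> = {}"
      using closure_subset by blast
    then have "Out \<inter> closure ?\<Omega> = {}"
      using open_Int_closure_eq_empty[of Out ?\<Omega>] face_props(1)[OF outer_is_face] by blast
    then have xO: "x \<notin> Out"
      using x(1) by blast
    show "x \<in> boundary_cycle V E p"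
    proof (rule ccontr)
      assume xB: "x \<notin> boundary_cycle V E p"
      then have "x \<in> p ` V"
        using on_edge x(2) xO by blast
      then obtain i where i: "i \<in> V" "x = p i"
        by blast
      define T where "T = boundary_cycle V E p \<union> (p ` V - {x})"
      have "closed T"
        unfolding T_def boundary_cycle_eq using finite_D finite_V
        by (intro closed_Un closed_UN) (auto intro: finite_imp_closed)
      moreover have "x \<in> - T"
        using xB by (simp add: T_def)
      ultimately obtain e where e: "e > 0" "ball x e \<subseteq> - T"
        by (meson openE open_Compl)
      have conn: "connected (ball x e - {x})"
        by (intro connected_open_delete) auto
      obtain y where "y \<in> Out" "dist y x < e"
        using x(2) e(1) closure_approachable by blast
      then have 1: "(ball x e - {x}) \<inter> Out \<noteq> {}"
        using xO by (auto simp: dist_commute)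
      obtain d where d: "d \<in> D" "fst d = i"
        using two_darts[OF i(1)] by metis
      obtain t where t: "0 < t" "t * cmod (dir d) < e" "t < 1"
        using small_step[of e "cmod (dir d)"] e(1) by auto
      let ?w = "x + t *\<^sub>R dir d"
      have "?w = (1 - t) *\<^sub>R p (fst d) + t *\<^sub>R p (snd d)"
        using d(2) i(2) by (simp add: algebra_simps)
      then have "?w \<in> seg d"
        unfolding in_segment using t by (intro exI[of _ t]) simp
      then have "?w \<notin> Out"
        using face_props(3)[OF outer_is_face] d(1) unfolding drawing_eq by blast
      moreover have "?w \<in> ball x e - {x}"
        using t dir_nonzero[OF d(1)] by (simp add: dist_norm)
      ultimately have 2: "(ball x e - {x}) - Out \<noteq> {}"
        by blast
      obtain w where w: "w \<in> ball x e - {x}" "w \<in> frontier Out"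
        using connected_Int_frontier[OF conn 1 2] by blast
      have "w \<in> closure Out" "w \<notin> Out"
        using w(2) face_props(1)[OF outer_is_face] by (simp_all add: frontier_def interior_open)
      moreover have "w \<notin> p ` V" "w \<notin> boundary_cycle V E p"
        using w(1) e(2) unfolding T_def by blast+
      ultimately show False
        using on_edge by blast
    qed
  qed
qed

end

theorem corollary7:
  fixes V :: "'v set" and E :: "'v set set" and p :: "'v \<Rightarrow> complex"
    and \<omega> :: "'v set \<Rightarrow> real" and h :: "complex \<Rightarrow> real" and v :: 'v
  assumes "noncrossing_framework V E p"
    and "two_connected V E"
    and "good_self_stress V E p \<omega>"
    and "standard_lifting V E p \<omega> h"
    and "distinguished_vertex V E p \<omega> v"
  shows "(\<forall>q. \<not> saddle_point h q) \<and>
    (\<forall>z. 0 < z \<and> z < (SUP x. h x) \<longrightarrow> simple_closed_curve (level_curve h z)) \<and>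
    moves_monotonically (level_curve h) 0 (SUP x. h x) (boundary_cycle V E p) (p v)"
proof -
  obtain r where stress: "\<forall>e\<in>E. \<omega> e \<noteq> 0" and r: "reciprocal V E p \<omega> r" "noncrossing_reciprocal V E p r"
    using assms(3) unfolding good_self_stress_def by blast
  obtain g c where h: "continuous_on UNIV h" "\<forall>x\<in>outer_face V E p. h x = 0"
    and c: "c \<in> {1, - 1}" "\<forall>e\<in>boundary_edges V E p. 0 < c * \<omega> e"
    and g: "\<forall>F\<in>faces V E p. \<exists>b. \<forall>x\<in>F. h x = inner (g F) x + b"
      "\<forall>(i, j)\<in>darts E. g (left_face V E p (i, j)) - g (right_face V E p (i, j)) =
         (c * \<omega> {i, j}) *\<^sub>R (\<i> * (p j - p i))"
    using assms(4) unfolding standard_lifting_def by blast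
  interpret good_lifting V E p \<omega> r h g c
  proof
    show "g (left_face V E p (i, j)) - g (right_face V E p (i, j)) = (c * \<omega> {i, j}) *\<^sub>R (\<i> * (p j - p i))"
      if "(i, j) \<in> darts E" for i j
      using bspec[OF g(2) that] by simp
  qed (use assms(1,2) stress r h c g(1) in simp_all)
  obtain \<sigma> where v: "diagram.peak \<sigma> v"
    by (rule distinguished_peak[OF assms(5)])
  (* Every local extremum off the outer face is a peak, and so is v. *)
  have only: "q = p v" if ext: "weak_local_extremum h q" and q: "q \<notin> closure Out" for q
  proof -
    obtain u \<tau> where "q = p u" "diagram.peak \<tau> u"
      using extremum_is_peak[OF ext q] by metis
    then show ?thesis
      using diagram.peak_unique[OF _ v] by blast
  qed
  have global: "weak_local_extremum h q" if "(\<forall>x. h x \<le> h q) \<or> (\<forall>x. h q \<le> h x)" for q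
    unfolding weak_local_extremum_def using that by (intro exI[of _ 1]) auto
  obtain x y where x: "0 < h x" "\<forall>z. h z \<le> h x"
    and y: "\<forall>z. h y \<le> h z \<or> (h z = 0 \<and> 0 \<le> h y)"
    by (rule attains_extrema)
  have off: "q \<notin> closure Out" if "h q \<noteq> 0" for q
    using that zero_on_closure_outer by blast
  have "x = p v"
    using x by (intro only global off) auto
  then have summit: "0 < h (p v)"
    using x by simp
  (* A negative minimum, and likewise a zero off the outer face, would be a second extremum. *)
  have nonneg: "0 \<le> h z" for z
  proof (rule ccontr)
    assume "\<not> 0 \<le> h z"
    then have "h y < 0"
      using spec[OF y, of z] by auto
    moreover from this have "h y \<le> h w" for w
      using spec[OF y, of w] by auto
    ultimately have "y = p v"
      by (intro only global off) auto
    then show False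
      using \<open>h y < 0\<close> summit by simp
  qed
  have zero: "z \<in> closure Out" if "h z = 0" for z
  proof (rule ccontr)
    assume "z \<notin> closure Out"
    then have "z = p v"
      using that nonneg by (intro only global) auto
    then show False
      using that summit by simp
  qed
  interpret mountain h Out "p v"
  proof
    show "{x. h x = 0} = closure Out"
      using zero zero_on_closure_outer by blast
    show "bounded {x. h x \<noteq> 0}"
      using bounded_complement_outer by (rule bounded_subset) (use outer_zero in blast)
    show "q = p v" if "0 < h q" "weak_local_extremum h q" for q
      using that by (intro only off) auto
  qed (use cont_h nonneg face_props(1,2)[OF outer_is_face] unbounded_outer summit conic_lifting in simp_all)
  have "{x. 0 < h x} = - closure Out"
    using zero zero_on_closure_outer nonneg by (auto simp: less_le)
  then have "boundary_cycle V E p = frontier {x. 0 < h x}"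
    using boundary_cycle_frontier by simp
  then show ?thesis
    unfolding Sup_summit using no_saddle level_simple_closed_curve levels_move_monotonically by simp
qed

end
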